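(* For every tripartite pure state $|\psi\rangle$ on $ABE$, $$M_C(\psi)\ \leq\ E_P^\infty(\psi^{AB}),$$ where $M_C$ is the non-Markovianity cost, $\psi^{AB}={\rm Tr}_E[|\psi\rangle\langle\psi|]$, and $E_P^\infty$ is the regularized entanglement of purification.
   Context: All Hilbert spaces are finite-dimensional. A quantum operation is a linear completely positive trace-preserving (CPTP) map; its input and output Hilbert spaces may differ. Maps act as the identity on systems not mentioned. Three parties Alice, Bob and Eve hold systems $A$, $B$ and $E$ (each possibly composed of several subsystems). $\mathcal{S}_{\rm all}$ is the set of all density operators on $\mathcal{H}^A\otimes\mathcal{H}^B\otimes\mathcal{H}^E$, for arbitrary finite-dimensional spaces. $\Omega$ is the set of all operations that are compositions of operations from the following classes: - $\mathbb{L}_A$, $\mathbb{L}_B$: arbitrary local quantum operations by Alice on $A$, respectively by Bob on $B$. - $\mathbb{R}_E$: local reversible operations by Eve, i.e. quantum operations $\mathcal{V}$ on $E$ for which there is a quantum operation $\mathcal{V}^*$ on Eve's system such that $\mathcal{V}^*\circ\mathcal{V}$ is the identity on states on the input space of $\mathcal{V}$. - $\mathbb{P}_A$: broadcasting of a classical message by Alice. It maps a state $\sum_m p_m|m\rangle\langle m|^{C_A}\otimes\rho_m^{ABE}$, with $C_A$ a register held by Alice ($\{p_m\}$ a probability distribution, $\{|m\rangle\}$ orthonormal), to $\sum_m p_m|m\rangle\langle m|^{C_B}\otimes|m\rangle\langle m|^{C_E}\otimes\rho_m^{ABE}$, with registers $C_B$ held by Bob and $C_E$ held by Eve. - $\mathbb{P}_B$: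 the same with the roles of Alice and Bob exchanged. - $\mathbb{Q}_{AE}$, $\mathbb{Q}_{BE}$: quantum communication from Alice to Eve (resp. Bob to Eve), i.e. a subsystem $Q$ held by Alice (resp. Bob) becomes part of Eve's system. A state $\rho_1$ is $\epsilon$-convertible to $\rho_2$ under $\Omega$ if there exist $\mathcal{E}\in\Omega$ and a reversible operation $\mathcal{V}$ on $E$ such that $\|\mathcal{E}(\rho_1^{ABE})-\mathcal{V}(\rho_2^{ABE})\|_1\leq\epsilon$, where $\|X\|_1={\rm Tr}|X|$. Unit state: $|\Phi_{\rm I}\rangle^{ABE}:=\frac{1}{\sqrt2}(|00\rangle+|11\rangle)^{AB}\otimes|0\rangle^E$. A rate $R$ is achievable in non-Markovianity dilution of $\rho\in\mathcal{S}_{\rm all}$ if, for any $\epsilon>0$ and all sufficiently large $n$, the state $\Phi_{\rm I}^{\otimes nR}$ is $\epsilon$-convertible to $(\rho^{ABE})^{\otimes n}$ under $\Omega$ (with $nR$ rounded up to an integer). The non-Markovianity cost $M_C(\rho)$ is the infimum of achievable rates $R$. The entanglement of purification of a bipartite state $\tau$ on $AB$ is $E_P(\tau):=\inf_{\phi_\tau}S(AE_A)_{\phi_\tau}$, where the infimum is over all purifications $\phi_\tau$ of $\tau$ on $AE_ABE_B$ ($E_A,E_B$ arbitrary finite-dimensional) and $S$ is the von Neumann entropy with base-2 logarithm. Its regularization is $E_P^\infty(\tau):=\lim_{n\to\infty}\frac1nE_P(\tau^{\otimes n})$, with $\tau^{\otimes n}$ regarded as bipartite between $A^n$ and $B^n$.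 *)

theory Defs
  imports
    "HOL-Library.Extended_Real"
    "Jordan_Normal_Form.Schur_Decomposition"
begin

text \<open>
  A finite-dimensional Hilbert space is represented by its dimension, and operators on it by square
  complex matrices. Tensor products follow the Kronecker convention: in a product of spaces of
  dimensions \<open>a\<close>, \<open>b\<close>, \<open>e\<close> the basis vector \<open>|i,j,k>\<close> has the index \<open>(i * b + j) * e + k\<close>.
\<close>

definition ix3 :: "nat \<Rightarrow> nat \<Rightarrow> nat \<Rightarrow> nat \<Rightarrow> nat \<Rightarrow> nat" where
  "ix3 b e i j k = (i * b + j) * e + k"

definition pos1 :: "nat \<Rightarrow> nat \<Rightarrow> nat \<Rightarrow> nat" where
  "pos1 b e x = x div (b * e)"

definition pos2 :: "nat \<Rightarrow> nat \<Rightarrow> nat \<Rightarrow> nat" where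
  "pos2 b e x = x div e mod b"

definition pos3 :: "nat \<Rightarrow> nat \<Rightarrow> nat" where
  "pos3 e x = x mod e"

section \<open>Operators and states\<close>

definition mtrace :: "complex mat \<Rightarrow> complex" where
  "mtrace X = (\<Sum>i<dim_row X. X $$ (i, i))"

definition psd :: "nat \<Rightarrow> complex mat \<Rightarrow> bool" where
  "psd d X \<longleftrightarrow> X \<in> carrier_mat d d \<and> (\<forall>v \<in> carrier_vec d. 0 \<le> (X *\<^sub>v v) \<bullet>c v)"

text \<open>The order on \<^typ>\<open>complex\<close> makes \<open>0 \<le> z\<close> say that \<open>z\<close> is real and nonnegative.\<close>

definition density :: "nat \<Rightarrow> complex mat \<Rightarrow> bool" where
  "density d \<rho> \<longleftrightarrow> psd d \<rho> \<and> mtrace \<rho> = 1"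

definition proj :: "complex vec \<Rightarrow> complex mat" where
  "proj \<psi> = mat (dim_vec \<psi>) (dim_vec \<psi>) (\<lambda>(x, y). \<psi> $ x * cnj (\<psi> $ y))"

definition unitary_mat :: "nat \<Rightarrow> complex mat \<Rightarrow> bool" where
  "unitary_mat d U \<longleftrightarrow> U \<in> carrier_mat d d \<and> mat_adjoint U * U = 1\<^sub>m d \<and> U * mat_adjoint U = 1\<^sub>m d"

text \<open>
  Functional calculus for a Hermitian matrix \<open>X\<close>. The result does not depend on the chosen
  diagonalization \<open>X = U diag(l) U*\<close>.
\<close>

definition herm_fun :: "(real \<Rightarrow> real) \<Rightarrow> complex mat \<Rightarrow> complex mat" where
  "herm_fun f X = (SOME Y. \<exists>U l. unitary_mat (dim_row X) U
      \<and> X = U * mat_diag (dim_row X) (\<lambda>i. complex_of_real (l i)) * mat_adjoint U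
      \<and> Y = U * mat_diag (dim_row X) (\<lambda>i. complex_of_real (f (l i))) * mat_adjoint U)"

definition trace_norm :: "complex mat \<Rightarrow> real" where
  "trace_norm X = Re (mtrace (herm_fun sqrt (mat_adjoint X * X)))"

text \<open>The value of the logarithm at eigenvalue 0 is irrelevant, as it is multiplied by 0.\<close>

definition vn_entropy :: "complex mat \<Rightarrow> real" where
  "vn_entropy \<rho> = - Re (mtrace (\<rho> * herm_fun (log 2) \<rho>))"

text \<open>Trace over the middle factor of a product of spaces of dimensions \<open>l\<close>, \<open>d\<close>, \<open>r\<close>.\<close>

definition ptrace :: "nat \<Rightarrow> nat \<Rightarrow> nat \<Rightarrow> complex mat \<Rightarrow> complex mat" where
  "ptrace l d r X = mat (l * r) (l * r)
     (\<lambda>(x, y). \<Sum>j<d. X $$ (ix3 d r (x div r) j (x mod r), ix3 d r (y div r) j (y mod r)))"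

section \<open>Quantum operations\<close>

text \<open>
  \<open>lift l r d d' F\<close> is the map \<open>id \<otimes> F \<otimes> id\<close>, where \<open>F\<close> maps operators on dimension \<open>d\<close> to operators
  on dimension \<open>d'\<close> and the identities act on dimensions \<open>l\<close> and \<open>r\<close>: the block of the result at
  \<open>(i,k), (i',k')\<close> is the image under \<open>F\<close> of the block of \<open>X\<close> at \<open>(i,k), (i',k')\<close>.
\<close>

definition lift :: "nat \<Rightarrow> nat \<Rightarrow> nat \<Rightarrow> nat \<Rightarrow> (complex mat \<Rightarrow> complex mat) \<Rightarrow> complex mat \<Rightarrow> complex mat" where
  "lift l r d d' F X = mat (l * d' * r) (l * d' * r)
     (\<lambda>(x, y). F (mat d d (\<lambda>(p, q).
          X $$ (ix3 d r (pos1 d' r x) p (pos3 r x), ix3 d r (pos1 d' r y) q (pos3 r y))))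
        $$ (pos2 d' r x, pos2 d' r y))"

text \<open>Only the values of a map on matrices of the right dimension matter.\<close>

definition quantum_operation :: "nat \<Rightarrow> nat \<Rightarrow> (complex mat \<Rightarrow> complex mat) \<Rightarrow> bool" where
  "quantum_operation d d' F \<longleftrightarrow>
     (\<forall>X \<in> carrier_mat d d. F X \<in> carrier_mat d' d') \<and>
     (\<forall>X \<in> carrier_mat d d. \<forall>Y \<in> carrier_mat d d. F (X + Y) = F X + F Y) \<and>
     (\<forall>c. \<forall>X \<in> carrier_mat d d. F (c \<cdot>\<^sub>m X) = c \<cdot>\<^sub>m F X) \<and>
     (\<forall>X \<in> carrier_mat d d. mtrace (F X) = mtrace X) \<and>
     (\<forall>k X. psd (d * k) X \<longrightarrow> psd (d' * k) (lift 1 k d d' F X))"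

definition reversible_operation :: "nat \<Rightarrow> nat \<Rightarrow> (complex mat \<Rightarrow> complex mat) \<Rightarrow> bool" where
  "reversible_operation d d' V \<longleftrightarrow> quantum_operation d d' V \<and>
     (\<exists>W. quantum_operation d' d W \<and> (\<forall>\<rho>. density d \<rho> \<longrightarrow> W (V \<rho>) = \<rho>))"

section \<open>Tripartite systems and the allowed operations\<close>

text \<open>The dimensions of the systems of Alice, Bob and Eve, which are always ordered in this way.\<close>

type_synonym dims = "nat \<times> nat \<times> nat"

fun total_dim :: "dims \<Rightarrow> nat" where
  "total_dim (a, b, e) = a * b * e"

text \<open>
  Broadcasting by Alice, whose system is \<open>C\<^sub>A \<otimes> A\<close> with \<open>C\<^sub>A\<close> of dimension \<open>c\<close>, sends
  \<open>\<Sum>m. p\<^sub>m |m><m| \<otimes> \<rho>\<^sub>m\<close> to the state with \<open>C\<^sub>A\<close> removed and copies of \<open>|m>\<close> in the registers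
  \<open>C\<^sub>B\<close> and \<open>C\<^sub>E\<close>, where Bob and Eve then hold \<open>C\<^sub>B \<otimes> B\<close> and \<open>C\<^sub>E \<otimes> E\<close>. As a linear map on all
  operators it deletes the blocks off the diagonal in \<open>C\<^sub>A\<close>, that is, dephases \<open>C\<^sub>A\<close> first; as
  dephasing is a local operation by Alice, this extension adds nothing.
\<close>

definition broadcast_A :: "nat \<Rightarrow> dims \<Rightarrow> complex mat \<Rightarrow> complex mat" where
  "broadcast_A c = (\<lambda>(a, b, e) X. mat (a * (c * b) * (c * e)) (a * (c * b) * (c * e)) (\<lambda>(x, y).
     let i = pos1 (c * b) (c * e) x; j = pos2 (c * b) (c * e) x; k = pos3 (c * e) x;
         i' = pos1 (c * b) (c * e) y; j' = pos2 (c * b) (c * e) y; k' = pos3 (c * e) y;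
         m = j div b
     in if k div e = m \<and> j' div b = m \<and> k' div e = m
        then X $$ (ix3 b e (m * a + i) (j mod b) (k mod e), ix3 b e (m * a + i') (j' mod b) (k' mod e))
        else 0))"

definition broadcast_B :: "nat \<Rightarrow> dims \<Rightarrow> complex mat \<Rightarrow> complex mat" where
  "broadcast_B c = (\<lambda>(a, b, e) X. mat (c * a * b * (c * e)) (c * a * b * (c * e)) (\<lambda>(x, y).
     let i = pos1 b (c * e) x; j = pos2 b (c * e) x; k = pos3 (c * e) x;
         i' = pos1 b (c * e) y; j' = pos2 b (c * e) y; k' = pos3 (c * e) y;
         m = i div a
     in if k div e = m \<and> i' div a = m \<and> k' div e = m
        then X $$ (ix3 (c * b) e (i mod a) (m * b + j) (k mod e),
                   ix3 (c * b) e (i' mod a) (m * b + j') (k' mod e))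
        else 0))"

text \<open>
  A subsystem \<open>Q\<close> of dimension \<open>q\<close> moves from Alice, holding \<open>Q \<otimes> A\<close>, to Eve, then holding \<open>Q \<otimes> E\<close>;
  likewise from Bob to Eve.
\<close>

definition send_AE :: "nat \<Rightarrow> dims \<Rightarrow> complex mat \<Rightarrow> complex mat" where
  "send_AE q = (\<lambda>(a, b, e) X. mat (a * b * (q * e)) (a * b * (q * e)) (\<lambda>(x, y).
     let old = (\<lambda>z. ix3 b e (pos3 (q * e) z div e * a + pos1 b (q * e) z)
                      (pos2 b (q * e) z) (pos3 (q * e) z mod e))
     in X $$ (old x, old y)))"

definition send_BE :: "nat \<Rightarrow> dims \<Rightarrow> complex mat \<Rightarrow> complex mat" where
  "send_BE q = (\<lambda>(a, b, e) X. mat (a * b * (q * e)) (a * b * (q * e)) (\<lambda>(x, y).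
     let old = (\<lambda>z. ix3 (q * b) e (pos1 b (q * e) z)
                      (pos3 (q * e) z div e * b + pos2 b (q * e) z) (pos3 (q * e) z mod e))
     in X $$ (old x, old y)))"

inductive Omega :: "dims \<Rightarrow> dims \<Rightarrow> (complex mat \<Rightarrow> complex mat) \<Rightarrow> bool" where
  local_A: "quantum_operation a a' F \<Longrightarrow> Omega (a, b, e) (a', b, e) (lift 1 (b * e) a a' F)"
| local_B: "quantum_operation b b' F \<Longrightarrow> Omega (a, b, e) (a, b', e) (lift a e b b' F)"
| reversible_E: "reversible_operation e e' V \<Longrightarrow> Omega (a, b, e) (a, b, e') (lift (a * b) 1 e e' V)"
| public_A: "Omega (c * a, b, e) (a, c * b, c * e) (broadcast_A c (a, b, e))"
| public_B: "Omega (a, c * b, e) (c * a, b, c * e) (broadcast_B c (a, b, e))"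
| quantum_AE: "Omega (q * a, b, e) (a, b, q * e) (send_AE q (a, b, e))"
| quantum_BE: "Omega (a, q * b, e) (a, b, q * e) (send_BE q (a, b, e))"
| compose: "Omega s s' F \<Longrightarrow> Omega s' s'' G \<Longrightarrow> Omega s s'' (G \<circ> F)"

definition convertible :: "real \<Rightarrow> dims \<Rightarrow> complex mat \<Rightarrow> dims \<Rightarrow> complex mat \<Rightarrow> bool" where
  "convertible \<epsilon> s\<^sub>1 \<rho>\<^sub>1 = (\<lambda>(a, b, e) \<rho>\<^sub>2. \<exists>e' F V. Omega s\<^sub>1 (a, b, e') F \<and> reversible_operation e e' V \<and>
     trace_norm (F \<rho>\<^sub>1 - lift (a * b) 1 e e' V \<rho>\<^sub>2) \<le> \<epsilon>)"

section \<open>Tensor powers and the non-Markovianity cost\<close>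

text \<open>
  The tensor product of two tripartite operators, with the tensor factors rearranged such that the
  result is an operator on \<open>A\<^sub>1A\<^sub>2 \<otimes> B\<^sub>1B\<^sub>2 \<otimes> E\<^sub>1E\<^sub>2\<close>.
\<close>

fun dims_mult :: "dims \<Rightarrow> dims \<Rightarrow> dims" where
  "dims_mult (a1, b1, e1) (a2, b2, e2) = (a1 * a2, b1 * b2, e1 * e2)"

fun tensor3 :: "dims \<Rightarrow> complex mat \<Rightarrow> dims \<Rightarrow> complex mat \<Rightarrow> complex mat" where
  "tensor3 (a1, b1, e1) X (a2, b2, e2) Y =
    (let D = (a1 * a2) * (b1 * b2) * (e1 * e2);
         i = pos1 (b1 * b2) (e1 * e2); j = pos2 (b1 * b2) (e1 * e2); k = pos3 (e1 * e2);
         fst_ix = (\<lambda>z. ix3 b1 e1 (i z div a2) (j z div b2) (k z div e2));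
         snd_ix = (\<lambda>z. ix3 b2 e2 (i z mod a2) (j z mod b2) (k z mod e2))
     in mat D D (\<lambda>(x, y). X $$ (fst_ix x, fst_ix y) * Y $$ (snd_ix x, snd_ix y)))"

fun dims_pow :: "dims \<Rightarrow> nat \<Rightarrow> dims" where
  "dims_pow s 0 = (1, 1, 1)"
| "dims_pow s (Suc n) = dims_mult (dims_pow s n) s"

fun tensor_pow :: "dims \<Rightarrow> complex mat \<Rightarrow> nat \<Rightarrow> complex mat" where
  "tensor_pow s X 0 = 1\<^sub>m 1"
| "tensor_pow s X (Suc n) = tensor3 (dims_pow s n) (tensor_pow s X n) s X"

text \<open>The unit state is a maximally entangled qubit pair; the space of Eve's state \<open>|0>\<close> is taken
  one-dimensional.\<close>

definition unit_dims :: dims where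
  "unit_dims = (2, 2, 1)"

definition unit_state :: "complex mat" where
  "unit_state = proj (vec 4 (\<lambda>x. if x = ix3 2 1 0 0 0 \<or> x = ix3 2 1 1 1 0 then 1 / complex_of_real (sqrt 2) else 0))"

definition achievable_dilution :: "dims \<Rightarrow> complex mat \<Rightarrow> real \<Rightarrow> bool" where
  "achievable_dilution s \<rho> R \<longleftrightarrow> 0 \<le> R \<and> (\<forall>\<epsilon>>0. \<forall>\<^sub>F n in sequentially.
     convertible \<epsilon> (dims_pow unit_dims (nat \<lceil>real n * R\<rceil>)) (tensor_pow unit_dims unit_state (nat \<lceil>real n * R\<rceil>))
       (dims_pow s n) (tensor_pow s \<rho> n))"

text \<open>Extended reals give the infimum of the empty set the value \<open>\<infinity>\<close>.\<close>

definition nonMarkovianity_cost :: "dims \<Rightarrow> complex mat \<Rightarrow> ereal" where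
  "nonMarkovianity_cost s \<rho> = Inf {ereal R | R. achievable_dilution s \<rho> R}"

section \<open>Entanglement of purification\<close>

text \<open>
  \<open>\<phi>\<close> is a vector in \<open>A \<otimes> E\<^sub>A \<otimes> B \<otimes> E\<^sub>B\<close>, where \<open>E\<^sub>A\<close> and \<open>E\<^sub>B\<close> have the dimensions \<open>ea\<close> and \<open>eb\<close>.
\<close>

definition purification :: "nat \<Rightarrow> nat \<Rightarrow> complex mat \<Rightarrow> nat \<Rightarrow> nat \<Rightarrow> complex vec \<Rightarrow> bool" where
  "purification a b \<tau> ea eb \<phi> \<longleftrightarrow> \<phi> \<in> carrier_vec ((a * ea) * (b * eb)) \<and>
     ptrace a ea b (ptrace (a * ea * b) eb 1 (proj \<phi>)) = \<tau>"

definition E_P :: "nat \<Rightarrow> nat \<Rightarrow> complex mat \<Rightarrow> real" where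
  "E_P a b \<tau> = Inf {vn_entropy (ptrace (a * ea) (b * eb) 1 (proj \<phi>)) | ea eb \<phi>. purification a b \<tau> ea eb \<phi>}"

text \<open>For the powers, an operator on \<open>A \<otimes> B\<close> is treated as tripartite with a trivial third system.\<close>

definition E_P_reg :: "nat \<Rightarrow> nat \<Rightarrow> complex mat \<Rightarrow> real" where
  "E_P_reg a b \<tau> = lim (\<lambda>n. E_P (a ^ n) (b ^ n) (tensor_pow (a, b, 1) \<tau> n) / real n)"

end

theory Submission
  imports Defs "HOL-Analysis.L2_Norm"
begin

text \<open>
  Let \<open>\<phi>\<close> be a purification of \<open>(\<psi>\<^sup>A\<^sup>B)\<^sup>\<otimes>\<^sup>m\<close> with entropy \<open>S(AE\<^sub>A) < mR\<close>. For \<open>k = n div m + 1\<close>, the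
  state \<open>\<phi>\<^sup>\<otimes>\<^sup>k\<close> is also a purification of \<open>(\<psi>\<^sup>A\<^sup>B)\<^sup>\<otimes>\<^sup>n\<close>, the superfluous copies of \<open>A\<close> and \<open>B\<close> being
  counted to \<open>E\<^sub>A\<close> and \<open>E\<^sub>B\<close>. All but a vanishing part of its Schmidt decomposition has at most
  \<open>2\<^sup>n\<^sup>R\<close> terms, so that Alice and Bob can turn \<open>nR\<close> maximally entangled qubit pairs into an approximation
  of it by one measurement of Alice, a broadcast of its uniformly distributed outcome and a correction
  by Bob. They send \<open>E\<^sub>A\<close> and \<open>E\<^sub>B\<close> to Eve. As all purifications are related by isometries, the result
  is close to the image of \<open>\<psi>\<^sup>\<otimes>\<^sup>n\<close> under an isometry of Eve that also appends a uniformly distributed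
  message, and this operation is reversible. The limit defining \<open>E\<^sub>P\<^sup>\<infinity>\<close> exists since \<open>E\<^sub>P\<close> is subadditive.
\<close>

section \<open>Orthogonal families and the spectral theorem\<close>

text \<open>Eve may undo nothing but reversible operations, so she cannot forget the broadcast. Her
  reversible operation on the side of the target must therefore create a message as well, which
  works because the message produced by the protocol is independent of the state. The cyclic shifts
  of the protocol achieve this exactly for every normalized Schmidt spectrum with at most
  \<open>d\<close> terms, so truncation is the only source of error. If the discarded weight is
  \<delta>, the truncated and renormalized vector has overlap \<open>sqrt (1 - \<delta>)\<close>
  with the full one, and the trace-norm error is at most \<open>2 * sqrt (2 * \<delta>)\<close>. A
  Chernoff bound makes \<delta> exponentially small in the number of blocks, while the gap between
  the entropy of a block and \<open>m * R\<close> pays for the additional block that rounding up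
  costs. The calculations stay elementary because operations are followed on finite families of
  unnormalized vectors, and purifications are represented by their Schmidt vectors.\<close>

lemma sum_lessThan_mult:
  "(\<Sum>x<a * b. f x) = (\<Sum>i<a. \<Sum>j<b. f (i * b + j))" for a b :: nat
proof -
  have "(\<Sum>j<b. f (i * b + j)) = sum f {i * b..<i * b + b}" for i
    using sum.shift_bounds_nat_ivl[of f 0 "i * b" b] by (simp add: lessThan_atLeast0 add.commute)
  then show ?thesis using sum.nat_group[of f b a] by simp
qed

lemma sum_lessThan_mult3:
  "(\<Sum>x<a * b * e. f x) = (\<Sum>i<a. \<Sum>j<b. \<Sum>k<e. f (ix3 b e i j k))"
  by (simp add: sum_lessThan_mult ix3_def)

lemma mult_add_less: "i * b + j < a * b" if "i < a" "j < b" for a b i j :: nat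
proof -
  have "i * b + j < Suc i * b" using that by simp
  also have "\<dots> \<le> a * b" using that by (intro mult_right_mono) auto
  finally show ?thesis .
qed

lemma ix3_less: "i < a \<Longrightarrow> j < b \<Longrightarrow> k < e \<Longrightarrow> ix3 b e i j k < a * b * e"
  unfolding ix3_def by (intro mult_add_less)

lemma pos1_ix3 [simp]: "j < b \<Longrightarrow> k < e \<Longrightarrow> pos1 b e (ix3 b e i j k) = i"
  by (simp add: pos1_def ix3_def mult.commute[of b] div_mult2_eq)

lemma pos2_ix3 [simp]: "j < b \<Longrightarrow> k < e \<Longrightarrow> pos2 b e (ix3 b e i j k) = j"
  by (simp add: pos2_def ix3_def)

lemma pos3_ix3 [simp]: "k < e \<Longrightarrow> pos3 e (ix3 b e i j k) = k"
  by (simp add: pos3_def ix3_def)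

lemma ix3_pos [simp]: "ix3 b e (pos1 b e x) (pos2 b e x) (pos3 e x) = x"
  by (simp add: pos1_def pos2_def pos3_def ix3_def mult.commute[of b] div_mult2_eq)

lemma pos_less:
  assumes "x < a * b * e"
  shows "pos1 b e x < a" "pos2 b e x < b" "pos3 e x < e"
proof -
  from assms have "0 < a * b * e" by linarith
  then have "b > 0" "e > 0" by auto
  then show "pos2 b e x < b" "pos3 e x < e" by (auto simp: pos2_def pos3_def)
  show "pos1 b e x < a" using assms
    by (simp add: pos1_def less_mult_imp_div_less mult.assoc)
qed

text \<open>The squared norms \<open>l c\<close> may vanish. One notion thus covers orthonormal
  bases, with \<open>l\<close> constantly 1, and the unnormalized second factors of a Schmidt
  decomposition, whose weights are then \<open>l\<close>.\<close>

definition orthogonal_family :: "nat \<Rightarrow> nat \<Rightarrow> (nat \<Rightarrow> nat \<Rightarrow> complex) \<Rightarrow> (nat \<Rightarrow> real) \<Rightarrow> bool" where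
  "orthogonal_family D n U l \<longleftrightarrow>
     (\<forall>c<D. \<forall>c'<D. (\<Sum>x<n. U c x * cnj (U c' x)) = (if c = c' then of_real (l c) else 0))"

lemma orthogonal_familyD:
  "orthogonal_family D n U l \<Longrightarrow> c < D \<Longrightarrow> c' < D \<Longrightarrow>
    (\<Sum>x<n. U c x * cnj (U c' x)) = (if c = c' then of_real (l c) else 0)"
  by (simp add: orthogonal_family_def)

lemma orthogonal_family_norm:
  assumes "orthogonal_family D n U l" "c < D"
  shows "l c = (\<Sum>x<n. (cmod (U c x))\<^sup>2)"
proof -
  have "of_real (\<Sum>x<n. (cmod (U c x))\<^sup>2) = complex_of_real (l c)"
    using orthogonal_familyD[OF assms(1,2,2)] by (simp only: of_real_sum complex_norm_square) simp
  then show ?thesis by (simp only: of_real_eq_iff)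
qed

lemma orthogonal_family_zero:
  assumes "orthogonal_family D n U l" "c < D" "l c = 0" "x < n"
  shows "U c x = 0"
  using orthogonal_family_norm[OF assms(1,2)] assms(3,4)
  by (simp add: sum_nonneg_eq_0_iff)

text \<open>For a square matrix, a right inverse is also a left inverse: orthonormality of
  \<open>n\<close> vectors in dimension \<open>n\<close> becomes completeness.\<close>

lemma orthonormal_complete:
  assumes U: "orthogonal_family n n U (\<lambda>_. 1)" and "x < n" "y < n"
  shows "(\<Sum>c<n. U c x * cnj (U c y)) = (if x = y then 1 else 0)"
proof -
  define A where "A = mat n n (\<lambda>(c, x). U c x)"
  define B where "B = mat n n (\<lambda>(x, c). cnj (U c x))"
  have [simp]: "A \<in> carrier_mat n n" "B \<in> carrier_mat n n" by (auto simp: A_def B_def)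
  have "A * B = 1\<^sub>m n"
    by (rule eq_matI) (auto simp: A_def B_def scalar_prod_def atLeast0LessThan orthogonal_familyD[OF U])
  then have "B * A = 1\<^sub>m n" by (intro mat_mult_left_right_inverse[of A]) auto
  then have "(B * A) $$ (y, x) = (if x = y then 1 else 0)" using assms by auto
  moreover have "(B * A) $$ (y, x) = (\<Sum>c<n. cnj (U c y) * U c x)"
    using assms by (simp add: A_def B_def scalar_prod_def atLeast0LessThan)
  ultimately show ?thesis by (simp add: mult.commute)
qed

section \<open>Diagonalization of Hermitian matrices\<close>

lemma mtrace_mult_commute:
  assumes "A \<in> carrier_mat n m" "B \<in> carrier_mat m n"
  shows "mtrace (A * B) = mtrace (B * A)"
proof -
  have "mtrace (A * B) = (\<Sum>i<n. \<Sum>j<m. A $$ (i, j) * B $$ (j, i))"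
    using assms by (simp add: mtrace_def scalar_prod_def atLeast0LessThan)
  also have "\<dots> = (\<Sum>j<m. \<Sum>i<n. B $$ (j, i) * A $$ (i, j))"
    by (subst sum.swap) (simp add: mult.commute)
  also have "\<dots> = mtrace (B * A)"
    using assms by (simp add: mtrace_def scalar_prod_def atLeast0LessThan)
  finally show ?thesis .
qed

text \<open>In a Schur decomposition the trace is the sum of the eigenvalues, so they cannot all be
  equal to \<mu>. Excluding one value is what the deflation argument for the spectral theorem
  requires.\<close>

lemma eigenvector_ne:
  assumes A: "A \<in> carrier_mat n n" and tr: "mtrace A \<noteq> of_nat n * \<mu>"
  obtains k v where "k \<noteq> \<mu>" "v \<in> carrier_vec n" "v \<noteq> 0\<^sub>v n" "A *\<^sub>v v = k \<cdot>\<^sub>v v"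
proof -
  obtain es where es: "char_poly A = (\<Prod>a\<leftarrow>es. [:- a, 1:])" and len: "length es = n"
    using char_poly_factorized[OF A] by blast
  obtain B P Q where "schur_decomposition A es = (B, P, Q)" by (metis prod_cases3)
  from schur_decomposition[OF A es this] have sim: "similar_mat_wit A B P Q" and d: "diag_mat B = es"
    by auto
  note w = similar_mat_witD2[OF A sim]
  have "mtrace A = mtrace (P * (B * Q))" using w by (simp add: assoc_mult_mat[of P n n B n Q n])
  also have "\<dots> = mtrace (B * Q * P)" using w by (intro mtrace_mult_commute) auto
  also have "B * Q * P = B" using w by (simp add: assoc_mult_mat[of B n n Q n P n])
  also have "mtrace B = sum_list es"
    using w by (simp add: mtrace_def d[symmetric] diag_mat_def interv_sum_list_conv_sum_set_nat atLeast0LessThan)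
  finally have "sum_list es \<noteq> of_nat n * \<mu>" using tr by simp
  then have "\<exists>k\<in>set es. k \<noteq> \<mu>"
  proof (rule contrapos_np)
    assume "\<not> (\<exists>k\<in>set es. k \<noteq> \<mu>)"
    then have "es = replicate n \<mu>" using len by (metis replicate_eqI)
    then show "sum_list es = of_nat n * \<mu>" by (simp add: sum_list_replicate)
  qed
  then obtain k where k: "k \<in> set es" "k \<noteq> \<mu>" by blast
  have "poly (char_poly A) k = 0" unfolding es using k by (simp add: poly_prod_list prod_list_zero_iff)
  then have "eigenvalue A k" using eigenvalue_root_char_poly[OF A] by simp
  then obtain v where "eigenvector A v k" unfolding eigenvalue_def by blast
  then show ?thesis using that[of k v] k(2) A unfolding eigenvector_def by auto
qed

text \<open>Deflation: adding \<open>m - l c\<close> times the projector of each known eigenvector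
  gives a Hermitian matrix \<open>B\<close> for which they all have the eigenvalue \<open>m\<close>.
  An eigenvector of \<open>B\<close> with another eigenvalue is orthogonal to them, hence unaffected
  by the added terms and an eigenvector of \<open>A\<close> itself.\<close>

lemma orthonormal_eigenvectors:
  assumes H: "\<And>i j. i < n \<Longrightarrow> j < n \<Longrightarrow> A i j = cnj (A j i)" and "k \<le> n"
  shows "\<exists>U (l :: nat \<Rightarrow> real). orthogonal_family k n U (\<lambda>_. 1) \<and>
    (\<forall>c<k. \<forall>i<n. (\<Sum>j<n. A i j * U c j) = l c * U c i)"
  using \<open>k \<le> n\<close>
proof (induction k)
  case 0
  show ?case by (simp add: orthogonal_family_def)
next
  case (Suc k)
  then obtain U :: "nat \<Rightarrow> nat \<Rightarrow> complex" and l :: "nat \<Rightarrow> real" where U: "orthogonal_family k n U (\<lambda>_. 1)"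
    and E: "\<And>c i. c < k \<Longrightarrow> i < n \<Longrightarrow> (\<Sum>j<n. A i j * U c j) = l c * U c i" by auto
  define t where "t = (\<Sum>i<n. A i i) - (\<Sum>c<k. of_real (l c))"
  \<comment> \<open>As \<open>n - k\<close> is positive, 0 and 1 cannot both be bad values. The
    inequality is equivalent to the trace of \<open>B\<close> differing from \<open>n * m\<close>,
    the condition for an eigenvalue other than \<open>m\<close>.\<close>
  have "\<exists>m::real. of_nat (n - k) * complex_of_real m \<noteq> t"
  proof (rule ccontr)
    assume "\<nexists>m::real. of_nat (n - k) * complex_of_real m \<noteq> t"
    then have "of_nat (n - k) * complex_of_real 0 = t" "of_nat (n - k) * complex_of_real 1 = t" by blast+
    then show False using Suc.prems by auto
  qed
  then obtain m :: real where m: "of_nat (n - k) * complex_of_real m \<noteq> t" by blast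
  define B where "B i j = A i j + (\<Sum>c<k. (m - l c) * (U c i * cnj (U c j)))" for i j
  have BH: "B i j = cnj (B j i)" if "i < n" "j < n" for i j
    using H[OF that] by (simp add: B_def mult.commute)
  have Bmul: "(\<Sum>j<n. B i j * f j) =
      (\<Sum>j<n. A i j * f j) + (\<Sum>c<k. (m - l c) * U c i * (\<Sum>j<n. f j * cnj (U c j)))" for i f
  proof -
    have "(\<Sum>j<n. B i j * f j) = (\<Sum>j<n. A i j * f j) +
       (\<Sum>j<n. \<Sum>c<k. (m - l c) * U c i * (f j * cnj (U c j)))"
      unfolding B_def distrib_right sum.distrib sum_distrib_right by (simp add: mult_ac)
    also have "(\<Sum>j<n. \<Sum>c<k. (m - l c) * U c i * (f j * cnj (U c j))) =
       (\<Sum>c<k. (m - l c) * U c i * (\<Sum>j<n. f j * cnj (U c j)))"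
      by (subst sum.swap) (simp add: sum_distrib_left)
    finally show ?thesis .
  qed
  have BU: "(\<Sum>j<n. B i j * U c j) = m * U c i" if c: "c < k" "i < n" for c i
  proof -
    have "(\<Sum>c'<k. (m - l c') * U c' i * (\<Sum>j<n. U c j * cnj (U c' j))) =
       (\<Sum>c'<k. if c' = c then (m - l c) * U c i else 0)"
      using c by (intro sum.cong refl) (auto simp: orthogonal_familyD[OF U])
    also have "\<dots> = (m - l c) * U c i" using c by (simp add: sum.delta)
    finally show ?thesis using E[OF c] by (simp add: Bmul algebra_simps)
  qed
  have "mtrace (mat n n (\<lambda>(i, j). B i j)) = (\<Sum>i<n. A i i) + (\<Sum>i<n. \<Sum>c<k. (m - l c) * (U c i * cnj (U c i)))"
    by (simp add: mtrace_def B_def sum.distrib)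
  also have "(\<Sum>i<n. \<Sum>c<k. (m - l c) * (U c i * cnj (U c i))) = (\<Sum>c<k. complex_of_real (m - l c))"
    by (subst sum.swap) (simp add: sum_distrib_left[symmetric] orthogonal_familyD[OF U])
  also have "\<dots> = of_nat k * m - (\<Sum>c<k. of_real (l c))" by (simp add: sum_subtractf)
  finally have trB: "mtrace (mat n n (\<lambda>(i, j). B i j)) = t + of_nat k * complex_of_real m" by (simp add: t_def)
  have "mtrace (mat n n (\<lambda>(i, j). B i j)) \<noteq> of_nat n * of_real m"
  proof
    assume "mtrace (mat n n (\<lambda>(i, j). B i j)) = of_nat n * of_real m"
    then have "t = of_nat n * of_real m - of_nat k * of_real m" using trB by (simp add: eq_diff_eq)
    also have "\<dots> = of_nat (n - k) * of_real m" using Suc.prems by (simp add: of_nat_diff left_diff_distrib)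
    finally show False using m by simp
  qed
  then obtain r v where r: "r \<noteq> of_real m" and v: "v \<in> carrier_vec n" "v \<noteq> 0\<^sub>v n"
    and ev: "mat n n (\<lambda>(i, j). B i j) *\<^sub>v v = r \<cdot>\<^sub>v v"
    by (rule eigenvector_ne[rotated]) auto
  have Bv: "(\<Sum>j<n. B i j * v $ j) = r * v $ i" if "i < n" for i
    using arg_cong[OF ev, of "\<lambda>w. w $ i"] that v by (simp add: scalar_prod_def atLeast0LessThan)
  have sym: "(\<Sum>i<n. (\<Sum>j<n. B i j * v $ j) * cnj (f i)) = (\<Sum>j<n. v $ j * cnj (\<Sum>i<n. B j i * f i))" for f
  proof -
    have "(\<Sum>i<n. (\<Sum>j<n. B i j * v $ j) * cnj (f i)) = (\<Sum>j<n. \<Sum>i<n. B i j * v $ j * cnj (f i))"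
      by (subst sum.swap) (simp add: sum_distrib_right)
    also have "\<dots> = (\<Sum>j<n. \<Sum>i<n. v $ j * cnj (B j i * f i))"
      by (intro sum.cong refl) (simp add: BH[symmetric] mult_ac)
    finally show ?thesis by (simp add: sum_distrib_left)
  qed
  have orth: "(\<Sum>i<n. v $ i * cnj (U c i)) = 0" if c: "c < k" for c
  proof -
    have "r * (\<Sum>i<n. v $ i * cnj (U c i)) = m * (\<Sum>i<n. v $ i * cnj (U c i))"
      using sym[of "U c"] c by (simp add: Bv BU sum_distrib_left mult_ac)
    then show ?thesis using r by simp
  qed
  define N where "N = (\<Sum>i<n. (cmod (v $ i))\<^sup>2)"
  have "\<exists>i<n. v $ i \<noteq> 0" using v by (metis carrier_vecD eq_vecI index_zero_vec)
  then have N: "N > 0" unfolding N_def by (meson finite_lessThan lessThan_iff sum_pos2 zero_le_power2 zero_less_power zero_less_norm_iff)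
  have vv: "(\<Sum>i<n. v $ i * cnj (v $ i)) = of_real N"
    by (simp add: N_def complex_norm_square[symmetric])
  have "r * N = cnj r * N"
    using sym[of "\<lambda>i. v $ i"] by (simp add: Bv vv[symmetric] sum_distrib_left mult_ac)
  then have "r = cnj r" using N by simp
  then obtain r' :: real where r': "r = of_real r'" by (metis Reals_cnj_iff Reals_cases)
  have Av: "(\<Sum>j<n. A i j * v $ j) = r * v $ i" if "i < n" for i
    using Bmul[of i "\<lambda>i. v $ i"] Bv[OF that] orth by simp
  define U' where "U' c i = (if c = k then v $ i / sqrt N else U c i)" for c i
  have orth': "(\<Sum>i<n. U c i * cnj (v $ i)) = 0" if "c < k" for c
    using arg_cong[OF orth[OF that], of cnj] by (simp add: mult.commute)
  have "orthogonal_family (Suc k) n U' (\<lambda>_. 1)"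
    unfolding orthogonal_family_def
  proof (intro allI impI)
    fix c c' assume "c < Suc k" "c' < Suc k"
    moreover have "complex_of_real (sqrt N) * complex_of_real (sqrt N) = N"
      using N by (simp flip: of_real_mult)
    ultimately show "(\<Sum>x<n. U' c x * cnj (U' c' x)) = (if c = c' then complex_of_real 1 else 0)"
      using N orthogonal_familyD[OF U] orth orth' vv
      by (auto simp: U'_def less_Suc_eq sum_divide_distrib[symmetric])
  qed
  moreover have "(\<Sum>j<n. A i j * U' c j) = (if c = k then r' else l c) * U' c i"
    if "c < Suc k" "i < n" for c i
    using that E Av r' by (auto simp: U'_def less_Suc_eq sum_divide_distrib[symmetric])
  ultimately show ?case by (intro exI[of _ U'] exI[of _ "\<lambda>c. if c = k then r' else l c"]) simp
qed

lemma spectral_theorem: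
  assumes H: "\<And>i j. i < n \<Longrightarrow> j < n \<Longrightarrow> A i j = cnj (A j i)"
  obtains U and l :: "nat \<Rightarrow> real" where "orthogonal_family n n U (\<lambda>_. 1)"
    "\<And>i j. i < n \<Longrightarrow> j < n \<Longrightarrow> A i j = (\<Sum>c<n. l c * (U c i * cnj (U c j)))"
proof -
  obtain U :: "nat \<Rightarrow> nat \<Rightarrow> complex" and l :: "nat \<Rightarrow> real" where U: "orthogonal_family n n U (\<lambda>_. 1)"
    and E: "\<And>c i. c < n \<Longrightarrow> i < n \<Longrightarrow> (\<Sum>j<n. A i j * U c j) = l c * U c i"
    using orthonormal_eigenvectors[of n A n] H by blast
  have "A i j = (\<Sum>c<n. l c * (U c i * cnj (U c j)))" if "i < n" "j < n" for i j
  proof -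
    have "(\<Sum>c<n. l c * (U c i * cnj (U c j))) = (\<Sum>c<n. (\<Sum>k<n. A i k * U c k) * cnj (U c j))"
      using E that by (simp add: mult_ac)
    also have "\<dots> = (\<Sum>c<n. \<Sum>k<n. A i k * U c k * cnj (U c j))"
      by (simp add: sum_distrib_right)
    also have "\<dots> = (\<Sum>k<n. A i k * (\<Sum>c<n. U c k * cnj (U c j)))"
      by (subst sum.swap) (simp add: sum_distrib_left mult_ac)
    also have "\<dots> = (\<Sum>k<n. if k = j then A i k else 0)"
      using that by (intro sum.cong) (auto simp: orthonormal_complete[OF U])
    also have "\<dots> = A i j" using that by simp
    finally show ?thesis by simp
  qed
  then show ?thesis using U that by blast
qed

section \<open>Schmidt decomposition and the relation between purifications\<close>

text \<open>The Gram matrix of the rows of \<open>M\<close> is diagonalized by \<open>U\<close>; the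
  coefficients \<open>w\<close> of \<open>M\<close> in this basis are then orthogonal, with the
  eigenvalues as squared norms. Leaving \<open>w\<close> unnormalized avoids any division at zero
  eigenvalues. The last clause is the spectral form of the reduced operator, with the same
  \<open>l\<close>.\<close>

lemma schmidt_decomposition:
  fixes M :: "nat \<Rightarrow> nat \<Rightarrow> complex"
  obtains U w and l :: "nat \<Rightarrow> real" where "orthogonal_family X X U (\<lambda>_. 1)" "orthogonal_family X Y w l"
    "\<And>x y. x < X \<Longrightarrow> y < Y \<Longrightarrow> M x y = (\<Sum>c<X. U c x * w c y)"
    "\<And>x x'. x < X \<Longrightarrow> x' < X \<Longrightarrow> (\<Sum>y<Y. M x y * cnj (M x' y)) = (\<Sum>c<X. l c * (U c x * cnj (U c x')))"
proof -
  define G where "G x x' = (\<Sum>y<Y. M x y * cnj (M x' y))" for x x'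
  have "G x x' = cnj (G x' x)" for x x' by (simp add: G_def mult.commute)
  then obtain U :: "nat \<Rightarrow> nat \<Rightarrow> complex" and l :: "nat \<Rightarrow> real" where
    U: "orthogonal_family X X U (\<lambda>_. 1)"
    and l: "\<And>i j. i < X \<Longrightarrow> j < X \<Longrightarrow> G i j = (\<Sum>c<X. l c * (U c i * cnj (U c j)))"
    using spectral_theorem[of X G] by blast
  define w where "w c y = (\<Sum>x<X. cnj (U c x) * M x y)" for c y
  have M: "M x y = (\<Sum>c<X. U c x * w c y)" if "x < X" for x y
  proof -
    have "(\<Sum>c<X. U c x * w c y) = (\<Sum>x'<X. (\<Sum>c<X. U c x * cnj (U c x')) * M x' y)"
      unfolding w_def sum_distrib_left sum_distrib_right by (subst sum.swap) (simp add: mult_ac)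
    also have "\<dots> = (\<Sum>x'<X. if x' = x then M x' y else 0)"
      using that by (intro sum.cong) (auto simp: orthonormal_complete[OF U])
    finally show ?thesis using that by simp
  qed
  have GU: "(\<Sum>x'<X. G x x' * U c x') = l c * U c x" if "x < X" "c < X" for x c
  proof -
    have "(\<Sum>x'<X. G x x' * U c x') = (\<Sum>x'<X. (\<Sum>c'<X. l c' * (U c' x * cnj (U c' x'))) * U c x')"
      using that by (intro sum.cong) (auto simp: l)
    also have "\<dots> = (\<Sum>c'<X. l c' * U c' x * (\<Sum>x'<X. U c x' * cnj (U c' x')))"
      unfolding sum_distrib_left sum_distrib_right by (subst sum.swap) (simp add: mult_ac)
    also have "\<dots> = (\<Sum>c'<X. if c' = c then l c * U c x else 0)"
      using that by (intro sum.cong) (auto simp: orthogonal_familyD[OF U])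
    finally show ?thesis using that by simp
  qed
  have "orthogonal_family X Y w l"
    unfolding orthogonal_family_def
  proof (intro allI impI)
    fix c c' assume c: "c < X" "c' < X"
    have "(\<Sum>y<Y. w c y * cnj (w c' y)) =
        (\<Sum>y<Y. \<Sum>x<X. \<Sum>x'<X. cnj (U c x) * (M x y * cnj (M x' y) * U c' x'))"
      unfolding w_def by (simp add: sum_product mult_ac)
    also have "\<dots> = (\<Sum>x<X. \<Sum>y<Y. \<Sum>x'<X. cnj (U c x) * (M x y * cnj (M x' y) * U c' x'))"
      by (rule sum.swap)
    also have "\<dots> = (\<Sum>x<X. \<Sum>x'<X. \<Sum>y<Y. cnj (U c x) * (M x y * cnj (M x' y) * U c' x'))"
      by (intro sum.cong refl sum.swap)
    also have "\<dots> = (\<Sum>x<X. cnj (U c x) * (\<Sum>x'<X. G x x' * U c' x'))"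
      by (simp add: G_def sum_distrib_left sum_distrib_right)
    also have "\<dots> = (\<Sum>x<X. cnj (U c x) * (l c' * U c' x))"
      using c by (intro sum.cong) (auto simp: GU)
    also have "\<dots> = l c' * (\<Sum>x<X. U c' x * cnj (U c x))"
      by (simp add: sum_distrib_left mult_ac)
    finally show "(\<Sum>y<Y. w c y * cnj (w c' y)) = (if c = c' then complex_of_real (l c) else 0)"
      using c by (auto simp: orthogonal_familyD[OF U])
  qed
  then show ?thesis using that[of U w l] U M l by (auto simp: G_def)
qed

text \<open>
  Two purifications of the same operator are related by an operation on the purifying system. The
  partial isometry \<open>W\<close> relating them is made isometric by adding \<open>R\<close>, which vanishes on the purification.
\<close>

lemma equal_gram_isometry:
  fixes M N :: "nat \<Rightarrow> nat \<Rightarrow> complex"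
  assumes gram: "\<And>x x'. x < X \<Longrightarrow> x' < X \<Longrightarrow>
    (\<Sum>y<Y. M x y * cnj (M x' y)) = (\<Sum>z<Z. N x z * cnj (N x' z))"
  obtains W R where
    "\<And>x z. x < X \<Longrightarrow> z < Z \<Longrightarrow> (\<Sum>y<Y. W z y * M x y) = N x z"
    "\<And>x y. x < X \<Longrightarrow> y < Y \<Longrightarrow> (\<Sum>y'<Y. R y y' * M x y') = 0"
    "\<And>y y'. y < Y \<Longrightarrow> y' < Y \<Longrightarrow>
      (\<Sum>z<Z. cnj (W z y) * W z y') + (\<Sum>z<Y. cnj (R z y) * R z y') = (if y = y' then 1 else 0)"
proof -
  obtain U m and l :: "nat \<Rightarrow> real" where U: "orthogonal_family X X U (\<lambda>_. 1)"
    and m: "orthogonal_family X Y m l"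
    and M: "\<And>x y. x < X \<Longrightarrow> y < Y \<Longrightarrow> M x y = (\<Sum>c<X. U c x * m c y)"
    and G: "\<And>x x'. x < X \<Longrightarrow> x' < X \<Longrightarrow> (\<Sum>y<Y. M x y * cnj (M x' y)) = (\<Sum>c<X. l c * (U c x * cnj (U c x')))"
    by (rule schmidt_decomposition[of X Y M]) blast
  \<comment> \<open>\<open>N\<close> is expanded in the eigenbasis belonging to \<open>M\<close>. As
    both have the same Gram matrix, the coefficients \<open>n\<close> are orthogonal with the same
    squared norms as \<open>m\<close>.\<close>
  define n where "n c z = (\<Sum>x<X. cnj (U c x) * N x z)" for c z
  have N: "N x z = (\<Sum>c<X. U c x * n c z)" if "x < X" for x z
  proof -
    have "(\<Sum>c<X. U c x * n c z) = (\<Sum>x'<X. (\<Sum>c<X. U c x * cnj (U c x')) * N x' z)"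
      unfolding n_def sum_distrib_left sum_distrib_right by (subst sum.swap) (simp add: mult_ac)
    also have "\<dots> = (\<Sum>x'<X. if x' = x then N x' z else 0)"
      using that by (intro sum.cong) (auto simp: orthonormal_complete[OF U])
    finally show ?thesis using that by simp
  qed
  have n: "orthogonal_family X Z n l"
    unfolding orthogonal_family_def
  proof (intro allI impI)
    fix c c' assume c: "c < X" "c' < X"
    have gm: "m d y = (\<Sum>x<X. cnj (U d x) * M x y)" if "d < X" "y < Y" for d y
    proof -
      have "(\<Sum>x<X. cnj (U d x) * M x y) = (\<Sum>x<X. cnj (U d x) * (\<Sum>c<X. U c x * m c y))"
        using that by (intro sum.cong) (auto simp: M)
      also have "\<dots> = (\<Sum>c<X. (\<Sum>x<X. U c x * cnj (U d x)) * m c y)"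
        unfolding sum_distrib_left sum_distrib_right by (subst sum.swap) (simp add: mult_ac)
      also have "\<dots> = (\<Sum>c<X. if c = d then m c y else 0)"
        using that by (intro sum.cong) (auto simp: orthogonal_familyD[OF U])
      finally show ?thesis using that by simp
    qed
    have expand: "(\<Sum>y<K. (\<Sum>x<X. cnj (U c x) * L x y) * cnj (\<Sum>x<X. cnj (U c' x) * L x y)) =
      (\<Sum>x<X. \<Sum>x'<X. cnj (U c x) * U c' x' * (\<Sum>y<K. L x y * cnj (L x' y)))" for K :: nat and L
    proof -
      have "(\<Sum>y<K. (\<Sum>x<X. cnj (U c x) * L x y) * cnj (\<Sum>x<X. cnj (U c' x) * L x y)) =
          (\<Sum>y<K. \<Sum>x<X. \<Sum>x'<X. cnj (U c x) * U c' x' * (L x y * cnj (L x' y)))"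
        by (simp add: sum_product mult_ac)
      also have "\<dots> = (\<Sum>x<X. \<Sum>y<K. \<Sum>x'<X. cnj (U c x) * U c' x' * (L x y * cnj (L x' y)))"
        by (rule sum.swap)
      also have "\<dots> = (\<Sum>x<X. \<Sum>x'<X. \<Sum>y<K. cnj (U c x) * U c' x' * (L x y * cnj (L x' y)))"
        by (intro sum.cong refl sum.swap)
      finally show ?thesis by (simp add: sum_distrib_left)
    qed
    have "(\<Sum>z<Z. n c z * cnj (n c' z)) = (\<Sum>y<Y. m c y * cnj (m c' y))"
      using c by (simp add: gm n_def expand gram del: cnj_sum)
    then show "(\<Sum>z<Z. n c z * cnj (n c' z)) = (if c = c' then complex_of_real (l c) else 0)"
      using orthogonal_familyD[OF m c] by simp
  qed
  define C where "C = {c. c < X \<and> l c \<noteq> 0}"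
  have finC [simp]: "finite C" by (simp add: C_def)
  have CX: "c < X" "l c \<noteq> 0" if "c \<in> C" for c using that by (auto simp: C_def)
  \<comment> \<open>\<open>W\<close> sends \<open>m c\<close> to \<open>n c\<close>; the factor
    \<open>1 / l c\<close> normalizes, which is why \<open>C\<close> leaves out the zero vectors.
    \<open>P\<close> is the projection onto the span of the \<open>m c\<close>, and \<open>R\<close>
    its complement.\<close>
  define W where "W z y = (\<Sum>c\<in>C. n c z * cnj (m c y) / l c)" for z y
  define P where "P y y' = (\<Sum>c\<in>C. m c y * cnj (m c y') / l c)" for y y'
  define R where "R y y' = (if y = y' then 1 else 0) - P y y'" for y y' :: nat
  have proj_m: "(\<Sum>y<Y. (\<Sum>c\<in>C. f c * cnj (m c y) / l c) * m c' y) = (if c' \<in> C then f c' else 0)"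
    if "c' < X" for f c'
  proof -
    have "(\<Sum>y<Y. (\<Sum>c\<in>C. f c * cnj (m c y) / l c) * m c' y) =
        (\<Sum>c\<in>C. f c / l c * (\<Sum>y<Y. m c' y * cnj (m c y)))"
      unfolding sum_distrib_left sum_distrib_right by (subst sum.swap) (simp add: mult_ac)
    also have "\<dots> = (\<Sum>c\<in>C. if c = c' then f c' else 0)"
      using that CX by (intro sum.cong) (auto simp: orthogonal_familyD[OF m])
    also have "\<dots> = (if c' \<in> C then f c' else 0)" by simp
    finally show ?thesis .
  qed
  have apply_M: "(\<Sum>y<Y. F y * M x y) = (\<Sum>c<X. U c x * (\<Sum>y<Y. F y * m c y))" if "x < X" for F x
  proof -
    have "(\<Sum>y<Y. F y * M x y) = (\<Sum>y<Y. \<Sum>c<X. U c x * (F y * m c y))"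
      using that by (intro sum.cong) (auto simp: M sum_distrib_left mult_ac)
    then show ?thesis by (subst (asm) sum.swap) (simp add: sum_distrib_left)
  qed
  have 1: "(\<Sum>y<Y. W z y * M x y) = N x z" if "x < X" "z < Z" for x z
  proof -
    have "(\<Sum>y<Y. W z y * M x y) = (\<Sum>c<X. U c x * (if c \<in> C then n c z else 0))"
      using that by (simp add: apply_M W_def proj_m)
    also have "\<dots> = (\<Sum>c<X. U c x * n c z)"
      using that orthogonal_family_zero[OF n] by (intro sum.cong) (auto simp: C_def)
    finally show ?thesis using N that by simp
  qed
  have PM: "(\<Sum>y'<Y. P y y' * M x y') = M x y" if "x < X" "y < Y" for x y
  proof -
    have "(\<Sum>y'<Y. P y y' * M x y') = (\<Sum>c<X. U c x * (if c \<in> C then m c y else 0))"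
      using that by (simp add: apply_M P_def proj_m)
    also have "\<dots> = (\<Sum>c<X. U c x * m c y)"
      using that orthogonal_family_zero[OF m] by (intro sum.cong) (auto simp: C_def)
    finally show ?thesis using M that by simp
  qed
  have 2: "(\<Sum>y'<Y. R y y' * M x y') = 0" if "x < X" "y < Y" for x y
  proof -
    have "(\<Sum>y'<Y. R y y' * M x y') = (\<Sum>y'<Y. (if y' = y then M x y' else 0) - P y y' * M x y')"
      by (intro sum.cong) (auto simp: R_def algebra_simps)
    then show ?thesis using that PM by (simp add: sum_subtractf)
  qed
  \<comment> \<open>With \<open>f = n\<close> this is the initial projection of the partial isometry
    \<open>W\<close>, with \<open>f = m\<close> the idempotence of \<open>P\<close>.\<close>
  have gramC: "(\<Sum>z<K. cnj (\<Sum>c\<in>C. f c z * cnj (m c y) / l c) * (\<Sum>c\<in>C. f c z * cnj (m c y') / l c)) = P y y'"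
    if f: "orthogonal_family X K f l" for K :: nat and f y y'
  proof -
    have "(\<Sum>z<K. cnj (\<Sum>c\<in>C. f c z * cnj (m c y) / l c) * (\<Sum>c\<in>C. f c z * cnj (m c y') / l c)) =
       (\<Sum>z<K. \<Sum>c\<in>C. \<Sum>d\<in>C. m c y / l c * cnj (m d y') / l d * (f d z * cnj (f c z)))"
      unfolding cnj_sum sum_product by (simp add: mult_ac)
    also have "\<dots> = (\<Sum>c\<in>C. \<Sum>z<K. \<Sum>d\<in>C. m c y / l c * cnj (m d y') / l d * (f d z * cnj (f c z)))"
      by (rule sum.swap)
    also have "\<dots> = (\<Sum>c\<in>C. \<Sum>d\<in>C. \<Sum>z<K. m c y / l c * cnj (m d y') / l d * (f d z * cnj (f c z)))"
      by (intro sum.cong refl sum.swap)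
    also have "\<dots> = (\<Sum>c\<in>C. \<Sum>d\<in>C. m c y / l c * cnj (m d y') / l d * (\<Sum>z<K. f d z * cnj (f c z)))"
      by (simp add: sum_distrib_left)
    also have "\<dots> = (\<Sum>c\<in>C. \<Sum>d\<in>C. if d = c then m c y * cnj (m c y') / l c else 0)"
      using CX by (intro sum.cong refl) (auto simp: orthogonal_familyD[OF f])
    finally show ?thesis by (simp add: P_def)
  qed
  have 3: "(\<Sum>z<Z. cnj (W z y) * W z y') + (\<Sum>z<Y. cnj (R z y) * R z y') = (if y = y' then 1 else 0)"
    if y: "y < Y" "y' < Y" for y y'
  proof -
    have "(\<Sum>z<Z. cnj (W z y) * W z y') = P y y'" unfolding W_def by (rule gramC[OF n])
    moreover have PP: "(\<Sum>z<Y. cnj (P z y) * P z y') = P y y'" using gramC[OF m, of y y'] by (simp only: P_def)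
    moreover have "cnj (P y' y) = P y y'" for y y' by (simp add: P_def mult_ac)
    moreover have "cnj (R z y) * R z y' = (if z = y then if y = y' then 1 else 0 else 0)
       - (if z = y' then cnj (P z y) else 0) - (if z = y then P z y' else 0) + cnj (P z y) * P z y'" for z
      by (auto simp: R_def algebra_simps)
    ultimately show ?thesis using y by (simp add: sum.distrib sum_subtractf)
  qed
  show ?thesis by (rule that[of W R]) (use 1 2 3 in auto)
qed

section \<open>Functional calculus, entropy and trace norm\<close>

lemma mat_adjoint_dim [simp]: "dim_row (mat_adjoint A) = dim_col A" "dim_col (mat_adjoint A) = dim_row A"
  by (auto simp: mat_adjoint_def)

lemma mat_adjoint_index [simp]:
  "i < dim_col A \<Longrightarrow> j < dim_row A \<Longrightarrow> mat_adjoint A $$ (i, j) = cnj (A $$ (j, i))"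
  by (simp add: mat_adjoint_def mat_of_rows_index)

text \<open>Since \<open>herm_fun\<close> selects some diagonalization, entropy and trace norm are
  evaluated only on matrices given in this form. The first argument of \<open>U\<close> numbers the
  eigenvectors, so \<open>U\<close> is transposed compared to the unitary matrix in
  \<open>herm_fun\<close>.\<close>

definition spectral_mat :: "nat \<Rightarrow> (nat \<Rightarrow> real) \<Rightarrow> (nat \<Rightarrow> nat \<Rightarrow> complex) \<Rightarrow> complex mat" where
  "spectral_mat n l U = mat n n (\<lambda>(i, j). \<Sum>c<n. l c * (U c i * cnj (U c j)))"

lemma spectral_mat_carrier [simp]: "spectral_mat n l U \<in> carrier_mat n n"
  by (simp add: spectral_mat_def)

lemma spectral_mat_dim [simp]: "dim_row (spectral_mat n l U) = n" "dim_col (spectral_mat n l U) = n"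
  by (simp_all add: spectral_mat_def)

lemma spectral_mat_index:
  "i < n \<Longrightarrow> j < n \<Longrightarrow> spectral_mat n l U $$ (i, j) = (\<Sum>c<n. l c * (U c i * cnj (U c j)))"
  by (simp add: spectral_mat_def)

lemma unitary_mat_conj_diag:
  assumes "U \<in> carrier_mat n n"
  shows "U * mat_diag n (\<lambda>i. complex_of_real (l i)) * mat_adjoint U = spectral_mat n l (\<lambda>c x. U $$ (x, c))"
  using assms by (intro eq_matI)
    (auto simp: spectral_mat_def mat_diag_mult_right[of U n n] scalar_prod_def atLeast0LessThan mult_ac)

lemma unitary_mat_iff:
  assumes "U \<in> carrier_mat n n"
  shows "unitary_mat n U \<longleftrightarrow> orthogonal_family n n (\<lambda>c x. U $$ (x, c)) (\<lambda>_. 1)"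
proof
  assume "unitary_mat n U"
  then have *: "mat_adjoint U * U = 1\<^sub>m n" by (simp add: unitary_mat_def)
  show "orthogonal_family n n (\<lambda>c x. U $$ (x, c)) (\<lambda>_. 1)"
    unfolding orthogonal_family_def
  proof (intro allI impI)
    fix c c' assume c: "c < n" "c' < n"
    have "(mat_adjoint U * U) $$ (c', c) = (\<Sum>x<n. U $$ (x, c) * cnj (U $$ (x, c')))"
      using c assms by (simp add: scalar_prod_def atLeast0LessThan mult.commute)
    then show "(\<Sum>x<n. U $$ (x, c) * cnj (U $$ (x, c'))) = (if c = c' then complex_of_real 1 else 0)"
      unfolding * using c by auto
  qed
next
  assume U: "orthogonal_family n n (\<lambda>c x. U $$ (x, c)) (\<lambda>_. 1)"
  have "mat_adjoint U * U = 1\<^sub>m n"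
    using assms by (intro eq_matI)
      (auto simp: scalar_prod_def atLeast0LessThan mult.commute[of "cnj _"] orthogonal_familyD[OF U])
  moreover have "U * mat_adjoint U = 1\<^sub>m n"
    using assms by (intro eq_matI) (auto simp: scalar_prod_def atLeast0LessThan orthonormal_complete[OF U])
  ultimately show "unitary_mat n U" using assms by (simp add: unitary_mat_def)
qed

lemma spectral_mat_eigen:
  assumes U: "orthogonal_family n n U (\<lambda>_. 1)" and "i < n" "c < n"
  shows "(\<Sum>j<n. spectral_mat n l U $$ (i, j) * U c j) = l c * U c i"
proof -
  have "(\<Sum>j<n. spectral_mat n l U $$ (i, j) * U c j) = (\<Sum>j<n. (\<Sum>d<n. l d * (U d i * cnj (U d j))) * U c j)"
    using assms by (simp add: spectral_mat_index)
  also have "\<dots> = (\<Sum>d<n. l d * U d i * (\<Sum>j<n. U c j * cnj (U d j)))"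
    unfolding sum_distrib_left sum_distrib_right by (subst sum.swap) (simp add: mult_ac)
  also have "\<dots> = (\<Sum>d<n. if d = c then l c * U c i else 0)"
    using assms by (intro sum.cong) (auto simp: orthogonal_familyD[OF U])
  finally show ?thesis using assms by simp
qed

lemma spectral_mat_hermitian:
  "i < n \<Longrightarrow> j < n \<Longrightarrow> spectral_mat n l U $$ (i, j) = cnj (spectral_mat n l U $$ (j, i))"
  by (simp add: spectral_mat_index mult.commute)

lemma orthonormal_expand:
  assumes U: "orthogonal_family n n U (\<lambda>_. 1)" and "i < n"
  shows "(\<Sum>c<n. (\<Sum>j<n. cnj (U c j) * f j) * U c i) = f i"
proof -
  have "(\<Sum>c<n. (\<Sum>j<n. cnj (U c j) * f j) * U c i) = (\<Sum>j<n. (\<Sum>c<n. U c i * cnj (U c j)) * f j)"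
    unfolding sum_distrib_left sum_distrib_right by (subst sum.swap) (simp add: mult_ac)
  also have "\<dots> = (\<Sum>j<n. if j = i then f i else 0)"
    using assms by (intro sum.cong) (auto simp: orthonormal_complete[OF U])
  finally show ?thesis using assms by simp
qed

lemma parseval:
  assumes U: "orthogonal_family n n U (\<lambda>_. 1)"
  shows "(\<Sum>c<n. (cmod (\<Sum>j<n. cnj (U c j) * f j))\<^sup>2) = (\<Sum>j<n. (cmod (f j))\<^sup>2)"
proof -
  have "complex_of_real (\<Sum>c<n. (cmod (\<Sum>j<n. cnj (U c j) * f j))\<^sup>2) =
    (\<Sum>c<n. (\<Sum>j<n. cnj (U c j) * f j) * (\<Sum>i<n. U c i * cnj (f i)))"
    unfolding of_real_sum complex_norm_square cnj_sum by simp
  also have "\<dots> = (\<Sum>i<n. (\<Sum>c<n. (\<Sum>j<n. cnj (U c j) * f j) * U c i) * cnj (f i))"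
    unfolding sum_distrib_left sum_distrib_right[of _ _ "cnj (f _)"] by (subst sum.swap) (simp add: mult_ac)
  also have "\<dots> = (\<Sum>i<n. f i * cnj (f i))"
    by (simp add: orthonormal_expand[OF U])
  also have "\<dots> = complex_of_real (\<Sum>j<n. (cmod (f j))\<^sup>2)"
    unfolding of_real_sum complex_norm_square ..
  finally show ?thesis by (simp only: of_real_eq_iff)
qed

text \<open>The overlaps \<open>T d c\<close> of the two eigenbases satisfy
  \<open>l c * T d c = k d * T d c\<close>, so they vanish unless the eigenvalues agree, and
  \<open>l\<close>, \<open>k\<close> may be replaced by \<open>f \<circ> l\<close>,
  \<open>f \<circ> k\<close>. Expanding each basis in the other then turns one matrix into the
  other.\<close>

lemma spectral_mat_unique:
  assumes U: "orthogonal_family n n U (\<lambda>_. 1)" and V: "orthogonal_family n n V (\<lambda>_. 1)"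
    and eq: "spectral_mat n l U = spectral_mat n k V"
  shows "spectral_mat n (f \<circ> l) U = spectral_mat n (f \<circ> k) V"
proof (rule eq_matI)
  fix i j assume "i < dim_row (spectral_mat n (f \<circ> k) V)" "j < dim_col (spectral_mat n (f \<circ> k) V)"
  then have ij: "i < n" "j < n" by auto
  define T where "T d c = (\<Sum>i<n. cnj (V d i) * U c i)" for d c
  have T: "f (l c) * T d c = f (k d) * T d c" if c: "c < n" "d < n" for c d
  proof -
    let ?X = "spectral_mat n l U"
    have "l c * T d c = (\<Sum>i<n. cnj (V d i) * (\<Sum>j<n. ?X $$ (i, j) * U c j))"
      using c by (simp add: T_def spectral_mat_eigen[OF U] sum_distrib_left mult.left_commute)
    also have "\<dots> = (\<Sum>j<n. (\<Sum>i<n. cnj (V d i) * ?X $$ (i, j)) * U c j)"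
      unfolding sum_distrib_left sum_distrib_right by (subst sum.swap) (simp add: mult_ac)
    also have "\<dots> = (\<Sum>j<n. cnj (\<Sum>i<n. ?X $$ (j, i) * V d i) * U c j)"
      by (simp add: spectral_mat_hermitian[symmetric] mult.commute)
    also have "\<dots> = (\<Sum>j<n. cnj (k d * V d j) * U c j)"
      using c unfolding eq by (simp add: spectral_mat_eigen[OF V] del: cnj_sum)
    also have "\<dots> = k d * T d c"
      by (simp add: T_def sum_distrib_left mult_ac)
    finally show ?thesis by auto
  qed
  have 1: "(\<Sum>d<n. T d c * V d i) = U c i" for c
    unfolding T_def using orthonormal_expand[OF V ij(1), of "U c"] by simp
  have 2: "(\<Sum>c<n. T d c * cnj (U c j)) = cnj (V d j)" for d
    using arg_cong[OF orthonormal_expand[OF U ij(2), of "V d"], of cnj] by (simp add: T_def mult.commute)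
  have "spectral_mat n (f \<circ> l) U $$ (i, j) = (\<Sum>c<n. f (l c) * ((\<Sum>d<n. T d c * V d i) * cnj (U c j)))"
    using ij by (simp add: spectral_mat_index 1)
  also have "\<dots> = (\<Sum>c<n. \<Sum>d<n. (f (l c) * T d c) * (V d i * cnj (U c j)))"
    by (simp add: sum_distrib_left sum_distrib_right mult_ac)
  also have "\<dots> = (\<Sum>c<n. \<Sum>d<n. (f (k d) * T d c) * (V d i * cnj (U c j)))"
    by (intro sum.cong refl) (use T in auto)
  also have "\<dots> = (\<Sum>d<n. f (k d) * (V d i * (\<Sum>c<n. T d c * cnj (U c j))))"
    unfolding sum_distrib_left by (subst sum.swap) (simp add: mult_ac)
  also have "\<dots> = spectral_mat n (f \<circ> k) V $$ (i, j)"
    using ij by (simp add: spectral_mat_index 2)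
  finally show "spectral_mat n (f \<circ> l) U $$ (i, j) = spectral_mat n (f \<circ> k) V $$ (i, j)" .
qed auto

lemma herm_fun_spectral_mat:
  assumes U: "orthogonal_family n n U (\<lambda>_. 1)"
  shows "herm_fun f (spectral_mat n l U) = spectral_mat n (f \<circ> l) U"
  unfolding herm_fun_def spectral_mat_dim
proof (rule someI2)
  let ?U = "mat n n (\<lambda>(x, c). U c x)"
  have sp: "spectral_mat n k (\<lambda>c x. ?U $$ (x, c)) = spectral_mat n k U" for k
    by (rule eq_matI) (auto simp: spectral_mat_def)
  have "orthogonal_family n n (\<lambda>c x. ?U $$ (x, c)) (\<lambda>_. 1)"
    using U by (simp add: orthogonal_family_def)
  then show "\<exists>V k. unitary_mat n V \<and>
     spectral_mat n l U = V * mat_diag n (\<lambda>i. complex_of_real (k i)) * mat_adjoint V \<and>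
     spectral_mat n (f \<circ> l) U = V * mat_diag n (\<lambda>i. complex_of_real (f (k i))) * mat_adjoint V"
    by (intro exI[of _ ?U] exI[of _ l]) (simp add: unitary_mat_iff unitary_mat_conj_diag sp comp_def)
next
  fix Y
  assume "\<exists>V k. unitary_mat n V \<and>
     spectral_mat n l U = V * mat_diag n (\<lambda>i. complex_of_real (k i)) * mat_adjoint V \<and>
     Y = V * mat_diag n (\<lambda>i. complex_of_real (f (k i))) * mat_adjoint V"
  then obtain V k where V: "unitary_mat n V"
    and eq: "spectral_mat n l U = V * mat_diag n (\<lambda>i. complex_of_real (k i)) * mat_adjoint V"
    and Y: "Y = V * mat_diag n (\<lambda>i. complex_of_real (f (k i))) * mat_adjoint V" by blast
  have Vc: "V \<in> carrier_mat n n" using V by (simp add: unitary_mat_def)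
  have "spectral_mat n (f \<circ> l) U = spectral_mat n (f \<circ> k) (\<lambda>c x. V $$ (x, c))"
    using U V eq Vc by (intro spectral_mat_unique) (auto simp: unitary_mat_iff unitary_mat_conj_diag)
  then show "Y = spectral_mat n (f \<circ> l) U" using Vc by (simp add: Y unitary_mat_conj_diag comp_def)
qed

lemma mtrace_spectral_mat:
  assumes U: "orthogonal_family n n U (\<lambda>_. 1)"
  shows "mtrace (spectral_mat n l U) = (\<Sum>c<n. l c)"
proof -
  have "mtrace (spectral_mat n l U) = (\<Sum>c<n. l c * (\<Sum>i<n. U c i * cnj (U c i)))"
    unfolding mtrace_def sum_distrib_left spectral_mat_dim
    by (subst sum.swap) (simp add: spectral_mat_index)
  then show ?thesis by (simp add: orthogonal_familyD[OF U])
qed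

lemma spectral_mat_mult:
  assumes U: "orthogonal_family n n U (\<lambda>_. 1)"
  shows "spectral_mat n k U * spectral_mat n l U = spectral_mat n (\<lambda>c. k c * l c) U"
proof (rule eq_matI)
  fix i j assume "i < dim_row (spectral_mat n (\<lambda>c. k c * l c) U)" "j < dim_col (spectral_mat n (\<lambda>c. k c * l c) U)"
  then have ij: "i < n" "j < n" by auto
  have "(spectral_mat n k U * spectral_mat n l U) $$ (i, j) =
    (\<Sum>x<n. spectral_mat n k U $$ (i, x) * (\<Sum>c<n. l c * (U c x * cnj (U c j))))"
    using ij by (simp add: scalar_prod_def atLeast0LessThan spectral_mat_index)
  also have "\<dots> = (\<Sum>c<n. l c * (\<Sum>x<n. spectral_mat n k U $$ (i, x) * U c x) * cnj (U c j))"
    unfolding sum_distrib_left sum_distrib_right by (subst sum.swap) (simp add: mult_ac)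
  also have "\<dots> = (\<Sum>c<n. l c * (k c * U c i) * cnj (U c j))"
    using ij by (simp add: spectral_mat_eigen[OF U])
  also have "\<dots> = spectral_mat n (\<lambda>c. k c * l c) U $$ (i, j)"
    using ij by (simp add: spectral_mat_index mult_ac)
  finally show "(spectral_mat n k U * spectral_mat n l U) $$ (i, j) = spectral_mat n (\<lambda>c. k c * l c) U $$ (i, j)" .
qed auto

lemma vn_entropy_spectral_mat:
  assumes U: "orthogonal_family n n U (\<lambda>_. 1)"
  shows "vn_entropy (spectral_mat n l U) = - (\<Sum>c<n. l c * log 2 (l c))"
  by (simp add: vn_entropy_def herm_fun_spectral_mat[OF U] spectral_mat_mult[OF U] mtrace_spectral_mat[OF U])

text \<open>The matrix is Hermitian, so the argument of the square root has the same eigenvectors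
  and the squares of the \<open>l c\<close> as eigenvalues.\<close>

lemma trace_norm_spectral_mat:
  assumes U: "orthogonal_family n n U (\<lambda>_. 1)"
  shows "trace_norm (spectral_mat n l U) = (\<Sum>c<n. \<bar>l c\<bar>)"
proof -
  have "mat_adjoint (spectral_mat n l U) = spectral_mat n l U"
    by (rule eq_matI) (auto simp: spectral_mat_hermitian[symmetric])
  then show ?thesis
    by (simp add: trace_norm_def spectral_mat_mult[OF U] herm_fun_spectral_mat[OF U]
        mtrace_spectral_mat[OF U])
qed

lemma norm_square_diff_le: "\<bar>(cmod a)\<^sup>2 - (cmod b)\<^sup>2\<bar> \<le> cmod (a - b) * cmod a + cmod (a - b) * cmod b"
proof -
  have "\<bar>(cmod a)\<^sup>2 - (cmod b)\<^sup>2\<bar> = \<bar>cmod a - cmod b\<bar> * (cmod a + cmod b)"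
    by (simp add: power2_eq_square square_diff_square_factored abs_mult)
  also have "\<dots> \<le> cmod (a - b) * (cmod a + cmod b)"
    by (intro mult_right_mono norm_triangle_ineq3) auto
  finally show ?thesis by (simp add: distrib_left)
qed

text \<open>
  \<open>|l\<^sub>c|\<close> is a difference of the squares of the \<open>c\<close>-th coefficients of \<open>x\<^sub>k\<close> and \<open>y\<^sub>k\<close> in an eigenbasis,
  so that the Cauchy--Schwarz inequality applies to the sum over \<open>c\<close>.
\<close>

lemma trace_norm_diff_le:
  fixes x y :: "'k \<Rightarrow> nat \<Rightarrow> complex"
  assumes "finite K"
  shows "trace_norm (mat n n (\<lambda>(i, j). \<Sum>k\<in>K. x k i * cnj (x k j) - y k i * cnj (y k j))) \<le>
    (\<Sum>k\<in>K. L2_set (\<lambda>i. cmod (x k i - y k i)) {..<n} *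
      (L2_set (\<lambda>i. cmod (x k i)) {..<n} + L2_set (\<lambda>i. cmod (y k i)) {..<n}))"
proof -
  define A where "A i j = (\<Sum>k\<in>K. x k i * cnj (x k j) - y k i * cnj (y k j))" for i j
  have "A i j = cnj (A j i)" for i j by (simp add: A_def mult.commute)
  then obtain U :: "nat \<Rightarrow> nat \<Rightarrow> complex" and l :: "nat \<Rightarrow> real" where U: "orthogonal_family n n U (\<lambda>_. 1)"
    and A: "\<And>i j. i < n \<Longrightarrow> j < n \<Longrightarrow> A i j = (\<Sum>c<n. l c * (U c i * cnj (U c j)))"
    using spectral_theorem[of n A] by blast
  have X: "mat n n (\<lambda>(i, j). A i j) = spectral_mat n l U"
    by (rule eq_matI) (auto simp: A spectral_mat_index)
  define a where "a k c = (\<Sum>i<n. cnj (U c i) * x k i)" for k c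
  define b where "b k c = (\<Sum>i<n. cnj (U c i) * y k i)" for k c
  have ab: "a k c - b k c = (\<Sum>i<n. cnj (U c i) * (x k i - y k i))" for k c
    by (simp add: a_def b_def right_diff_distrib sum_subtractf)
  \<comment> \<open>\<open>l c\<close> is the expectation value of the matrix in its eigenvector
    \<open>U c\<close>.\<close>
  have l: "l c = (\<Sum>k\<in>K. (cmod (a k c))\<^sup>2 - (cmod (b k c))\<^sup>2)" if c: "c < n" for c
  proof -
    have sq: "(\<Sum>i<n. \<Sum>j<n. cnj (U c i) * (z i * cnj (z j)) * U c j) =
       complex_of_real ((cmod (\<Sum>i<n. cnj (U c i) * z i))\<^sup>2)" for z
      unfolding complex_norm_square cnj_sum sum_product by (simp add: mult_ac)
    have "complex_of_real (l c) = (\<Sum>i<n. l c * (U c i * cnj (U c i)))"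
      using c by (simp add: sum_distrib_left[symmetric] orthogonal_familyD[OF U])
    also have "\<dots> = (\<Sum>i<n. cnj (U c i) * (\<Sum>j<n. spectral_mat n l U $$ (i, j) * U c j))"
      using c by (simp add: spectral_mat_eigen[OF U]) (simp add: mult_ac)
    also have "\<dots> = (\<Sum>i<n. \<Sum>j<n. \<Sum>k\<in>K. cnj (U c i) * (x k i * cnj (x k j)) * U c j
        - cnj (U c i) * (y k i * cnj (y k j)) * U c j)"
      by (simp add: X[symmetric] A_def sum_distrib_left sum_distrib_right algebra_simps)
    also have "\<dots> = (\<Sum>i<n. \<Sum>k\<in>K. \<Sum>j<n. cnj (U c i) * (x k i * cnj (x k j)) * U c j
        - cnj (U c i) * (y k i * cnj (y k j)) * U c j)"
      by (intro sum.cong refl sum.swap)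
    also have "\<dots> = (\<Sum>k\<in>K. \<Sum>i<n. \<Sum>j<n. cnj (U c i) * (x k i * cnj (x k j)) * U c j
        - cnj (U c i) * (y k i * cnj (y k j)) * U c j)"
      by (rule sum.swap)
    also have "\<dots> = of_real (\<Sum>k\<in>K. (cmod (a k c))\<^sup>2 - (cmod (b k c))\<^sup>2)"
      by (simp add: sum_subtractf sq a_def b_def)
    finally show ?thesis by (simp only: of_real_eq_iff)
  qed
  have L2: "L2_set (\<lambda>c. cmod (\<Sum>i<n. cnj (U c i) * z i)) {..<n} = L2_set (\<lambda>i. cmod (z i)) {..<n}" for z
    by (simp add: L2_set_def parseval[OF U])
  have cs: "(\<Sum>c<n. cmod (f c) * cmod (g c)) \<le> L2_set (\<lambda>c. cmod (f c)) {..<n} * L2_set (\<lambda>c. cmod (g c)) {..<n}" for f g :: "nat \<Rightarrow> complex"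
    using L2_set_mult_ineq[of "\<lambda>c. cmod (f c)" "\<lambda>c. cmod (g c)" "{..<n}"] by simp
  have "trace_norm (mat n n (\<lambda>(i, j). A i j)) = (\<Sum>c<n. \<bar>l c\<bar>)"
    by (simp add: X trace_norm_spectral_mat[OF U])
  also have "\<dots> \<le> (\<Sum>c<n. \<Sum>k\<in>K. cmod (a k c - b k c) * cmod (a k c) + cmod (a k c - b k c) * cmod (b k c))"
    by (intro sum_mono, subst l, simp, rule order_trans[OF sum_abs], intro sum_mono norm_square_diff_le)
  also have "\<dots> = (\<Sum>k\<in>K. (\<Sum>c<n. cmod (a k c - b k c) * cmod (a k c)) + (\<Sum>c<n. cmod (a k c - b k c) * cmod (b k c)))"
    by (subst sum.swap) (simp add: sum.distrib)
  also have "\<dots> \<le> (\<Sum>k\<in>K. L2_set (\<lambda>c. cmod (a k c - b k c)) {..<n} * L2_set (\<lambda>c. cmod (a k c)) {..<n} +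
      L2_set (\<lambda>c. cmod (a k c - b k c)) {..<n} * L2_set (\<lambda>c. cmod (b k c)) {..<n})"
    by (intro sum_mono add_mono cs)
  also have "\<dots> = (\<Sum>k\<in>K. L2_set (\<lambda>i. cmod (x k i - y k i)) {..<n} *
      (L2_set (\<lambda>i. cmod (x k i)) {..<n} + L2_set (\<lambda>i. cmod (y k i)) {..<n}))"
    by (simp add: ab L2 distrib_left) (simp add: a_def b_def L2)
  finally show ?thesis by (simp add: A_def)
qed

section \<open>Kraus operators and ensembles\<close>

text \<open>Kraus operators are coefficient functions over an index set of arbitrary type; the index
  can then carry structure, such as a pair for a composition or a measured value together with a
  second label.\<close>

definition kraus :: "nat \<Rightarrow> nat \<Rightarrow> 'k set \<Rightarrow> ('k \<Rightarrow> nat \<Rightarrow> nat \<Rightarrow> complex) \<Rightarrow> complex mat \<Rightarrow> complex mat" where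
  "kraus d d' J K X = mat d' d' (\<lambda>(x, y). \<Sum>\<kappa>\<in>J. \<Sum>p<d. \<Sum>q<d. K \<kappa> x p * X $$ (p, q) * cnj (K \<kappa> y q))"

definition kraus_complete :: "nat \<Rightarrow> nat \<Rightarrow> 'k set \<Rightarrow> ('k \<Rightarrow> nat \<Rightarrow> nat \<Rightarrow> complex) \<Rightarrow> bool" where
  "kraus_complete d d' J K \<longleftrightarrow> finite J \<and>
     (\<forall>p<d. \<forall>q<d. (\<Sum>\<kappa>\<in>J. \<Sum>x<d'. cnj (K \<kappa> x p) * K \<kappa> x q) = (if p = q then 1 else 0))"

lemma kraus_carrier [simp]: "kraus d d' J K X \<in> carrier_mat d' d'"
  by (simp add: kraus_def)

lemma psdI:
  assumes "X \<in> carrier_mat d d"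
    and "\<And>v. 0 \<le> (\<Sum>x<d. \<Sum>y<d. cnj (v x) * X $$ (x, y) * v y)"
  shows "psd d X"
  unfolding psd_def
proof (intro conjI ballI)
  fix v :: "complex vec" assume "v \<in> carrier_vec d"
  then have "(X *\<^sub>v v) \<bullet>c v = (\<Sum>x<d. \<Sum>y<d. cnj (v $ x) * X $$ (x, y) * v $ y)"
    using assms(1) by (simp add: scalar_prod_def atLeast0LessThan sum_distrib_left sum_distrib_right mult_ac)
  then show "0 \<le> (X *\<^sub>v v) \<bullet>c v" using assms(2)[of "\<lambda>i. v $ i"] by simp
qed (fact assms(1))

lemma psdD:
  assumes "psd d X"
  shows "0 \<le> (\<Sum>x<d. \<Sum>y<d. cnj (v x) * X $$ (x, y) * v y)"
proof -
  have "(X *\<^sub>v vec d v) \<bullet>c vec d v = (\<Sum>x<d. \<Sum>y<d. cnj (v x) * X $$ (x, y) * v y)"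
    using assms by (auto simp: psd_def scalar_prod_def atLeast0LessThan sum_distrib_left sum_distrib_right mult_ac)
  then show ?thesis using assms by (metis psd_def vec_carrier)
qed

lemma lift_kraus_index:
  assumes "x < l * d' * r" "y < l * d' * r"
  shows "lift l r d d' (kraus d d' J K) X $$ (x, y) =
    (\<Sum>\<kappa>\<in>J. \<Sum>p<d. \<Sum>q<d. K \<kappa> (pos2 d' r x) p *
       X $$ (ix3 d r (pos1 d' r x) p (pos3 r x), ix3 d r (pos1 d' r y) q (pos3 r y)) *
       cnj (K \<kappa> (pos2 d' r y) q))"
  using assms pos_less[OF assms(1)] pos_less[OF assms(2)] by (simp add: lift_def kraus_def)

text \<open>The quadratic form of the output at \<open>v\<close> is the sum over \<kappa> of the
  quadratic forms of \<open>X\<close> at \<open>w \<kappa>\<close>, the image of \<open>v\<close>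
  under the adjoint of the Kraus operator tensored with the identity on dimension
  \<open>k\<close>.\<close>

lemma psd_lift_kraus:
  assumes X: "psd (d * k) X"
  shows "psd (d' * k) (lift 1 k d d' (kraus d d' J K) X)"
proof (rule psdI)
  show "lift 1 k d d' (kraus d d' J K) X \<in> carrier_mat (d' * k) (d' * k)" by (simp add: lift_def)
  fix v :: "nat \<Rightarrow> complex"
  let ?L = "lift 1 k d d' (kraus d d' J K) X"
  define w where "w \<kappa> z = (\<Sum>s<d'. cnj (K \<kappa> s (z div k)) * v (s * k + z mod k))" for \<kappa> z
  have L: "?L $$ (s * k + t, s' * k + t') =
      (\<Sum>\<kappa>\<in>J. \<Sum>p<d. \<Sum>q<d. K \<kappa> s p * X $$ (p * k + t, q * k + t') * cnj (K \<kappa> s' q))"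
    if "s < d'" "t < k" "s' < d'" "t' < k" for s t s' t'
  proof -
    have ix: "s * k + t < 1 * d' * k" "s' * k + t' < 1 * d' * k"
      using that by (auto intro: mult_add_less)
    have "pos1 d' k (s * k + t) = 0" "pos2 d' k (s * k + t) = s" "pos3 k (s * k + t) = t"
      "pos1 d' k (s' * k + t') = 0" "pos2 d' k (s' * k + t') = s'" "pos3 k (s' * k + t') = t'"
      using that pos1_ix3[of s d' t k 0] pos2_ix3[of s d' t k 0] pos3_ix3[of t k d' 0 s]
        pos1_ix3[of s' d' t' k 0] pos2_ix3[of s' d' t' k 0] pos3_ix3[of t' k d' 0 s']
      by (simp_all add: ix3_def)
    then show ?thesis unfolding lift_kraus_index[OF ix] by (simp add: ix3_def)
  qed
  have "(\<Sum>x<d'*k. \<Sum>y<d'*k. cnj (v x) * ?L $$ (x, y) * v y) =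
    (\<Sum>s<d'. \<Sum>t<k. \<Sum>s'<d'. \<Sum>t'<k. cnj (v (s * k + t)) * ?L $$ (s * k + t, s' * k + t') * v (s' * k + t'))"
    by (simp add: sum_lessThan_mult)
  also have "\<dots> = (\<Sum>s<d'. \<Sum>t<k. \<Sum>s'<d'. \<Sum>t'<k. \<Sum>\<kappa>\<in>J. \<Sum>p<d. \<Sum>q<d.
      cnj (v (s * k + t)) * (K \<kappa> s p * X $$ (p * k + t, q * k + t') * cnj (K \<kappa> s' q)) * v (s' * k + t'))"
    by (intro sum.cong refl) (simp add: L sum_distrib_left sum_distrib_right del: One_nat_def)
  also have "\<dots> = (\<Sum>\<kappa>\<in>J. \<Sum>s<d'. \<Sum>t<k. \<Sum>s'<d'. \<Sum>t'<k. \<Sum>p<d. \<Sum>q<d.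
      cnj (v (s * k + t)) * (K \<kappa> s p * X $$ (p * k + t, q * k + t') * cnj (K \<kappa> s' q)) * v (s' * k + t'))"
    by (simp only: sum.swap[where B = J])
  also have "\<dots> = (\<Sum>\<kappa>\<in>J. \<Sum>x<d*k. \<Sum>y<d*k. cnj (w \<kappa> x) * X $$ (x, y) * w \<kappa> y)"
  proof (rule sum.cong[OF refl])
    fix \<kappa>
    have "(\<Sum>x<d*k. \<Sum>y<d*k. cnj (w \<kappa> x) * X $$ (x, y) * w \<kappa> y) =
      (\<Sum>p<d. \<Sum>t<k. \<Sum>q<d. \<Sum>t'<k. (\<Sum>s<d'. K \<kappa> s p * cnj (v (s * k + t))) *
         X $$ (p * k + t, q * k + t') * (\<Sum>s'<d'. cnj (K \<kappa> s' q) * v (s' * k + t')))"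
      unfolding sum_lessThan_mult by (intro sum.cong refl) (simp add: w_def)
    also have "\<dots> = (\<Sum>p<d. \<Sum>t<k. \<Sum>q<d. \<Sum>t'<k. \<Sum>s<d'. \<Sum>s'<d'.
        cnj (v (s * k + t)) * (K \<kappa> s p * X $$ (p * k + t, q * k + t') * cnj (K \<kappa> s' q)) * v (s' * k + t'))"
      by (simp add: sum_distrib_left sum_distrib_right mult_ac)
    also have "\<dots> = (\<Sum>s<d'. \<Sum>t<k. \<Sum>s'<d'. \<Sum>t'<k. \<Sum>p<d. \<Sum>q<d.
      cnj (v (s * k + t)) * (K \<kappa> s p * X $$ (p * k + t, q * k + t') * cnj (K \<kappa> s' q)) * v (s' * k + t'))"
      unfolding sum.cartesian_product
      by (rule sum.reindex_bij_witness[of _ "\<lambda>(s, t, s', t', p, q). (p, t, q, t', s, s')"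
            "\<lambda>(p, t, q, t', s, s'). (s, t, s', t', p, q)"]) auto
    finally show "(\<Sum>s<d'. \<Sum>t<k. \<Sum>s'<d'. \<Sum>t'<k. \<Sum>p<d. \<Sum>q<d.
      cnj (v (s * k + t)) * (K \<kappa> s p * X $$ (p * k + t, q * k + t') * cnj (K \<kappa> s' q)) * v (s' * k + t')) =
      (\<Sum>x<d*k. \<Sum>y<d*k. cnj (w \<kappa> x) * X $$ (x, y) * w \<kappa> y)" by simp
  qed
  also have "0 \<le> \<dots>" by (intro sum_nonneg psdD[OF X])
  finally show "0 \<le> (\<Sum>x<d'*k. \<Sum>y<d'*k. cnj (v x) * ?L $$ (x, y) * v y)" .
qed

lemma kraus_quantum_operation:
  assumes "kraus_complete d d' J K"
  shows "quantum_operation d d' (kraus d d' J K)"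
  unfolding quantum_operation_def
proof (intro conjI ballI allI impI)
  fix X Y :: "complex mat" assume "X \<in> carrier_mat d d" "Y \<in> carrier_mat d d"
  then show "kraus d d' J K (X + Y) = kraus d d' J K X + kraus d d' J K Y"
    by (intro eq_matI) (auto simp: kraus_def algebra_simps sum.distrib)
next
  fix c and X :: "complex mat" assume "X \<in> carrier_mat d d"
  then show "kraus d d' J K (c \<cdot>\<^sub>m X) = c \<cdot>\<^sub>m kraus d d' J K X"
    by (intro eq_matI) (auto simp: kraus_def sum_distrib_left mult_ac)
next
  fix X :: "complex mat" assume X: "X \<in> carrier_mat d d"
  have "mtrace (kraus d d' J K X) = (\<Sum>x<d'. \<Sum>\<kappa>\<in>J. \<Sum>p<d. \<Sum>q<d. K \<kappa> x p * X $$ (p, q) * cnj (K \<kappa> x q))"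
    by (simp add: mtrace_def kraus_def)
  also have "\<dots> = (\<Sum>p<d. \<Sum>q<d. \<Sum>\<kappa>\<in>J. \<Sum>x<d'. K \<kappa> x p * X $$ (p, q) * cnj (K \<kappa> x q))"
    unfolding sum.cartesian_product
    by (rule sum.reindex_bij_witness[of _ "\<lambda>(p, q, \<kappa>, x). (x, \<kappa>, p, q)" "\<lambda>(x, \<kappa>, p, q). (p, q, \<kappa>, x)"]) auto
  also have "\<dots> = (\<Sum>p<d. \<Sum>q<d. X $$ (p, q) * (\<Sum>\<kappa>\<in>J. \<Sum>x<d'. cnj (K \<kappa> x q) * K \<kappa> x p))"
    by (simp add: sum_distrib_left mult_ac)
  also have "\<dots> = (\<Sum>p<d. \<Sum>q<d. if p = q then X $$ (p, q) else 0)"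
    using assms by (intro sum.cong refl) (auto simp: kraus_complete_def)
  also have "\<dots> = mtrace X" using X by (simp add: mtrace_def)
  finally show "mtrace (kraus d d' J K X) = mtrace X" .
next
  fix k X assume "psd (d * k) X"
  then show "psd (d' * k) (lift 1 k d d' (kraus d d' J K) X)" by (rule psd_lift_kraus)
qed auto

lemma kraus_comp:
  assumes "finite J" "finite L"
  shows "kraus d' d'' L R (kraus d d' J K X) =
    kraus d d'' (L \<times> J) (\<lambda>(a, b) x p. \<Sum>z<d'. R a x z * K b z p) X"
proof (rule eq_matI)
  fix x y assume "x < dim_row (kraus d d'' (L \<times> J) (\<lambda>(a, b) x p. \<Sum>z<d'. R a x z * K b z p) X)"
    "y < dim_col (kraus d d'' (L \<times> J) (\<lambda>(a, b) x p. \<Sum>z<d'. R a x z * K b z p) X)"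
  then have xy: "x < d''" "y < d''" by (auto simp: kraus_def)
  have "kraus d' d'' L R (kraus d d' J K X) $$ (x, y) =
    (\<Sum>a\<in>L. \<Sum>z<d'. \<Sum>z'<d'. \<Sum>b\<in>J. \<Sum>p<d. \<Sum>q<d. R a x z * (K b z p * X $$ (p, q) * cnj (K b z' q)) * cnj (R a y z'))"
    using xy by (simp add: kraus_def sum_distrib_left sum_distrib_right)
  also have "\<dots> = (\<Sum>a\<in>L. \<Sum>b\<in>J. \<Sum>p<d. \<Sum>q<d. \<Sum>z'<d'. \<Sum>z<d'. R a x z * (K b z p * X $$ (p, q) * cnj (K b z' q)) * cnj (R a y z'))"
    unfolding sum.cartesian_product
    by (rule sum.reindex_bij_witness[of _ "\<lambda>(a, b, p, q, z', z). (a, z, z', b, p, q)"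
          "\<lambda>(a, z, z', b, p, q). (a, b, p, q, z', z)"]) auto
  also have "\<dots> = kraus d d'' (L \<times> J) (\<lambda>(a, b) x p. \<Sum>z<d'. R a x z * K b z p) X $$ (x, y)"
    using xy by (simp add: kraus_def sum.cartesian_product' cnj_sum sum_product sum_distrib_left sum_distrib_right mult_ac)
  finally show "kraus d' d'' L R (kraus d d' J K X) $$ (x, y) =
    kraus d d'' (L \<times> J) (\<lambda>(a, b) x p. \<Sum>z<d'. R a x z * K b z p) X $$ (x, y)" .
qed (auto simp: kraus_def)

section \<open>Mixed states as families of unnormalized vectors\<close>

text \<open>The probabilities are absorbed into the norms of the \<open>V i\<close>. All operations
  of the protocol act on the vectors one by one, so that a mixed state with a classical message is a
  family indexed by the message.\<close>

definition ensemble :: "nat \<Rightarrow> 'i set \<Rightarrow> ('i \<Rightarrow> nat \<Rightarrow> complex) \<Rightarrow> complex mat" where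
  "ensemble D I V = mat D D (\<lambda>(x, y). \<Sum>i\<in>I. V i x * cnj (V i y))"

lemma ensemble_cong:
  "(\<And>i x. i \<in> I \<Longrightarrow> x < D \<Longrightarrow> V i x = V' i x) \<Longrightarrow> ensemble D I V = ensemble D I V'"
  by (auto simp: ensemble_def intro!: eq_matI)

text \<open>Every vector of the family branches into one vector for each Kraus operator.\<close>

lemma lift_kraus_ensemble:
  assumes "finite I" "finite J"
  shows "lift l r d d' (kraus d d' J K) (ensemble (l * d * r) I V) =
    ensemble (l * d' * r) (I \<times> J) (\<lambda>(i, \<kappa>) x. \<Sum>p<d. K \<kappa> (pos2 d' r x) p * V i (ix3 d r (pos1 d' r x) p (pos3 r x)))"
proof (rule eq_matI)
  let ?E = "ensemble (l * d' * r) (I \<times> J) (\<lambda>(i, \<kappa>) x. \<Sum>p<d. K \<kappa> (pos2 d' r x) p * V i (ix3 d r (pos1 d' r x) p (pos3 r x)))"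
  fix x y assume "x < dim_row ?E" "y < dim_col ?E"
  then have xy: "x < l * d' * r" "y < l * d' * r" by (auto simp: ensemble_def)
  define v where "v i p = V i (ix3 d r (pos1 d' r x) p (pos3 r x))" for i p
  define v' where "v' i p = V i (ix3 d r (pos1 d' r y) p (pos3 r y))" for i p
  have "lift l r d d' (kraus d d' J K) (ensemble (l * d * r) I V) $$ (x, y) =
    (\<Sum>\<kappa>\<in>J. \<Sum>p<d. \<Sum>q<d. \<Sum>i\<in>I. K \<kappa> (pos2 d' r x) p * (v i p * cnj (v' i q)) * cnj (K \<kappa> (pos2 d' r y) q))"
    unfolding lift_kraus_index[OF xy]
    by (intro sum.cong refl) (simp add: ensemble_def ix3_less pos_less[OF xy(1)] pos_less[OF xy(2)] v_def v'_def
        sum_distrib_left sum_distrib_right)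
  also have "\<dots> = (\<Sum>i\<in>I. \<Sum>\<kappa>\<in>J. \<Sum>p<d. \<Sum>q<d. K \<kappa> (pos2 d' r x) p * (v i p * cnj (v' i q)) * cnj (K \<kappa> (pos2 d' r y) q))"
    by (simp only: sum.swap[where B = I])
  also have "\<dots> = ?E $$ (x, y)"
    using xy by (simp add: ensemble_def sum.cartesian_product' sum_product v_def v'_def mult_ac)
  finally show "lift l r d d' (kraus d d' J K) (ensemble (l * d * r) I V) $$ (x, y) = ?E $$ (x, y)" .
qed (auto simp: lift_def ensemble_def)

lemma lift_A_kraus_ensemble:
  assumes "finite I" "finite J"
  shows "lift 1 (b * e) a a' (kraus a a' J K) (ensemble (a * b * e) I V) =
    ensemble (a' * b * e) (I \<times> J) (\<lambda>(i, \<kappa>) x. \<Sum>p<a. K \<kappa> (pos1 b e x) p * V i (ix3 b e p (pos2 b e x) (pos3 e x)))"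
proof -
  have "pos2 a' (b * e) x = pos1 b e x" "pos1 a' (b * e) x = 0"
    "ix3 a (b * e) 0 p (pos3 (b * e) x) = ix3 b e p (pos2 b e x) (pos3 e x)" if "x < a' * b * e" for x p
  proof -
    have "x div (b * e) < a'" using that by (simp add: less_mult_imp_div_less mult.assoc)
    then show "pos2 a' (b * e) x = pos1 b e x" "pos1 a' (b * e) x = 0"
      using that by (auto simp: pos2_def pos1_def mult.assoc)
    have "x mod (b * e) = x div e mod b * e + x mod e"
      by (simp add: mult.commute[of b] mod_mult2_eq)
    then show "ix3 a (b * e) 0 p (pos3 (b * e) x) = ix3 b e p (pos2 b e x) (pos3 e x)"
      by (simp add: ix3_def pos3_def pos2_def algebra_simps)
  qed
  then show ?thesis
    using lift_kraus_ensemble[OF assms, of 1 "b * e" a a' K V]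
    by (auto simp: mult.assoc intro!: ensemble_cong)
qed

lemma lift_B_kraus_ensemble:
  assumes "finite I" "finite J"
  shows "lift a e b b' (kraus b b' J K) (ensemble (a * b * e) I V) =
    ensemble (a * b' * e) (I \<times> J) (\<lambda>(i, \<kappa>) x. \<Sum>p<b. K \<kappa> (pos2 b' e x) p * V i (ix3 b e (pos1 b' e x) p (pos3 e x)))"
  by (rule lift_kraus_ensemble[OF assms])

lemma lift_E_kraus_ensemble:
  assumes "finite I" "finite J"
  shows "lift (a * b) 1 e e' (kraus e e' J K) (ensemble (a * b * e) I V) =
    ensemble (a * b * e') (I \<times> J) (\<lambda>(i, \<kappa>) x. \<Sum>p<e. K \<kappa> (pos3 e' x) p * V i (ix3 b e (pos1 b e' x) (pos2 b e' x) p))"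
proof -
  have "pos2 e' 1 x = pos3 e' x" "ix3 e 1 (pos1 e' 1 x) p (pos3 1 x) = ix3 b e (pos1 b e' x) (pos2 b e' x) p" for x p
    by (simp_all add: pos1_def pos2_def pos3_def ix3_def mult.commute[of b] div_mult2_eq)
  then show ?thesis
    using lift_kraus_ensemble[OF assms, of "a * b" 1 e e' K V]
    by (auto intro!: ensemble_cong)
qed

section \<open>Reversibility of Eve's encoding\<close>

text \<open>Serves to verify a recovery operation: after composing it with the operation to be
  undone, each Kraus operator turns out to be a multiple \<open>s \<kappa>\<close> of the identity,
  and only the total weight matters.\<close>

lemma kraus_scalar:
  assumes "X \<in> carrier_mat d d"
    and K: "\<And>\<kappa> p q. \<kappa> \<in> J \<Longrightarrow> p < d \<Longrightarrow> q < d \<Longrightarrow> K \<kappa> p q = (if p = q then s \<kappa> else 0)"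
    and s: "(\<Sum>\<kappa>\<in>J. s \<kappa> * cnj (s \<kappa>)) = 1"
  shows "kraus d d J K X = X"
proof (rule eq_matI)
  fix x y assume "x < dim_row X" "y < dim_col X"
  then have xy: "x < d" "y < d" using assms by auto
  have "kraus d d J K X $$ (x, y) = (\<Sum>\<kappa>\<in>J. \<Sum>p<d. \<Sum>q<d. K \<kappa> x p * X $$ (p, q) * cnj (K \<kappa> y q))"
    using xy by (simp add: kraus_def)
  also have "\<dots> = (\<Sum>\<kappa>\<in>J. \<Sum>p<d. \<Sum>q<d. if q = y then if p = x then s \<kappa> * X $$ (x, y) * cnj (s \<kappa>) else 0 else 0)"
    by (intro sum.cong refl) (use xy in \<open>auto simp: K\<close>)
  also have "\<dots> = (\<Sum>\<kappa>\<in>J. s \<kappa> * cnj (s \<kappa>)) * X $$ (x, y)"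
    using xy by (simp add: sum_distrib_left sum_distrib_right mult_ac)
  finally show "kraus d d J K X $$ (x, y) = X $$ (x, y)" by (simp add: s)
qed (use assms in \<open>auto simp: kraus_def\<close>)

text \<open>
  Applying an isometry and appending a uniformly distributed message is reversible. The recovery
  operation needs the extra Kraus operators with \<open>Q\<close> to be trace preserving off the range of \<open>W\<close>.
\<close>

lemma reversible_isometry_message:
  assumes W: "\<And>p q. p < e \<Longrightarrow> q < e \<Longrightarrow> (\<Sum>z<f. cnj (W z p) * W z q) = (if p = q then 1 else 0)"
    and "0 < d" "0 < e"
  shows "reversible_operation e (f * d) (kraus e (f * d) {..<d}
    (\<lambda>j z p. if z mod d = j then W (z div d) p / complex_of_real (sqrt d) else 0))"
proof -
  let ?K = "\<lambda>j z p. if z mod d = j then W (z div d) p / complex_of_real (sqrt d) else 0"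
  have sqd: "complex_of_real (sqrt d) * complex_of_real (sqrt d) = of_nat d" 
    by (simp flip: of_real_mult)
  have "kraus_complete e (f * d) {..<d} ?K"
    unfolding kraus_complete_def
  proof (intro conjI allI impI)
    fix p q assume pq: "p < e" "q < e"
    have "(\<Sum>j<d. \<Sum>x<f * d. cnj (?K j x p) * ?K j x q) =
       (\<Sum>j<d. \<Sum>u<f. \<Sum>m<d. if m = j then cnj (W u p) * W u q / of_nat d else 0)"
      unfolding sum_lessThan_mult by (intro sum.cong refl) (auto simp: sqd)
    also have "\<dots> = (\<Sum>j<d. (\<Sum>u<f. cnj (W u p) * W u q) / of_nat d)"
      by (simp add: sum_divide_distrib)
    also have "\<dots> = (if p = q then 1 else 0)" using pq \<open>0 < d\<close> by (simp add: W)
    finally show "(\<Sum>j<d. \<Sum>x<f * d. cnj (?K j x p) * ?K j x q) = (if p = q then 1 else 0)" .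
  qed simp
  then have V: "quantum_operation e (f * d) (kraus e (f * d) {..<d} ?K)"
    by (rule kraus_quantum_operation)
  \<comment> \<open>\<open>P\<close> is the projection onto the range of \<open>W\<close>, and
    \<open>Q\<close> its complement.\<close>
  define P where "P t u = (\<Sum>p<e. W t p * cnj (W u p))" for t u
  define Q where "Q t u = (if t = u then 1 else 0) - P t u" for t u :: nat
  \<comment> \<open>The index \<open>j\<close> reads off and discards the message. The value
    \<open>t = f\<close> is reserved for the adjoint of \<open>W\<close>, the actual recovery; each
    \<open>t < f\<close> contributes an operator that maps the complement of the range to the basis
    vector 0, which exists because \<open>0 < e\<close>.\<close>
  define R where "R = (\<lambda>(j, t) p z. if z mod d = j then
      if t = f then cnj (W (z div d) p) else if p = 0 then Q t (z div d) else 0 else 0)"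
  let ?J = "{..<d} \<times> {..f}"
  have cnjP: "cnj (P t u) = P u t" for t u by (simp add: P_def mult.commute)
  have WW: "(\<Sum>q<e. (\<Sum>p<e. F p * (\<Sum>t<f. cnj (W t p) * W t q)) * G q) = (\<Sum>p<e. F p * G p)" for F G
  proof -
    have "(\<Sum>q<e. (\<Sum>p<e. F p * (\<Sum>t<f. cnj (W t p) * W t q)) * G q) =
      (\<Sum>q<e. (\<Sum>p<e. if p = q then F p else 0) * G q)"
      by (intro sum.cong arg_cong2[where f = "(*)"] refl) (auto simp: W)
    then show ?thesis by simp
  qed
  have PP: "(\<Sum>t<f. P u t * P t v) = P u v" for u v
  proof -
    have "(\<Sum>t<f. P u t * P t v) = (\<Sum>t<f. \<Sum>q<e. \<Sum>p<e. W u p * (cnj (W t p) * W t q) * cnj (W v q))"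
      unfolding P_def sum_product by (subst sum.swap) (simp add: mult_ac)
    also have "\<dots> = (\<Sum>q<e. \<Sum>p<e. \<Sum>t<f. W u p * (cnj (W t p) * W t q) * cnj (W v q))"
      unfolding sum.cartesian_product
      by (rule sum.reindex_bij_witness[of _ "\<lambda>(q, p, t). (t, q, p)" "\<lambda>(t, q, p). (q, p, t)"]) auto
    also have "\<dots> = (\<Sum>q<e. (\<Sum>p<e. W u p * (\<Sum>t<f. cnj (W t p) * W t q)) * cnj (W v q))"
      by (simp add: sum_distrib_left sum_distrib_right)
    also have "\<dots> = P u v" by (simp add: WW P_def)
    finally show ?thesis .
  qed
  have QQ: "(\<Sum>t<f. cnj (Q t u) * Q t v) = Q u v" if "u < f" "v < f" for u v
  proof -
    have "(\<Sum>t<f. cnj (Q t u) * Q t v) = (\<Sum>t<f. (if t = u then Q u v else 0)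
        - (if t = v then P u v else 0) + P u t * P t v)"
      by (intro sum.cong refl) (auto simp: Q_def cnjP algebra_simps)
    then show ?thesis using that by (simp add: sum.distrib sum_subtractf PP)
  qed
  have "kraus_complete (f * d) e ?J R"
    unfolding kraus_complete_def
  proof (intro conjI allI impI)
    fix z z' assume z: "z < f * d" "z' < f * d"
    then have zf: "z div d < f" "z' div d < f" by (auto intro: less_mult_imp_div_less)
    have zd: "z mod d < d" using \<open>0 < d\<close> by simp
    have t1: "(\<Sum>x<e. cnj (R (j, f) x z) * R (j, f) x z') =
      (if j = z mod d then if z' mod d = z mod d then P (z div d) (z' div d) else 0 else 0)" for j
      by (auto simp: R_def P_def intro!: sum.cong sum.neutral)
    have t2: "(\<Sum>x<e. cnj (R (j, t) x z) * R (j, t) x z') =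
      (if j = z mod d then if z' mod d = z mod d then cnj (Q t (z div d)) * Q t (z' div d) else 0 else 0)" if "t < f" for j t
    proof -
      have "(\<Sum>x<e. cnj (R (j, t) x z) * R (j, t) x z') = (\<Sum>x<e. if x = 0 then
         (if j = z mod d then if z' mod d = z mod d then cnj (Q t (z div d)) * Q t (z' div d) else 0 else 0) else 0)"
        using that by (intro sum.cong refl) (auto simp: R_def)
      then show ?thesis using \<open>0 < e\<close> by simp
    qed
    have "(\<Sum>\<kappa>\<in>?J. \<Sum>x<e. cnj (R \<kappa> x z) * R \<kappa> x z') =
       (\<Sum>j<d. (\<Sum>t<f. \<Sum>x<e. cnj (R (j, t) x z) * R (j, t) x z') + (\<Sum>x<e. cnj (R (j, f) x z) * R (j, f) x z'))"
      by (simp add: sum.cartesian_product' lessThan_Suc_atMost[symmetric])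
    also have "\<dots> = (\<Sum>j<d. if j = z mod d then (if z' mod d = z mod d then
        (\<Sum>t<f. cnj (Q t (z div d)) * Q t (z' div d)) + P (z div d) (z' div d) else 0) else 0)"
      by (intro sum.cong refl) (simp add: t1 t2)
    also have "\<dots> = (if z' mod d = z mod d \<and> z div d = z' div d then 1 else 0)"
      using zd zf by (simp add: QQ) (simp add: Q_def)
    also have "\<dots> = (if z = z' then 1 else 0)" by (metis div_mult_mod_eq)
    finally show "(\<Sum>\<kappa>\<in>?J. \<Sum>x<e. cnj (R \<kappa> x z) * R \<kappa> x z') = (if z = z' then 1 else 0)" .
  qed simp
  then have RQ: "quantum_operation (f * d) e (kraus (f * d) e ?J R)"
    by (rule kraus_quantum_operation)
  have QW: "(\<Sum>u<f. Q t u * W u q) = 0" if "t < f" "q < e" for t q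
  proof -
    have "(\<Sum>u<f. P t u * W u q) = (\<Sum>p<e. W t p * (\<Sum>u<f. cnj (W u p) * W u q))"
      unfolding P_def sum_distrib_left sum_distrib_right by (subst sum.swap) (simp add: mult_ac)
    also have "\<dots> = (\<Sum>p<e. if p = q then W t q else 0)"
      using that by (intro sum.cong refl) (auto simp: W)
    finally have "(\<Sum>u<f. P t u * W u q) = W t q" using that by simp
    moreover have "(\<Sum>u<f. Q t u * W u q) = (\<Sum>u<f. (if u = t then W t q else 0) - P t u * W u q)"
      by (intro sum.cong refl) (auto simp: Q_def algebra_simps)
    ultimately show ?thesis using that by (simp add: sum_subtractf)
  qed
  \<comment> \<open>On the range of \<open>W\<close> all operators with \<open>t < f\<close> vanish,
    and recovery and encoding must agree on the message. What is left are \<open>d\<close> multiples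
    of the identity by \<open>1 / sqrt d\<close>, of total weight 1.\<close>
  have RK: "(\<Sum>z<f * d. R (j, t) p z * ?K i z q) =
      (if p = q then if i = j \<and> t = f then 1 / complex_of_real (sqrt d) else 0 else 0)"
    if "j < d" "t \<le> f" "i < d" "p < e" "q < e" for j t i p q
  proof -
    have "(\<Sum>z<f * d. R (j, t) p z * ?K i z q) =
      (\<Sum>u<f. \<Sum>m<d. if m = j then if i = j then
         (if t = f then cnj (W u p) * W u q else if p = 0 then Q t u * W u q else 0) / complex_of_real (sqrt d) else 0 else 0)"
      unfolding sum_lessThan_mult by (intro sum.cong refl) (auto simp: R_def)
    also have "\<dots> = (\<Sum>u<f. if i = j then
         (if t = f then cnj (W u p) * W u q else if p = 0 then Q t u * W u q else 0) / complex_of_real (sqrt d) else 0)"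
      using that by simp
    also have "\<dots> = (if i = j then (if t = f then (\<Sum>u<f. cnj (W u p) * W u q)
         else if p = 0 then (\<Sum>u<f. Q t u * W u q) else 0) / complex_of_real (sqrt d) else 0)"
      by (simp add: sum_divide_distrib)
    also have "\<dots> = (if p = q then if i = j \<and> t = f then 1 / complex_of_real (sqrt d) else 0 else 0)"
      using that by (auto simp: W QW)
    finally show ?thesis .
  qed
  have "kraus (f * d) e ?J R (kraus e (f * d) {..<d} ?K \<rho>) = \<rho>" if "density e \<rho>" for \<rho>
  proof -
    have \<rho>: "\<rho> \<in> carrier_mat e e" using that by (simp add: density_def psd_def)
    define s :: "(nat \<times> nat) \<times> nat \<Rightarrow> complex" where "s = (\<lambda>((j, t), i). if i = j \<and> t = f then 1 / complex_of_real (sqrt d) else 0)"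
    have "(\<Sum>\<kappa>\<in>?J \<times> {..<d}. s \<kappa> * cnj (s \<kappa>)) = (\<Sum>j<d. \<Sum>t\<le>f. \<Sum>i<d. if i = j then if t = f then 1 / of_nat d else 0 else 0)"
      unfolding s_def sum.cartesian_product' by (intro sum.cong refl) (auto simp: sqd)
    also have "\<dots> = 1" using \<open>0 < d\<close> by simp
    finally have s: "(\<Sum>\<kappa>\<in>?J \<times> {..<d}. s \<kappa> * cnj (s \<kappa>)) = 1" .
    show ?thesis
      unfolding kraus_comp[OF finite_lessThan finite_cartesian_product[OF finite_lessThan finite_atMost]]
      by (rule kraus_scalar[OF \<rho> _ s]) (auto simp: RK s_def)
  qed
  then show ?thesis unfolding reversible_operation_def using V RQ by blast
qed

text \<open>Kraus operators belonging to a message value other than the actual one produce zero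
  vectors; this removes them, so that a single message index is kept throughout the
  protocol.\<close>

lemma ensemble_reindex:
  assumes "finite I'" "inj_on g I" "g ` I \<subseteq> I'"
    and "\<And>i x. i \<in> I \<Longrightarrow> x < D \<Longrightarrow> V' (g i) x = V i x"
    and "\<And>i x. i \<in> I' \<Longrightarrow> i \<notin> g ` I \<Longrightarrow> x < D \<Longrightarrow> V' i x = 0"
  shows "ensemble D I' V' = ensemble D I V"
proof -
  have "(\<Sum>i\<in>I'. V' i x * cnj (V' i y)) = (\<Sum>i\<in>I. V i x * cnj (V i y))" if "x < D" "y < D" for x y
  proof -
    have "(\<Sum>i\<in>I'. V' i x * cnj (V' i y)) = (\<Sum>i\<in>g ` I. V' i x * cnj (V' i y))"
      using assms that by (intro sum.mono_neutral_right) auto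
    also have "\<dots> = (\<Sum>i\<in>I. V i x * cnj (V i y))"
      using assms that by (subst sum.reindex) auto
    finally show ?thesis .
  qed
  then show ?thesis by (auto simp: ensemble_def intro!: eq_matI)
qed

section \<open>Communication acting on ensembles\<close>

text \<open>Each vector is supported on the one register value \<open>msg i\<close>, so it has no
  blocks off the diagonal in the register that the broadcast could delete, and its image is again
  given by a single vector.\<close>

lemma broadcast_A_ensemble:
  assumes V: "\<And>i z. i \<in> I \<Longrightarrow> z < c * a * b * e \<Longrightarrow> pos1 b e z div a \<noteq> msg i \<Longrightarrow> V i z = 0"
  shows "broadcast_A c (a, b, e) (ensemble (c * a * b * e) I V) = ensemble (a * (c * b) * (c * e)) I
    (\<lambda>i x. if pos2 (c * b) (c * e) x div b = msg i \<and> pos3 (c * e) x div e = msg i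
       then V i (ix3 b e (msg i * a + pos1 (c * b) (c * e) x) (pos2 (c * b) (c * e) x mod b) (pos3 (c * e) x mod e)) else 0)"
    (is "?L = ensemble ?D I ?V")
proof (rule eq_matI)
  fix x y assume "x < dim_row (ensemble ?D I ?V)" "y < dim_col (ensemble ?D I ?V)"
  then have x: "x < ?D" and y: "y < ?D" by (auto simp: ensemble_def)
  note px = pos_less[OF x] and py = pos_less[OF y]
  define m where "m = pos2 (c * b) (c * e) x div b"
  have m: "m < c" using px by (simp add: m_def less_mult_imp_div_less)
  have be: "0 < b" "0 < e" using px by (auto intro: Nat.gr0I)
  define ox where "ox = ix3 b e (m * a + pos1 (c * b) (c * e) x) (pos2 (c * b) (c * e) x mod b) (pos3 (c * e) x mod e)"
  define oy where "oy = ix3 b e (m * a + pos1 (c * b) (c * e) y) (pos2 (c * b) (c * e) y mod b) (pos3 (c * e) y mod e)"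
  have ox: "ox < c * a * b * e" "pos1 b e ox div a = m" and oy: "oy < c * a * b * e"
    using m be px(1) py(1) by (auto simp: ox_def oy_def intro!: ix3_less mult_add_less)
  define P where "P \<longleftrightarrow> pos3 (c * e) x div e = m \<and> pos2 (c * b) (c * e) y div b = m \<and> pos3 (c * e) y div e = m"
  have "?L $$ (x, y) = (if P then ensemble (c * a * b * e) I V $$ (ox, oy) else 0)"
    using x y by (simp add: broadcast_A_def Let_def P_def m_def ox_def oy_def)
  also have "\<dots> = (\<Sum>i\<in>I. if P then V i ox * cnj (V i oy) else 0)"
    using ox oy by (simp add: ensemble_def)
  also have "\<dots> = (\<Sum>i\<in>I. ?V i x * cnj (?V i y))"
  proof (rule sum.cong[OF refl])
    fix i assume i: "i \<in> I"
    show "(if P then V i ox * cnj (V i oy) else 0) = ?V i x * cnj (?V i y)"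
    proof (cases "msg i = m")
      case True then show ?thesis by (auto simp: P_def ox_def oy_def m_def)
    next
      case False then show ?thesis using V[OF i ox(1)] ox(2) by (auto simp: m_def)
    qed
  qed
  also have "\<dots> = ensemble ?D I ?V $$ (x, y)" using x y by (simp add: ensemble_def)
  finally show "?L $$ (x, y) = ensemble ?D I ?V $$ (x, y)" .
qed (auto simp: broadcast_A_def ensemble_def)

lemma send_AE_ensemble:
  "send_AE q (a, b, e) (ensemble (q * a * b * e) I V) = ensemble (a * b * (q * e)) I
    (\<lambda>i z. V i (ix3 b e (pos3 (q * e) z div e * a + pos1 b (q * e) z) (pos2 b (q * e) z) (pos3 (q * e) z mod e)))"
proof -
  have "ix3 b e (pos3 (q * e) z div e * a + pos1 b (q * e) z) (pos2 b (q * e) z) (pos3 (q * e) z mod e) < q * a * b * e"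
    if "z < a * b * (q * e)" for z
    using pos_less[OF that] that
    by (intro ix3_less mult_add_less) (auto simp: less_mult_imp_div_less intro!: mod_less_divisor Nat.gr0I)
  then show ?thesis by (auto simp: send_AE_def ensemble_def Let_def intro!: eq_matI)
qed

lemma send_BE_ensemble:
  "send_BE q (a, b, e) (ensemble (a * (q * b) * e) I V) = ensemble (a * b * (q * e)) I
    (\<lambda>i z. V i (ix3 (q * b) e (pos1 b (q * e) z) (pos3 (q * e) z div e * b + pos2 b (q * e) z) (pos3 (q * e) z mod e)))"
proof -
  have "ix3 (q * b) e (pos1 b (q * e) z) (pos3 (q * e) z div e * b + pos2 b (q * e) z) (pos3 (q * e) z mod e) < a * (q * b) * e"
    if "z < a * b * (q * e)" for z
    using pos_less[OF that] that
    by (intro ix3_less mult_add_less) (auto simp: less_mult_imp_div_less intro!: mod_less_divisor Nat.gr0I)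
  then show ?thesis by (auto simp: send_BE_def ensemble_def Let_def intro!: eq_matI)
qed

section \<open>The dilution protocol\<close>

text \<open>An ensemble with one member, so that the ensemble calculus applies to it directly. For
  \<open>d = 2 ^ n\<close> it is the \<open>n\<close>-fold unit state.\<close>

definition max_entangled :: "nat \<Rightarrow> complex mat" where
  "max_entangled d = ensemble (d * d * 1) {()}
     (\<lambda>_ x. if pos1 d 1 x = pos2 d 1 x then 1 / complex_of_real (sqrt d) else 0)"

lemma cyclic_shift: "bij_betw (\<lambda>j. (p + j) mod d) {..<d} {..<d}" for p d :: nat
proof -
  have le: "i = j" if "i \<le> j" "j < d" "(p + j) mod d = (p + i) mod d" for i j
  proof -
    have "d dvd (p + j) - (p + i)" using that by (subst mod_eq_dvd_iff_nat[symmetric]) auto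
    then show ?thesis using that by (cases "i < j") (auto dest!: dvd_imp_le)
  qed
  have "inj_on (\<lambda>j. (p + j) mod d) {..<d}"
    using le by (intro inj_onI) (metis lessThan_iff nat_le_linear)
  moreover have "(\<lambda>j. (p + j) mod d) ` {..<d} = {..<d}"
    by (intro endo_inj_surj calculation) auto
  ultimately show ?thesis by (simp add: bij_betw_def)
qed

lemma sum_cyclic_shift:
  fixes p d :: nat
  shows "(\<Sum>j<d. f ((p + j) mod d)) = (\<Sum>c<d. f c)" "(\<Sum>j<d. f ((j + p) mod d)) = (\<Sum>c<d. f c)"
  using sum.reindex_bij_betw[OF cyclic_shift, of f p d] by (simp_all add: add.commute)

text \<open>
  Alice measures with Kraus operators \<open>|p> \<mapsto> |U\<^bsub>p+j\<^esub>>\<close> and announces \<open>j\<close>; Bob then applies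
  \<open>|p> \<mapsto> |V\<^bsub>p+j\<^esub>>\<close>, both with indices modulo \<open>d\<close>. For every \<open>j\<close> this yields the same state
  \<open>\<Sum>\<^sub>c U\<^sub>c \<otimes> V\<^sub>c\<close>, so that Eve's copy of \<open>j\<close> is uniformly distributed and independent of it.
\<close>

lemma dilution_protocol:
  assumes d: "0 < d"
    and U: "orthogonal_family d (ea * a) U \<mu>" and \<mu>: "(\<Sum>c<d. \<mu> c) = 1"
    and V: "orthogonal_family d (eb * b) V (\<lambda>_. 1)"
  obtains F where "Omega (d, d, 1) (a, b, eb * ea * d) F"
    "F (max_entangled d) = ensemble (a * b * (eb * ea * d)) {..<d} (\<lambda>j z.
      if pos3 (eb * ea * d) z mod d = j then (\<Sum>c<d.
        U c (pos3 (eb * ea * d) z div d mod ea * a + pos1 b (eb * ea * d) z) *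
        V c (pos3 (eb * ea * d) z div d div ea * b + pos2 b (eb * ea * d) z)) / complex_of_real (sqrt d) else 0)"
proof -
  let ?sd = "complex_of_real (sqrt d)"
  \<comment> \<open>\<open>E_A\<close> and \<open>E_B\<close> are the leading factors here, because
    \<open>send_AE\<close> and \<open>send_BE\<close> detach the leading subsystem.\<close>
  define \<alpha> \<beta> where "\<alpha> = ea * a" and "\<beta> = eb * b"
  have inj_shift: "x = y" if "(j + x) mod d = (j + y) mod d" "x < d" "y < d" for j x y
    using that inj_onD[OF bij_betw_imp_inj_on[OF cyclic_shift[of j d]], of x y] by simp
  \<comment> \<open>The leading digit \<open>x div \<alpha>\<close> is the register to be broadcast.
    Completeness holds since summing over \<open>j\<close> runs through every \<open>U c\<close>
    once: different \<open>p\<close>, \<open>q\<close> give orthogonal vectors, and equal ones give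
    the sum of all \<open>\<mu> c\<close>.\<close>
  define KA where "KA j x p = (if x div \<alpha> = j then U ((p + j) mod d) (x mod \<alpha>) else 0)" for j x p
  have KA: "kraus_complete d (d * \<alpha>) {..<d} KA"
    unfolding kraus_complete_def
  proof (intro conjI allI impI)
    fix p q assume pq: "p < d" "q < d"
    have "(\<Sum>j<d. \<Sum>x<d * \<alpha>. cnj (KA j x p) * KA j x q) =
      (\<Sum>j<d. \<Sum>m<d. \<Sum>y<\<alpha>. if m = j then cnj (U ((p + j) mod d) y) * U ((q + j) mod d) y else 0)"
      unfolding sum_lessThan_mult by (intro sum.cong refl) (auto simp: KA_def)
    also have "\<dots> = (\<Sum>j<d. \<Sum>m<d. if m = j then \<Sum>y<\<alpha>. cnj (U ((p + j) mod d) y) * U ((q + j) mod d) y else 0)"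
      by (intro sum.cong refl) auto
    also have "\<dots> = (\<Sum>j<d. \<Sum>y<\<alpha>. U ((q + j) mod d) y * cnj (U ((p + j) mod d) y))"
      by (simp add: mult.commute)
    also have "\<dots> = (\<Sum>j<d. if p = q then complex_of_real (\<mu> ((p + j) mod d)) else 0)"
    proof (intro sum.cong refl)
      fix j assume "j \<in> {..<d}"
      then have "(q + j) mod d = (p + j) mod d \<longleftrightarrow> p = q"
        using inj_shift[of j q p] pq by (auto simp: add.commute)
      then show "(\<Sum>y<\<alpha>. U ((q + j) mod d) y * cnj (U ((p + j) mod d) y)) =
          (if p = q then complex_of_real (\<mu> ((p + j) mod d)) else 0)"
        using orthogonal_familyD[OF U, of "(q + j) mod d" "(p + j) mod d"] d by (simp add: \<alpha>_def)
    qed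
    also have "\<dots> = (if p = q then complex_of_real (\<Sum>j<d. \<mu> ((p + j) mod d)) else 0)" by simp
    also have "\<dots> = (if p = q then 1 else 0)" using pq by (simp add: sum_cyclic_shift \<mu>)
    finally show "(\<Sum>j<d. \<Sum>x<d * \<alpha>. cnj (KA j x p) * KA j x q) = (if p = q then 1 else 0)" .
  qed simp
  \<comment> \<open>Bob's input is the register followed by his half of the entangled state. The
    Kraus operator \<open>j\<close> accepts only the register value \<open>j\<close>, so the
    register is consumed and no branches beyond those of Alice's outcome survive.\<close>
  define KB where "KB j y p = (if p div d = j then V ((p mod d + j) mod d) y else 0)" for j y p
  have KB: "kraus_complete (d * d) \<beta> {..<d} KB"
    unfolding kraus_complete_def
  proof (intro conjI allI impI)
    fix p q assume pq: "p < d * d" "q < d * d"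
    have dm: "p div d < d" "p mod d < d" "q mod d < d" using pq d by (auto intro: less_mult_imp_div_less)
    have "(\<Sum>j<d. \<Sum>x<\<beta>. cnj (KB j x p) * KB j x q) = (\<Sum>j<d. if j = p div d then if q div d = p div d
        then \<Sum>x<\<beta>. V ((q mod d + j) mod d) x * cnj (V ((p mod d + j) mod d) x) else 0 else 0)"
      by (intro sum.cong refl) (auto simp: KB_def mult.commute)
    also have "\<dots> = (if q div d = p div d \<and> (q mod d + p div d) mod d = (p mod d + p div d) mod d then 1 else 0)"
      using dm(1) d by (auto simp: \<beta>_def orthogonal_familyD[OF V])
    also have "(q mod d + p div d) mod d = (p mod d + p div d) mod d \<longleftrightarrow> q mod d = p mod d"
      using inj_shift[of "p div d" "q mod d" "p mod d"] dm by (auto simp: add.commute)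
    also have "q div d = p div d \<and> q mod d = p mod d \<longleftrightarrow> p = q" by (metis div_mult_mod_eq)
    finally show "(\<Sum>j<d. \<Sum>x<\<beta>. cnj (KB j x p) * KB j x q) = (if p = q then 1 else 0)" .
  qed simp
  define F1 where "F1 = lift 1 (d * 1) d (d * \<alpha>) (kraus d (d * \<alpha>) {..<d} KA)"
  define F2 where "F2 = broadcast_A d (\<alpha>, d, 1)"
  define F3 where "F3 = lift \<alpha> d (d * d) \<beta> (kraus (d * d) \<beta> {..<d} KB)"
  define F4 where "F4 = send_AE ea (a, \<beta>, d)"
  define F5 where "F5 = send_BE eb (a, b, ea * d)"
  have "Omega (d, d, 1) (d * \<alpha>, d, 1) F1"
    unfolding F1_def by (intro Omega.local_A kraus_quantum_operation KA)
  moreover have "Omega (d * \<alpha>, d, 1) (\<alpha>, d * d, d) F2"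
    using Omega.public_A[of d \<alpha> d 1] by (simp add: F2_def)
  moreover have "Omega (\<alpha>, d * d, d) (\<alpha>, \<beta>, d) F3"
    unfolding F3_def by (intro Omega.local_B kraus_quantum_operation KB)
  moreover have "Omega (\<alpha>, \<beta>, d) (a, \<beta>, ea * d) F4"
    unfolding F4_def \<alpha>_def by (rule Omega.quantum_AE)
  moreover have "Omega (a, \<beta>, ea * d) (a, b, eb * (ea * d)) F5"
    unfolding F5_def \<beta>_def by (rule Omega.quantum_BE)
  ultimately have Om: "Omega (d, d, 1) (a, b, eb * ea * d) (F5 \<circ> (F4 \<circ> (F3 \<circ> (F2 \<circ> F1))))"
    by (simp add: mult.assoc) (blast intro: Omega.compose)
  define V1 where "V1 j x = (if pos1 d 1 x div \<alpha> = j then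
     U ((pos2 d 1 x + j) mod d) (pos1 d 1 x mod \<alpha>) / ?sd else 0)" for j x
  have 1: "F1 (max_entangled d) = ensemble (d * \<alpha> * d * 1) {..<d} V1"
    unfolding F1_def max_entangled_def lift_A_kraus_ensemble[OF finite.insertI[OF finite.emptyI] finite_lessThan]
  proof (rule ensemble_reindex[where g = "\<lambda>j. ((), j)"])
    fix j x assume "x < d * \<alpha> * d * 1"
    note x = pos_less[OF this]
    have "(\<Sum>p<d. KA j (pos1 d 1 x) p * (if pos1 d 1 (ix3 d 1 p (pos2 d 1 x) (pos3 1 x)) =
            pos2 d 1 (ix3 d 1 p (pos2 d 1 x) (pos3 1 x)) then 1 / ?sd else 0)) =
       (\<Sum>p<d. if p = pos2 d 1 x then KA j (pos1 d 1 x) p / ?sd else 0)"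
      using x by (intro sum.cong refl) auto
    then show "(case ((), j) of (i, \<kappa>) \<Rightarrow> \<lambda>x. \<Sum>p<d. KA \<kappa> (pos1 d 1 x) p * (if pos1 d 1 (ix3 d 1 p (pos2 d 1 x) (pos3 1 x)) =
            pos2 d 1 (ix3 d 1 p (pos2 d 1 x) (pos3 1 x)) then 1 / ?sd else 0)) x = V1 j x"
      using x by (auto simp: V1_def KA_def)
  qed (auto simp: inj_on_def)
  define V2 where "V2 j x = (if pos2 (d * d) d x div d = j \<and> pos3 d x = j
     then U ((pos2 (d * d) d x mod d + j) mod d) (pos1 (d * d) d x) / ?sd else 0)" for j x
  have 2: "F2 (ensemble (d * \<alpha> * d * 1) {..<d} V1) = ensemble (\<alpha> * (d * d) * d) {..<d} V2"
    unfolding F2_def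
  proof (subst broadcast_A_ensemble[where msg = "\<lambda>j. j"])
    show "V1 i z = 0" if "pos1 d 1 z div \<alpha> \<noteq> i" for i z using that by (simp add: V1_def)
    show "ensemble (\<alpha> * (d * d) * (d * 1)) {..<d} (\<lambda>i x.
        if pos2 (d * d) (d * 1) x div d = i \<and> pos3 (d * 1) x div 1 = i
        then V1 i (ix3 d 1 (i * \<alpha> + pos1 (d * d) (d * 1) x) (pos2 (d * d) (d * 1) x mod d)
                (pos3 (d * 1) x mod 1)) else 0) = ensemble (\<alpha> * (d * d) * d) {..<d} V2"
      unfolding mult_1_right
    proof (rule ensemble_cong)
      fix i x assume "x < \<alpha> * (d * d) * d"
      note x = pos_less[OF this]
      show "(if pos2 (d * d) d x div d = i \<and> pos3 d x div 1 = i
        then V1 i (ix3 d 1 (i * \<alpha> + pos1 (d * d) d x) (pos2 (d * d) d x mod d)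
                (pos3 d x mod 1)) else 0) = V2 i x"
        using x d by (simp add: V1_def V2_def)
    qed
  qed
  \<comment> \<open>Both parties have shifted by the same \<open>j\<close>, and a sum over all
    residues does not notice the shift. From here on \<open>j\<close> occurs only in Eve's
    register.\<close>
  define V3 where "V3 j x = (if pos3 d x = j then (\<Sum>c<d. U c (pos1 \<beta> d x) * V c (pos2 \<beta> d x)) / ?sd else 0)" for j x
  have 3: "F3 (ensemble (\<alpha> * (d * d) * d) {..<d} V2) = ensemble (\<alpha> * \<beta> * d) {..<d} V3"
    unfolding F3_def lift_B_kraus_ensemble[OF finite_lessThan finite_lessThan]
  proof (rule ensemble_reindex[where g = "\<lambda>j. (j, j)"])
    have eq: "(\<Sum>p<d * d. KB \<kappa> (pos2 \<beta> d x) p * V2 j (ix3 (d * d) d (pos1 \<beta> d x) p (pos3 d x))) =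
        (if \<kappa> = j then V3 j x else 0)" if x: "x < \<alpha> * \<beta> * d" and j: "j < d" for j \<kappa> x
    proof -
      note px = pos_less[OF x]
      have "(\<Sum>p<d * d. KB \<kappa> (pos2 \<beta> d x) p * V2 j (ix3 (d * d) d (pos1 \<beta> d x) p (pos3 d x))) =
        (\<Sum>m<d. \<Sum>t<d. if m = j then if \<kappa> = j \<and> pos3 d x = j then
           V ((t + j) mod d) (pos2 \<beta> d x) * U ((t + j) mod d) (pos1 \<beta> d x) / ?sd else 0 else 0)"
        unfolding sum_lessThan_mult using px
        by (intro sum.cong refl) (auto simp: KB_def V2_def mult_add_less)
      also have "\<dots> = (\<Sum>m<d. if m = j then if \<kappa> = j \<and> pos3 d x = j then
           \<Sum>t<d. V ((t + j) mod d) (pos2 \<beta> d x) * U ((t + j) mod d) (pos1 \<beta> d x) / ?sd else 0 else 0)"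
        by (intro sum.cong refl) auto
      also have "\<dots> = (if \<kappa> = j then V3 j x else 0)"
        using j sum_cyclic_shift(2)[where p = j and d = d and f = "\<lambda>c. V c (pos2 \<beta> d x) * U c (pos1 \<beta> d x) / ?sd"]
        by (simp add: V3_def sum_divide_distrib mult.commute)
      finally show ?thesis .
    qed
    show "(case (j, j) of (i, \<kappa>) \<Rightarrow> \<lambda>x. \<Sum>p<d * d. KB \<kappa> (pos2 \<beta> d x) p * V2 i (ix3 (d * d) d (pos1 \<beta> d x) p (pos3 d x))) x = V3 j x"
      if "j \<in> {..<d}" "x < \<alpha> * \<beta> * d" for j x using that eq by simp
    show "(case i of (i, \<kappa>) \<Rightarrow> \<lambda>x. \<Sum>p<d * d. KB \<kappa> (pos2 \<beta> d x) p * V2 i (ix3 (d * d) d (pos1 \<beta> d x) p (pos3 d x))) x = 0"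
      if "i \<in> {..<d} \<times> {..<d}" "i \<notin> (\<lambda>j. (j, j)) ` {..<d}" "x < \<alpha> * \<beta> * d" for i x using that eq by (cases i) auto
  qed (auto simp: inj_on_def)
  define V4 where "V4 j z = V3 j (ix3 \<beta> d (pos3 (ea * d) z div d * a + pos1 \<beta> (ea * d) z) (pos2 \<beta> (ea * d) z)
      (pos3 (ea * d) z mod d))" for j z
  have 4: "F4 (ensemble (\<alpha> * \<beta> * d) {..<d} V3) = ensemble (a * \<beta> * (ea * d)) {..<d} V4"
    unfolding F4_def \<alpha>_def send_AE_ensemble V4_def ..
  have 5: "F5 (ensemble (a * \<beta> * (ea * d)) {..<d} V4) = ensemble (a * b * (eb * ea * d)) {..<d} (\<lambda>j z.
      if pos3 (eb * ea * d) z mod d = j then (\<Sum>c<d.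
        U c (pos3 (eb * ea * d) z div d mod ea * a + pos1 b (eb * ea * d) z) *
        V c (pos3 (eb * ea * d) z div d div ea * b + pos2 b (eb * ea * d) z)) / ?sd else 0)"
    unfolding F5_def \<beta>_def send_BE_ensemble mult.assoc[of eb ea d]
  proof (rule ensemble_cong)
    fix j z assume "z < a * b * (eb * (ea * d))"
    note z = pos_less[OF this]
    define k where "k = pos3 (eb * (ea * d)) z"
    have ed: "0 < ea * d" using z(3) by (auto intro: Nat.gr0I)
    then have k: "k div (ea * d) < eb" "k mod (ea * d) < ea * d"
      using z(3) by (auto simp: k_def less_mult_imp_div_less)
    have lt: "k div (ea * d) * b + pos2 b (eb * (ea * d)) z < eb * b" using k z by (intro mult_add_less)
    have "k mod (ea * d) div d = k div d mod ea" "k mod (ea * d) mod d = k mod d" "k div (ea * d) = k div d div ea"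
      using d by (simp_all add: mult.commute[of ea] mod_mult2_eq div_mult2_eq)
    then show "V4 j (ix3 (eb * b) (ea * d) (pos1 b (eb * (ea * d)) z)
            (pos3 (eb * (ea * d)) z div (ea * d) * b + pos2 b (eb * (ea * d)) z)
            (pos3 (eb * (ea * d)) z mod (ea * d))) = (if pos3 (eb * (ea * d)) z mod d = j then (\<Sum>c<d.
        U c (pos3 (eb * (ea * d)) z div d mod ea * a + pos1 b (eb * (ea * d)) z) *
        V c (pos3 (eb * (ea * d)) z div d div ea * b + pos2 b (eb * (ea * d)) z)) / ?sd else 0)"
      using d lt k(2) by (auto simp: V4_def V3_def k_def[symmetric] \<beta>_def)
  qed
  show ?thesis by (rule that[OF Om]) (simp only: comp_apply 1 2 3 4 5)
qed

section \<open>Error estimate for the protocol\<close>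

text \<open>Each of the \<open>d\<close> branches has weight \<open>1 / d\<close>. A sum over the
  branches of a product of two such norms therefore gives back the product of the norms of the
  states without a message.\<close>

lemma L2_set_uniform_message:
  assumes "j < d"
  shows "L2_set (\<lambda>z. cmod (if pos3 (f * d) z mod d = j
      then G (pos1 b (f * d) z) (pos2 b (f * d) z) (pos3 (f * d) z div d) / complex_of_real (sqrt d) else 0))
      {..<a * b * (f * d)} = sqrt (\<Sum>i<a. \<Sum>i'<b. \<Sum>u<f. (cmod (G i i' u))\<^sup>2) / sqrt d"
proof -
  have "(\<Sum>z<a * b * (f * d). (cmod (if pos3 (f * d) z mod d = j
      then G (pos1 b (f * d) z) (pos2 b (f * d) z) (pos3 (f * d) z div d) / complex_of_real (sqrt d) else 0))\<^sup>2) =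
    (\<Sum>i<a. \<Sum>i'<b. \<Sum>u<f. \<Sum>m<d. if m = j then (cmod (G i i' u))\<^sup>2 / d else 0)"
    unfolding sum_lessThan_mult3 sum_lessThan_mult[where a = f and b = d]
    by (intro sum.cong refl) (auto simp: mult_add_less norm_divide power_divide)
  also have "\<dots> = (\<Sum>i<a. \<Sum>i'<b. \<Sum>u<f. (cmod (G i i' u))\<^sup>2) / d"
    using assms by (simp add: sum_divide_distrib)
  finally show ?thesis by (simp add: L2_set_def real_sqrt_divide)
qed

text \<open>\<open>\<Theta>\<close> is what the protocol prepares and \<open>\<Psi>\<close> the
  target after the isometry \<open>W\<close>, both as coefficients with \<open>f\<close> running
  over \<open>E_B\<close> and \<open>E_A\<close> together. As both sides carry the same uniform
  message, they can be compared branch by branch, and the message drops out of the bound.\<close>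

lemma convertible_of_isometry:
  fixes W :: "nat \<Rightarrow> nat \<Rightarrow> complex"
  assumes \<psi>: "\<psi> \<in> carrier_vec (a * b * e)" and "0 < d" "0 < e"
    and U: "orthogonal_family d (ea * a) U \<mu>" and \<mu>: "(\<Sum>c<d. \<mu> c) = 1"
    and V: "orthogonal_family d (eb * b) V (\<lambda>_. 1)"
    and W: "\<And>p q. p < e \<Longrightarrow> q < e \<Longrightarrow> (\<Sum>z<eb * ea. cnj (W z p) * W z q) = (if p = q then 1 else 0)"
  defines "\<Theta> \<equiv> \<lambda>i j f. \<Sum>c<d. U c (f mod ea * a + i) * V c (f div ea * b + j)"
    and "\<Psi> \<equiv> \<lambda>i j f. \<Sum>p<e. W f p * \<psi> $ ix3 b e i j p"
    and "N \<equiv> \<lambda>G :: nat \<Rightarrow> nat \<Rightarrow> nat \<Rightarrow> complex. sqrt (\<Sum>i<a. \<Sum>j<b. \<Sum>f<eb * ea. (cmod (G i j f))\<^sup>2)"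
  shows "convertible (N (\<lambda>i j f. \<Theta> i j f - \<Psi> i j f) * (N \<Theta> + N \<Psi>)) (d, d, 1) (max_entangled d) (a, b, e) (proj \<psi>)"
proof -
  define e' where "e' = eb * ea * d"
  let ?sd = "complex_of_real (sqrt d)"
  let ?msg = "\<lambda>G j z. if pos3 e' z mod d = j then G (pos1 b e' z) (pos2 b e' z) (pos3 e' z div d) / ?sd else (0 :: complex)"
  obtain F where F: "Omega (d, d, 1) (a, b, e') F"
    "F (max_entangled d) = ensemble (a * b * e') {..<d} (?msg \<Theta>)"
    using dilution_protocol[OF \<open>0 < d\<close> U \<mu> V] unfolding e'_def \<Theta>_def by blast
  let ?K = "\<lambda>j z p. if z mod d = j then W (z div d) p / ?sd else 0"
  have rev: "reversible_operation e e' (kraus e e' {..<d} ?K)"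
    unfolding e'_def by (rule reversible_isometry_message[OF W \<open>0 < d\<close> \<open>0 < e\<close>])
  have proj: "proj \<psi> = ensemble (a * b * e) {()} (\<lambda>_ x. \<psi> $ x)"
    using \<psi> by (simp add: proj_def ensemble_def)
  have lift: "lift (a * b) 1 e e' (kraus e e' {..<d} ?K) (proj \<psi>) = ensemble (a * b * e') {..<d} (?msg \<Psi>)"
    unfolding proj lift_E_kraus_ensemble[OF finite.insertI[OF finite.emptyI] finite_lessThan]
    by (rule ensemble_reindex[where g = "\<lambda>j. ((), j)"]) (auto simp: \<Psi>_def inj_on_def sum_divide_distrib)
  have "F (max_entangled d) - lift (a * b) 1 e e' (kraus e e' {..<d} ?K) (proj \<psi>) =
     mat (a * b * e') (a * b * e') (\<lambda>(x, y). \<Sum>j\<in>{..<d}. ?msg \<Theta> j x * cnj (?msg \<Theta> j y) - ?msg \<Psi> j x * cnj (?msg \<Psi> j y))"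
    unfolding F(2) lift by (intro eq_matI) (simp_all add: ensemble_def sum_subtractf)
  then have "trace_norm (F (max_entangled d) - lift (a * b) 1 e e' (kraus e e' {..<d} ?K) (proj \<psi>)) \<le>
     (\<Sum>j<d. L2_set (\<lambda>x. cmod (?msg \<Theta> j x - ?msg \<Psi> j x)) {..<a * b * e'} *
       (L2_set (\<lambda>x. cmod (?msg \<Theta> j x)) {..<a * b * e'} + L2_set (\<lambda>x. cmod (?msg \<Psi> j x)) {..<a * b * e'}))"
    using trace_norm_diff_le[OF finite_lessThan[of d], of "a * b * e'" "?msg \<Theta>" "?msg \<Psi>"] by simp
  also have "\<dots> = (\<Sum>j<d. N (\<lambda>i j f. \<Theta> i j f - \<Psi> i j f) / sqrt d * (N \<Theta> / sqrt d + N \<Psi> / sqrt d))"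
  proof (intro sum.cong refl)
    fix j assume "j \<in> {..<d}"
    then have j: "j < d" by simp
    have L: "L2_set (\<lambda>z. cmod (?msg G j z)) {..<a * b * e'} = N G / sqrt d" for G
      unfolding e'_def N_def by (rule L2_set_uniform_message[OF j])
    have "?msg \<Theta> j z - ?msg \<Psi> j z = ?msg (\<lambda>i j f. \<Theta> i j f - \<Psi> i j f) j z" for z
      by (simp add: diff_divide_distrib)
    then show "L2_set (\<lambda>x. cmod (?msg \<Theta> j x - ?msg \<Psi> j x)) {..<a * b * e'} *
       (L2_set (\<lambda>x. cmod (?msg \<Theta> j x)) {..<a * b * e'} + L2_set (\<lambda>x. cmod (?msg \<Psi> j x)) {..<a * b * e'}) =
       N (\<lambda>i j f. \<Theta> i j f - \<Psi> i j f) / sqrt d * (N \<Theta> / sqrt d + N \<Psi> / sqrt d)"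
      by (simp only: L[of \<Theta>] L[of \<Psi>] L[of "\<lambda>i j f. \<Theta> i j f - \<Psi> i j f"])
  qed
  also have "\<dots> = N (\<lambda>i j f. \<Theta> i j f - \<Psi> i j f) * (N \<Theta> + N \<Psi>)"
    using \<open>0 < d\<close> by (simp add: add_divide_distrib[symmetric])
  finally show ?thesis unfolding convertible_def using F(1) rev by auto
qed

text \<open>Pythagoras: the products of \<open>u c\<close> and \<open>w c\<close> are orthogonal,
  with squared norms \<open>l c\<close>.\<close>

lemma orthogonal_product_norm:
  assumes u: "orthogonal_family D X u (\<lambda>_. 1)" and w: "orthogonal_family D Y w l"
  shows "(\<Sum>x<X. \<Sum>y<Y. (cmod (\<Sum>c<D. complex_of_real (\<beta> c) * (u c x * w c y)))\<^sup>2) = (\<Sum>c<D. (\<beta> c)\<^sup>2 * l c)"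
proof -
  have "complex_of_real (\<Sum>x<X. \<Sum>y<Y. (cmod (\<Sum>c<D. complex_of_real (\<beta> c) * (u c x * w c y)))\<^sup>2) =
    (\<Sum>x<X. \<Sum>y<Y. \<Sum>c<D. \<Sum>c'<D. complex_of_real (\<beta> c * \<beta> c') * (u c x * cnj (u c' x)) * (w c y * cnj (w c' y)))"
    unfolding of_real_sum complex_norm_square cnj_sum sum_product by (simp add: mult_ac)
  also have "\<dots> = (\<Sum>c<D. \<Sum>c'<D. \<Sum>y<Y. \<Sum>x<X. complex_of_real (\<beta> c * \<beta> c') * (u c x * cnj (u c' x)) * (w c y * cnj (w c' y)))"
    unfolding sum.cartesian_product
    by (rule sum.reindex_bij_witness[of _ "\<lambda>(c, c', y, x). (x, y, c, c')" "\<lambda>(x, y, c, c'). (c, c', y, x)"]) auto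
  also have "\<dots> = (\<Sum>c<D. \<Sum>c'<D. complex_of_real (\<beta> c * \<beta> c') * (\<Sum>x<X. u c x * cnj (u c' x)) * (\<Sum>y<Y. w c y * cnj (w c' y)))"
    by (simp add: sum_distrib_left sum_distrib_right)
  also have "\<dots> = (\<Sum>c<D. \<Sum>c'<D. if c' = c then complex_of_real ((\<beta> c)\<^sup>2 * l c) else 0)"
    by (intro sum.cong refl) (auto simp: orthogonal_familyD[OF u] orthogonal_familyD[OF w] power2_eq_square)
  also have "\<dots> = complex_of_real (\<Sum>c<D. (\<beta> c)\<^sup>2 * l c)" by simp
  finally show ?thesis by (simp only: of_real_eq_iff)
qed

lemma sum_lessThan_add: "(\<Sum>t<m + n. g t) = (\<Sum>t<m. g t) + (\<Sum>t<n. g (m + t))" for m n :: nat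
  by (induction n) (simp_all add: add.assoc)

text \<open>
  The purification \<open>\<Sum>\<^sub>c u\<^sub>c \<otimes> w\<^sub>c\<close> is truncated to the indices in \<open>S\<close>. An ancilla of dimension
  \<open>q = 1 + d + e\<close> is appended to \<open>E\<^sub>B\<close>: the purification sits at its basis vector 0, the next \<open>d\<close>
  extend the vectors \<open>w\<^sub>c\<close> to an orthonormal family of size \<open>d\<close>, and the last \<open>e\<close> give room to extend
  the partial isometry from Eve's system to \<open>E\<^sub>AE\<^sub>B\<close> to an isometry.
\<close>

lemma convertible_of_purification:
  assumes \<psi>: "\<psi> \<in> carrier_vec (a * b * e)" and "0 < e" "0 < d"
    and u: "orthogonal_family D (ea * a) u (\<lambda>_. 1)" and w: "orthogonal_family D (eb * b) w l"
    and l: "(\<Sum>c<D. l c) = 1"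
    and pur: "\<And>i j i' j'. i < a \<Longrightarrow> j < b \<Longrightarrow> i' < a \<Longrightarrow> j' < b \<Longrightarrow>
      (\<Sum>p<e. \<psi> $ ix3 b e i j p * cnj (\<psi> $ ix3 b e i' j' p)) =
      (\<Sum>m<eb. \<Sum>k<ea. (\<Sum>c<D. u c (k * a + i) * w c (m * b + j)) * cnj (\<Sum>c<D. u c (k * a + i') * w c (m * b + j')))"
    and S: "S \<subseteq> {..<D}" "card S \<le> d" "\<And>c. c \<in> S \<Longrightarrow> 0 < l c" and ws: "0 < (\<Sum>c\<in>S. l c)"
  shows "convertible (2 * sqrt (2 * (1 - (\<Sum>c\<in>S. l c)))) (d, d, 1) (max_entangled d) (a, b, e) (proj \<psi>)"
proof -
  define ws where "ws = (\<Sum>c\<in>S. l c)"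
  have ws0: "0 < ws" using ws by (simp add: ws_def)
  have l0: "0 \<le> l c" if "c < D" for c using orthogonal_family_norm[OF w that] by (simp add: sum_nonneg)
  have ws1: "ws \<le> 1" unfolding ws_def l[symmetric] using S l0 by (intro sum_mono2) auto
  have finS: "finite S" using S(1) finite_subset by blast
  \<comment> \<open>The retained Schmidt indices are renumbered from 0, as the protocol works with
    the residues below \<open>d\<close>.\<close>
  obtain h where h: "bij_betw h {..<card S} S" using ex_bij_betw_nat_finite[OF finS] by (auto simp: atLeast0LessThan)
  define r where "r = card S"
  have hS: "h c \<in> S" if "c < r" for c using bij_betwE[OF h] that by (auto simp: r_def)
  have hD: "h c < D" if "c < r" for c using hS[OF that] S(1) by auto
  have hinj: "h c = h c' \<longleftrightarrow> c = c'" if "c < r" "c' < r" for c c'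
    using bij_betw_imp_inj_on[OF h] that by (auto simp: r_def inj_on_def)
  have hsum: "(\<Sum>c<r. g (h c)) = (\<Sum>c\<in>S. g c)" for g :: "nat \<Rightarrow> complex"
    using sum.reindex_bij_betw[OF h] by (simp add: r_def)
  have hsumr: "(\<Sum>c<r. g (h c)) = (\<Sum>c\<in>S. g c)" for g :: "nat \<Rightarrow> real"
    using sum.reindex_bij_betw[OF h] by (simp add: r_def)
  have rd: "r \<le> d" using S(2) by (simp add: r_def)
  have "eb * b > 0"
  proof (rule ccontr)
    assume "\<not> 0 < eb * b"
    then have "eb * b = 0" by simp
    then have "l c = 0" if "c < D" for c
      using orthogonal_family_norm[OF w that] by (simp only: lessThan_0 sum.empty)
    then show False using l by simp
  qed
  then have b0: "0 < eb" "0 < b" by auto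
  have "ea * a > 0"
  proof (rule ccontr)
    assume "\<not> 0 < ea * a"
    then have "\<not> c < D" for c using orthogonal_family_norm[OF u, of c] by auto
    then have "D = 0" by blast
    then show False using l by simp
  qed
  then have a0: "0 < ea" "0 < a" by auto
  define q where "q = Suc d + e"
  have q: "0 < q" "c < d \<Longrightarrow> Suc c < q" for c by (simp_all add: q_def)
  define \<phi> where "\<phi> i k j m = (\<Sum>c<D. u c (k * a + i) * w c (m * b + j))" for i k j m
  obtain W0 R where W0: "\<And>x z. x < a * b \<Longrightarrow> z < eb * ea \<Longrightarrow>
      (\<Sum>p<e. W0 z p * \<psi> $ (x * e + p)) = \<phi> (x div b) (z mod ea) (x mod b) (z div ea)"
    and R: "\<And>x y. x < a * b \<Longrightarrow> y < e \<Longrightarrow> (\<Sum>p<e. R y p * \<psi> $ (x * e + p)) = 0"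
    and iso: "\<And>p p'. p < e \<Longrightarrow> p' < e \<Longrightarrow>
      (\<Sum>z<eb * ea. cnj (W0 z p) * W0 z p') + (\<Sum>z<e. cnj (R z p) * R z p') = (if p = p' then 1 else 0)"
  proof (rule equal_gram_isometry[where X = "a * b" and Y = e and Z = "eb * ea" and
        M = "\<lambda>x p. \<psi> $ (x * e + p)" and N = "\<lambda>x z. \<phi> (x div b) (z mod ea) (x mod b) (z div ea)"])
    fix x x' assume x: "x < a * b" "x' < a * b"
    then have "(\<Sum>p<e. \<psi> $ ix3 b e (x div b) (x mod b) p * cnj (\<psi> $ ix3 b e (x' div b) (x' mod b) p)) =
      (\<Sum>m<eb. \<Sum>k<ea. \<phi> (x div b) k (x mod b) m * cnj (\<phi> (x' div b) k (x' mod b) m))"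
      unfolding \<phi>_def using b0 by (intro pur) (auto simp: less_mult_imp_div_less)
    then show "(\<Sum>y<e. \<psi> $ (x * e + y) * cnj (\<psi> $ (x' * e + y))) =
      (\<Sum>z<eb * ea. \<phi> (x div b) (z mod ea) (x mod b) (z div ea) * cnj (\<phi> (x' div b) (z mod ea) (x' mod b) (z div ea)))"
      by (simp add: ix3_def sum_lessThan_mult)
  qed blast
  \<comment> \<open>The Schmidt weights, renormalized by \<open>ws\<close>, are put on Alice's side,
    where only their sum is constrained. Bob's vectors have to be orthonormal, so \<open>w\<close>
    is divided by its norm, and the indices from \<open>r\<close> on, at which \<open>U\<close>
    vanishes, receive unit vectors at ancilla values other than 0.\<close>
  define U where "U c x = (if c < r then complex_of_real (sqrt (l (h c) / ws)) * u (h c) x else 0)" for c x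
  define V where "V c y = (if c < r
      then if pos2 q b y = 0 then w (h c) (pos1 q b y * b + pos3 b y) / complex_of_real (sqrt (l (h c))) else 0
      else if pos1 q b y = 0 \<and> pos3 b y = 0 \<and> pos2 q b y = Suc c then 1 else 0)" for c y
  \<comment> \<open>\<open>R\<close> annihilates the vector \<psi>, so placing it at its own ancilla
    values makes \<open>W\<close> isometric without changing the image of the target.\<close>
  define W where "W f p = (if pos2 q ea f = 0 then W0 (pos1 q ea f * ea + pos3 ea f) p
      else if pos1 q ea f = 0 \<and> pos3 ea f = 0 \<and> Suc d \<le> pos2 q ea f then R (pos2 q ea f - Suc d) p else 0)" for f p
  define \<mu> where "\<mu> c = (if c < r then l (h c) / ws else 0)" for c
  have sq: "complex_of_real (sqrt x) * complex_of_real (sqrt x) = complex_of_real x" if "0 \<le> x" for x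
    using that by (simp flip: of_real_mult)
  have U: "orthogonal_family d (ea * a) U \<mu>"
    unfolding orthogonal_family_def
  proof (intro allI impI)
    fix c c' assume "c < d" "c' < d"
    show "(\<Sum>x<ea * a. U c x * cnj (U c' x)) = (if c = c' then complex_of_real (\<mu> c) else 0)"
    proof (cases "c < r \<and> c' < r")
      case True
      have "(\<Sum>x<ea * a. U c x * cnj (U c' x)) = complex_of_real (sqrt (l (h c) / ws)) * complex_of_real (sqrt (l (h c') / ws))
         * (\<Sum>x<ea * a. u (h c) x * cnj (u (h c') x))"
        using True by (simp add: U_def sum_distrib_left mult_ac del: of_real_mult of_real_divide)
      also have "\<dots> = (if c = c' then complex_of_real (\<mu> c) else 0)"
        using True l0[OF hD[of c]] ws0
        by (auto simp: orthogonal_familyD[OF u] hD hinj \<mu>_def sq simp del: of_real_divide)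
      finally show ?thesis .
    qed (auto simp: U_def \<mu>_def)
  qed
  have \<mu>: "(\<Sum>c<d. \<mu> c) = 1"
  proof -
    have "(\<Sum>c<d. \<mu> c) = (\<Sum>c<r. \<mu> c)" using rd by (intro sum.mono_neutral_right) (auto simp: \<mu>_def)
    also have "\<dots> = (\<Sum>c<r. l (h c)) / ws" by (simp add: \<mu>_def sum_divide_distrib)
    also have "\<dots> = 1" using ws0 by (simp add: hsumr ws_def)
    finally show ?thesis .
  qed
  have V: "orthogonal_family d (eb * q * b) V (\<lambda>_. 1)"
    unfolding orthogonal_family_def
  proof (intro allI impI)
    fix c c' assume c: "c < d" "c' < d"
    have expand: "(\<Sum>x<eb * q * b. V c x * cnj (V c' x)) =
      (\<Sum>m<eb. \<Sum>t<q. \<Sum>j<b. V c (ix3 q b m t j) * cnj (V c' (ix3 q b m t j)))"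
      by (rule sum_lessThan_mult3)
    show "(\<Sum>x<eb * q * b. V c x * cnj (V c' x)) = (if c = c' then complex_of_real 1 else 0)"
    proof (cases "c < r \<and> c' < r")
      case True
      then have lh: "0 < l (h c)" "0 < l (h c')" using S(3) hS by auto
      have "(\<Sum>x<eb * q * b. V c x * cnj (V c' x)) = (\<Sum>m<eb. \<Sum>t<q. if t = 0 then \<Sum>j<b.
         w (h c) (m * b + j) * cnj (w (h c') (m * b + j)) / (complex_of_real (sqrt (l (h c))) * complex_of_real (sqrt (l (h c')))) else 0)"
        unfolding expand by (intro sum.cong refl) (use True in \<open>auto simp: V_def\<close>)
      also have "\<dots> = (\<Sum>y<eb * b. w (h c) y * cnj (w (h c') y)) / (complex_of_real (sqrt (l (h c))) * complex_of_real (sqrt (l (h c'))))"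
        by (simp add: sum_lessThan_mult sum_divide_distrib q)
      also have "\<dots> = (if c = c' then complex_of_real 1 else 0)"
        using True lh by (auto simp: orthogonal_familyD[OF w] hD hinj sq)
      finally show ?thesis .
    next
      case False
      show ?thesis
      proof (cases "c < r \<or> c' < r")
        case True
        then have "(\<Sum>m<eb. \<Sum>t<q. \<Sum>j<b. V c (ix3 q b m t j) * cnj (V c' (ix3 q b m t j))) = 0"
          using False by (intro sum.neutral ballI) (auto simp: V_def)
        then show ?thesis using True False expand by auto
      next
        case F2: False
        have "(\<Sum>m<eb. \<Sum>t<q. \<Sum>j<b. V c (ix3 q b m t j) * cnj (V c' (ix3 q b m t j))) =
          (\<Sum>m<eb. \<Sum>t<q. \<Sum>j<b. if j = 0 then if t = Suc c then if m = 0 then if c = c' then 1 else 0 else 0 else 0 else 0)"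
          using F2 by (intro sum.cong refl) (auto simp: V_def)
        also have "\<dots> = (if c = c' then complex_of_real 1 else 0)" using b0 c by (simp add: q)
        finally show ?thesis using expand by simp
      qed
    qed
  qed
  have Wiso: "(\<Sum>z<eb * q * ea. cnj (W z p) * W z p') = (if p = p' then 1 else 0)" if p: "p < e" "p' < e" for p p'
  proof -
    have "(\<Sum>z<eb * q * ea. cnj (W z p) * W z p') =
      (\<Sum>m<eb. \<Sum>t<q. \<Sum>k<ea. cnj (W (ix3 q ea m t k) p) * W (ix3 q ea m t k) p')"
      by (rule sum_lessThan_mult3)
    also have "\<dots> = (\<Sum>m<eb. \<Sum>t<q. \<Sum>k<ea. (if t = 0 then cnj (W0 (m * ea + k) p) * W0 (m * ea + k) p' else 0) +
        (if k = 0 then if m = 0 then if Suc d \<le> t then cnj (R (t - Suc d) p) * R (t - Suc d) p' else 0 else 0 else 0))"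
      by (intro sum.cong refl) (auto simp: W_def)
    also have "\<dots> = (\<Sum>m<eb. \<Sum>t<q. \<Sum>k<ea. if t = 0 then cnj (W0 (m * ea + k) p) * W0 (m * ea + k) p' else 0) +
        (\<Sum>m<eb. \<Sum>t<q. \<Sum>k<ea. if k = 0 then if m = 0 then if Suc d \<le> t then cnj (R (t - Suc d) p) * R (t - Suc d) p' else 0 else 0 else 0)"
      by (simp only: sum.distrib)
    also have "(\<Sum>m<eb. \<Sum>t<q. \<Sum>k<ea. if t = 0 then cnj (W0 (m * ea + k) p) * W0 (m * ea + k) p' else 0) =
        (\<Sum>m<eb. \<Sum>k<ea. cnj (W0 (m * ea + k) p) * W0 (m * ea + k) p')"
      by (rule sum.cong[OF refl], subst sum.swap) (simp add: q)
    also have "(\<Sum>m<eb. \<Sum>t<q. \<Sum>k<ea. if k = 0 then if m = 0 then if Suc d \<le> t then cnj (R (t - Suc d) p) * R (t - Suc d) p' else 0 else 0 else 0) =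
        (\<Sum>t<q. if Suc d \<le> t then cnj (R (t - Suc d) p) * R (t - Suc d) p' else 0)"
      using a0 b0 by (subst sum.swap) simp
    also have "(\<Sum>m<eb. \<Sum>k<ea. cnj (W0 (m * ea + k) p) * W0 (m * ea + k) p') +
        (\<Sum>t<q. if Suc d \<le> t then cnj (R (t - Suc d) p) * R (t - Suc d) p' else 0) =
        (\<Sum>z<eb * ea. cnj (W0 z p) * W0 z p') + (\<Sum>z<e. cnj (R z p) * R z p')"
      using b0 unfolding q_def sum_lessThan_add by (simp add: sum_lessThan_mult)
    finally show ?thesis using iso[OF p] by simp
  qed
  define \<Theta> where "\<Theta> = (\<lambda>i j f. \<Sum>c<d. U c (f mod ea * a + i) * V c (f div ea * b + j))"
  define \<Psi> where "\<Psi> = (\<lambda>i j f. \<Sum>p<e. W f p * \<psi> $ ix3 b e i j p)"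
  define N where "N = (\<lambda>G :: nat \<Rightarrow> nat \<Rightarrow> nat \<Rightarrow> complex. sqrt (\<Sum>i<a. \<Sum>j<b. \<Sum>f<eb * q * ea. (cmod (G i j f))\<^sup>2))"
  \<comment> \<open>Coefficients of the prepared state relative to the full purification. Prepared
    state, target and their difference are thus combinations of the same orthogonal products, so all
    three norms are sums over \<open>c\<close>.\<close>
  define \<beta> where "\<beta> c = (if c \<in> S then 1 / sqrt ws else 0)" for c
  have N: "N G = sqrt (\<Sum>c<D. (\<gamma> c)\<^sup>2 * l c)"
    if G: "\<And>i j m t k. i < a \<Longrightarrow> j < b \<Longrightarrow> m < eb \<Longrightarrow> t < q \<Longrightarrow> k < ea \<Longrightarrow> G i j (ix3 q ea m t k) =
      (if t = 0 then \<Sum>c<D. complex_of_real (\<gamma> c) * (u c (k * a + i) * w c (m * b + j)) else 0)" for G \<gamma>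
  proof -
    have "(\<Sum>i<a. \<Sum>j<b. \<Sum>f<eb * q * ea. (cmod (G i j f))\<^sup>2) =
      (\<Sum>i<a. \<Sum>j<b. \<Sum>m<eb. \<Sum>t<q. if t = 0 then \<Sum>k<ea. (cmod (\<Sum>c<D. complex_of_real (\<gamma> c) * (u c (k * a + i) * w c (m * b + j))))\<^sup>2 else 0)"
      unfolding sum_lessThan_mult3 by (intro sum.cong refl) (auto simp: G)
    also have "\<dots> = (\<Sum>i<a. \<Sum>j<b. \<Sum>m<eb. \<Sum>k<ea. (cmod (\<Sum>c<D. complex_of_real (\<gamma> c) * (u c (k * a + i) * w c (m * b + j))))\<^sup>2)"
      by (simp add: q)
    also have "\<dots> = (\<Sum>k<ea. \<Sum>i<a. \<Sum>m<eb. \<Sum>j<b. (cmod (\<Sum>c<D. complex_of_real (\<gamma> c) * (u c (k * a + i) * w c (m * b + j))))\<^sup>2)"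
      unfolding sum.cartesian_product
      by (rule sum.reindex_bij_witness[of _ "\<lambda>(k, i, m, j). (i, j, m, k)" "\<lambda>(i, j, m, k). (k, i, m, j)"]) auto
    also have "\<dots> = (\<Sum>c<D. (\<gamma> c)\<^sup>2 * l c)"
      unfolding orthogonal_product_norm[OF u w, symmetric] sum_lessThan_mult ..
    finally show ?thesis by (simp add: N_def)
  qed
  have \<Theta>: "\<Theta> i j (ix3 q ea m t k) = (if t = 0 then \<Sum>c<D. complex_of_real (\<beta> c) * (u c (k * a + i) * w c (m * b + j)) else 0)"
    if "i < a" "j < b" "m < eb" "t < q" "k < ea" for i j m t k
  proof -
    have f: "ix3 q ea m t k mod ea = k" "ix3 q ea m t k div ea * b + j = ix3 q b m t j"
      using that by (simp_all add: ix3_def)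
    have "\<Theta> i j (ix3 q ea m t k) = (\<Sum>c<r. U c (k * a + i) * V c (ix3 q b m t j))"
      unfolding \<Theta>_def f using rd by (intro sum.mono_neutral_right) (auto simp: U_def)
    also have "\<dots> = (\<Sum>c<r. if t = 0 then u (h c) (k * a + i) * w (h c) (m * b + j) / complex_of_real (sqrt ws) else 0)"
    proof (intro sum.cong refl)
      fix c assume "c \<in> {..<r}"
      then have "c < r" "0 < l (h c)" using hS S(3) by auto
      then show "U c (k * a + i) * V c (ix3 q b m t j) =
         (if t = 0 then u (h c) (k * a + i) * w (h c) (m * b + j) / complex_of_real (sqrt ws) else 0)"
        using that ws0 by (simp add: U_def V_def real_sqrt_divide)
    qed
    also have "\<dots> = (if t = 0 then \<Sum>c\<in>S. u c (k * a + i) * w c (m * b + j) / complex_of_real (sqrt ws) else 0)"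
      using hsum[of "\<lambda>c. u c (k * a + i) * w c (m * b + j) / complex_of_real (sqrt ws)"] by simp
    also have "(\<Sum>c\<in>S. u c (k * a + i) * w c (m * b + j) / complex_of_real (sqrt ws)) =
       (\<Sum>c<D. complex_of_real (\<beta> c) * (u c (k * a + i) * w c (m * b + j)))"
      using S(1) by (intro sum.mono_neutral_cong_left) (auto simp: \<beta>_def)
    finally show ?thesis .
  qed
  have \<Psi>: "\<Psi> i j (ix3 q ea m t k) = (if t = 0 then \<Sum>c<D. complex_of_real 1 * (u c (k * a + i) * w c (m * b + j)) else 0)"
    if "i < a" "j < b" "m < eb" "t < q" "k < ea" for i j m t k
  proof -
    have x: "i * b + j < a * b" using that by (intro mult_add_less)
    have z: "m * ea + k < eb * ea" using that by (intro mult_add_less)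
    have "\<Psi> i j (ix3 q ea m t k) = (if t = 0 then \<Sum>p<e. W0 (m * ea + k) p * \<psi> $ ((i * b + j) * e + p)
      else if m = 0 \<and> k = 0 \<and> Suc d \<le> t then \<Sum>p<e. R (t - Suc d) p * \<psi> $ ((i * b + j) * e + p) else 0)"
      using that by (auto simp: \<Psi>_def W_def ix3_def[of b e])
    also have "\<dots> = (if t = 0 then \<phi> i k j m else 0)"
      using that W0[OF x z] R[OF x, of "t - Suc d"] by (auto simp: q_def)
    finally show ?thesis by (simp add: \<phi>_def)
  qed
  have "N \<Theta> = sqrt (\<Sum>c<D. (\<beta> c)\<^sup>2 * l c)" by (rule N[OF \<Theta>])
  also have "(\<Sum>c<D. (\<beta> c)\<^sup>2 * l c) = (\<Sum>c\<in>S. l c / ws)"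
    using S(1) ws0 by (intro sum.mono_neutral_cong_right) (auto simp: \<beta>_def power_divide)
  also have "\<dots> = 1" using ws0 by (simp add: sum_divide_distrib[symmetric] ws_def)
  finally have N\<Theta>: "N \<Theta> = 1" by simp
  have N\<Psi>: "N \<Psi> = 1" using N[OF \<Psi>] l by simp
  have "N (\<lambda>i j f. \<Theta> i j f - \<Psi> i j f) = sqrt (\<Sum>c<D. (\<beta> c - 1)\<^sup>2 * l c)"
    by (rule N) (simp add: \<Theta> \<Psi> sum_subtractf[symmetric] left_diff_distrib)
  also have "(\<Sum>c<D. (\<beta> c - 1)\<^sup>2 * l c) = (\<Sum>c<D. (\<beta> c)\<^sup>2 * l c - 2 * (\<beta> c * l c) + l c)"
    by (simp add: power2_eq_square algebra_simps)
  also have "\<dots> = (\<Sum>c<D. (\<beta> c)\<^sup>2 * l c) - 2 * (\<Sum>c<D. \<beta> c * l c) + 1"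
    by (simp add: sum.distrib sum_subtractf l sum_distrib_left)
  also have "(\<Sum>c<D. (\<beta> c)\<^sup>2 * l c) = 1"
    using N[OF \<Theta>] N\<Theta> by simp
  also have "(\<Sum>c<D. \<beta> c * l c) = (\<Sum>c\<in>S. l c / sqrt ws)"
    using S(1) by (intro sum.mono_neutral_cong_right) (auto simp: \<beta>_def)
  also have "\<dots> = sqrt ws"
    using ws0 by (simp add: sum_divide_distrib[symmetric] ws_def[symmetric] real_div_sqrt)
  finally have "N (\<lambda>i j f. \<Theta> i j f - \<Psi> i j f) = sqrt (2 - 2 * sqrt ws)" by simp
  \<comment> \<open>The squared distance is \<open>2 - 2 * sqrt ws\<close>; this replaces it by an
    expression linear in the discarded weight. The outer factor 2 of the final bound is the sum of
    the norms of the two unit vectors.\<close>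
  moreover have "ws \<le> sqrt ws" using ws0 ws1 by (intro real_le_rsqrt) (simp add: power2_eq_square mult_left_le)
  ultimately have Nd: "N (\<lambda>i j f. \<Theta> i j f - \<Psi> i j f) \<le> sqrt (2 * (1 - ws))" by simp
  have "convertible (N (\<lambda>i j f. \<Theta> i j f - \<Psi> i j f) * (N \<Theta> + N \<Psi>)) (d, d, 1) (max_entangled d) (a, b, e) (proj \<psi>)"
    unfolding N_def \<Theta>_def \<Psi>_def
    by (rule convertible_of_isometry[OF \<psi> \<open>0 < d\<close> \<open>0 < e\<close> U \<mu> V Wiso])
  then show ?thesis
    unfolding N\<Theta> N\<Psi> ws_def[symmetric] convertible_def using Nd by (fastforce intro: order_trans)
qed

section \<open>Tensor products of operators and purifications\<close>

lemma carrier_mat_eq_ix3I: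
  assumes "A \<in> carrier_mat (a * b * e) (a * b * e)" "B \<in> carrier_mat (a * b * e) (a * b * e)"
    and "\<And>i j k i' j' k'. i < a \<Longrightarrow> j < b \<Longrightarrow> k < e \<Longrightarrow> i' < a \<Longrightarrow> j' < b \<Longrightarrow> k' < e \<Longrightarrow>
      A $$ (ix3 b e i j k, ix3 b e i' j' k') = B $$ (ix3 b e i j k, ix3 b e i' j' k')"
  shows "A = B"
proof (rule eq_matI)
  fix x y assume "x < dim_row B" "y < dim_col B"
  then have xy: "x < a * b * e" "y < a * b * e" using assms by auto
  show "A $$ (x, y) = B $$ (x, y)"
    using assms(3)[OF pos_less[OF xy(1)] pos_less[OF xy(2)]] by simp
qed (use assms in auto)

lemma tensor3_carrier [simp]:
  "tensor3 (a1, b1, e1) X (a2, b2, e2) Y \<in> carrier_mat (a1 * a2 * (b1 * b2) * (e1 * e2)) (a1 * a2 * (b1 * b2) * (e1 * e2))"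
  by (simp add: Let_def)

lemma tensor3_index:
  assumes "i < a1 * a2" "j < b1 * b2" "k < e1 * e2" "i' < a1 * a2" "j' < b1 * b2" "k' < e1 * e2"
  shows "tensor3 (a1, b1, e1) X (a2, b2, e2) Y $$ (ix3 (b1 * b2) (e1 * e2) i j k, ix3 (b1 * b2) (e1 * e2) i' j' k') =
    X $$ (ix3 b1 e1 (i div a2) (j div b2) (k div e2), ix3 b1 e1 (i' div a2) (j' div b2) (k' div e2)) *
    Y $$ (ix3 b2 e2 (i mod a2) (j mod b2) (k mod e2), ix3 b2 e2 (i' mod a2) (j' mod b2) (k' mod e2))"
  using assms by (simp add: Let_def ix3_less)

declare tensor3.simps [simp del]

text \<open>Regrouping the digits of a positional index involves no permutation, so associativity is
  a plain equality of matrices. It is what permits a tensor power to be split at an arbitrary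
  place.\<close>

lemma tensor3_assoc:
  "tensor3 (a1, b1, e1) X (a2 * a3, b2 * b3, e2 * e3) (tensor3 (a2, b2, e2) Y (a3, b3, e3) Z) =
   tensor3 (a1 * a2, b1 * b2, e1 * e2) (tensor3 (a1, b1, e1) X (a2, b2, e2) Y) (a3, b3, e3) Z"
proof (rule carrier_mat_eq_ix3I[where a = "a1 * a2 * a3" and b = "b1 * b2 * b3" and e = "e1 * e2 * e3"])
  show "tensor3 (a1, b1, e1) X (a2 * a3, b2 * b3, e2 * e3) (tensor3 (a2, b2, e2) Y (a3, b3, e3) Z)
    \<in> carrier_mat (a1 * a2 * a3 * (b1 * b2 * b3) * (e1 * e2 * e3)) (a1 * a2 * a3 * (b1 * b2 * b3) * (e1 * e2 * e3))"
    using tensor3_carrier[of a1 b1 e1 X "a2 * a3" "b2 * b3" "e2 * e3"] by (simp add: mult.assoc)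
  have split_less: "i div n < x * y" "i mod (y * n) < y * n" and
      split_eq: "i div (y * n) = i div n div y" "i mod (y * n) div n = i div n mod y" "i mod (y * n) mod n = i mod n"
    if "i < x * y * n" for i x y n :: nat
  proof -
    have 0: "0 < n" "0 < y" using that by (auto intro: Nat.gr0I)
    then show "i div n < x * y" "i mod (y * n) < y * n"
      using that by (simp_all add: less_mult_imp_div_less)
    show "i div (y * n) = i div n div y" "i mod (y * n) div n = i div n mod y" "i mod (y * n) mod n = i mod n"
      using 0 by (simp_all add: mult.commute[of y] div_mult2_eq mod_mult2_eq)
  qed
  fix i j k i' j' k' assume lt: "i < a1 * a2 * a3" "j < b1 * b2 * b3" "k < e1 * e2 * e3"
    "i' < a1 * a2 * a3" "j' < b1 * b2 * b3" "k' < e1 * e2 * e3"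
  note less = split_less(1)[OF lt(1)] split_less(1)[OF lt(2)] split_less(1)[OF lt(3)]
    split_less(1)[OF lt(4)] split_less(1)[OF lt(5)] split_less(1)[OF lt(6)]
  note less' = split_less(2)[OF lt(1)] split_less(2)[OF lt(2)] split_less(2)[OF lt(3)]
    split_less(2)[OF lt(4)] split_less(2)[OF lt(5)] split_less(2)[OF lt(6)]
  note eqs = split_eq[OF lt(1)] split_eq[OF lt(2)] split_eq[OF lt(3)]
    split_eq[OF lt(4)] split_eq[OF lt(5)] split_eq[OF lt(6)]
  have 1: "tensor3 (a1, b1, e1) X (a2 * a3, b2 * b3, e2 * e3) (tensor3 (a2, b2, e2) Y (a3, b3, e3) Z) $$
      (ix3 (b1 * b2 * b3) (e1 * e2 * e3) i j k, ix3 (b1 * b2 * b3) (e1 * e2 * e3) i' j' k') =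
    X $$ (ix3 b1 e1 (i div (a2 * a3)) (j div (b2 * b3)) (k div (e2 * e3)), ix3 b1 e1 (i' div (a2 * a3)) (j' div (b2 * b3)) (k' div (e2 * e3))) *
    tensor3 (a2, b2, e2) Y (a3, b3, e3) Z $$ (ix3 (b2 * b3) (e2 * e3) (i mod (a2 * a3)) (j mod (b2 * b3)) (k mod (e2 * e3)),
      ix3 (b2 * b3) (e2 * e3) (i' mod (a2 * a3)) (j' mod (b2 * b3)) (k' mod (e2 * e3)))"
    using tensor3_index[of i a1 "a2 * a3" j b1 "b2 * b3" k e1 "e2 * e3" i' j' k'] lt by (simp only: mult.assoc)
  show "tensor3 (a1, b1, e1) X (a2 * a3, b2 * b3, e2 * e3) (tensor3 (a2, b2, e2) Y (a3, b3, e3) Z) $$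
      (ix3 (b1 * b2 * b3) (e1 * e2 * e3) i j k, ix3 (b1 * b2 * b3) (e1 * e2 * e3) i' j' k') =
     tensor3 (a1 * a2, b1 * b2, e1 * e2) (tensor3 (a1, b1, e1) X (a2, b2, e2) Y) (a3, b3, e3) Z $$
      (ix3 (b1 * b2 * b3) (e1 * e2 * e3) i j k, ix3 (b1 * b2 * b3) (e1 * e2 * e3) i' j' k')"
    unfolding 1 tensor3_index[OF less'] tensor3_index[OF lt] tensor3_index[OF less] eqs by (rule mult.assoc[symmetric])
qed simp

lemma tensor3_one_right:
  assumes "X \<in> carrier_mat (a * b * e) (a * b * e)"
  shows "tensor3 (a, b, e) X (1, 1, 1) (1\<^sub>m 1) = X"
proof (rule carrier_mat_eq_ix3I[OF _ assms])
  show "tensor3 (a, b, e) X (1, 1, 1) (1\<^sub>m 1) \<in> carrier_mat (a * b * e) (a * b * e)"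
    using tensor3_carrier[of a b e X 1 1 1 "1\<^sub>m 1"] by simp
next
  fix i j k i' j' k' assume "i < a" "j < b" "k < e" "i' < a" "j' < b" "k' < e"
  then show "tensor3 (a, b, e) X (1, 1, 1) (1\<^sub>m 1) $$ (ix3 b e i j k, ix3 b e i' j' k') = X $$ (ix3 b e i j k, ix3 b e i' j' k')"
    using tensor3_index[of i a 1 j b 1 k e 1 i' j' k' X "1\<^sub>m 1"] by (simp add: ix3_def)
qed

section \<open>Tensor powers\<close>

lemma dims_pow_eq: "dims_pow (a, b, e) n = (a ^ n, b ^ n, e ^ n)"
  by (induction n) (simp_all add: mult.commute)

lemma tensor_pow_carrier [simp]:
  "tensor_pow (a, b, e) X n \<in> carrier_mat (a ^ n * b ^ n * e ^ n) (a ^ n * b ^ n * e ^ n)"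
proof (cases n)
  case (Suc m)
  then show ?thesis using tensor3_carrier[of "a ^ m" "b ^ m" "e ^ m" "tensor_pow (a, b, e) X m" a b e X]
    by (simp add: dims_pow_eq power_Suc2 del: power_Suc)
qed simp

lemma tensor_pow_add:
  "tensor_pow (a, b, e) X (m + n) =
    tensor3 (a ^ m, b ^ m, e ^ m) (tensor_pow (a, b, e) X m) (a ^ n, b ^ n, e ^ n) (tensor_pow (a, b, e) X n)"
proof (induction n)
  case 0
  show ?case using tensor3_one_right[OF tensor_pow_carrier] by simp
next
  case (Suc n)
  have "tensor_pow (a, b, e) X (m + Suc n) = tensor3 (a ^ m * a ^ n, b ^ m * b ^ n, e ^ m * e ^ n)
     (tensor3 (a ^ m, b ^ m, e ^ m) (tensor_pow (a, b, e) X m) (a ^ n, b ^ n, e ^ n) (tensor_pow (a, b, e) X n)) (a, b, e) X"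
    by (simp add: dims_pow_eq Suc power_add)
  then show ?case by (simp add: tensor3_assoc[symmetric] dims_pow_eq power_Suc2 del: power_Suc)
qed

lemma tensor_pow_mult:
  "tensor_pow (a, b, e) X (m * k) = tensor_pow (a ^ m, b ^ m, e ^ m) (tensor_pow (a, b, e) X m) k"
proof (induction k)
  case (Suc k)
  have "m * Suc k = m * k + m" by simp
  then have "tensor_pow (a, b, e) X (m * Suc k) = tensor3 (a ^ (m * k), b ^ (m * k), e ^ (m * k))
     (tensor_pow (a, b, e) X (m * k)) (a ^ m, b ^ m, e ^ m) (tensor_pow (a, b, e) X m)"
    by (simp only: tensor_pow_add)
  then show ?case by (simp add: Suc dims_pow_eq power_mult)
qed simp

lemma tensor3_proj:
  assumes "\<psi> \<in> carrier_vec (a1 * b1 * e1)" "\<chi> \<in> carrier_vec (a2 * b2 * e2)"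
  shows "\<exists>\<eta> \<in> carrier_vec (a1 * a2 * (b1 * b2) * (e1 * e2)).
    tensor3 (a1, b1, e1) (proj \<psi>) (a2, b2, e2) (proj \<chi>) = proj \<eta>"
proof -
  let ?D = "a1 * a2 * (b1 * b2) * (e1 * e2)"
  define i1 i2 where "i1 = (\<lambda>z. ix3 b1 e1 (pos1 (b1 * b2) (e1 * e2) z div a2) (pos2 (b1 * b2) (e1 * e2) z div b2) (pos3 (e1 * e2) z div e2))"
    and "i2 = (\<lambda>z. ix3 b2 e2 (pos1 (b1 * b2) (e1 * e2) z mod a2) (pos2 (b1 * b2) (e1 * e2) z mod b2) (pos3 (e1 * e2) z mod e2))"
  have lt: "i1 z < a1 * b1 * e1" "i2 z < a2 * b2 * e2" if "z < ?D" for z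
    using pos_less[OF that] that unfolding i1_def i2_def
    by (auto intro!: ix3_less mod_less_divisor Nat.gr0I simp: less_mult_imp_div_less)
  have "tensor3 (a1, b1, e1) (proj \<psi>) (a2, b2, e2) (proj \<chi>) = proj (vec ?D (\<lambda>z. \<psi> $ i1 z * \<chi> $ i2 z))"
    using assms lt by (intro eq_matI) (auto simp: tensor3.simps proj_def Let_def i1_def i2_def)
  then show ?thesis by (metis vec_carrier)
qed

text \<open>The conversion lemmas expect their target as \<open>proj\<close> of a vector, so the
  power of a pure state is exhibited in this form.\<close>

lemma tensor_pow_proj:
  assumes "\<psi> \<in> carrier_vec (a * b * e)"
  shows "\<exists>\<eta> \<in> carrier_vec (a ^ n * b ^ n * e ^ n). tensor_pow (a, b, e) (proj \<psi>) n = proj \<eta>"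
proof (induction n)
  case 0
  have "tensor_pow (a, b, e) (proj \<psi>) 0 = proj (vec 1 (\<lambda>_. 1))"
    by (intro eq_matI) (auto simp: proj_def)
  then show ?case by (intro bexI[of _ "vec 1 (\<lambda>_. 1)"]) auto
next
  case (Suc n)
  then obtain \<eta> where "\<eta> \<in> carrier_vec (a ^ n * b ^ n * e ^ n)" "tensor_pow (a, b, e) (proj \<psi>) n = proj \<eta>" by blast
  from tensor3_proj[OF this(1) assms] this(2) show ?case by (simp add: dims_pow_eq power_Suc2 del: power_Suc)
qed

lemma ptrace_carrier [simp]: "ptrace l d r X \<in> carrier_mat (l * r) (l * r)"
  by (simp add: ptrace_def)

lemma ptrace_last_index:
  assumes "x < n" "y < n"
  shows "ptrace n e 1 X $$ (x, y) = (\<Sum>k<e. X $$ (x * e + k, y * e + k))"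
  using assms by (simp add: ptrace_def ix3_def)

lemma ptrace_tensor3:
  "ptrace (a1 * a2 * (b1 * b2)) (e1 * e2) 1 (tensor3 (a1, b1, e1) X (a2, b2, e2) Y) =
   tensor3 (a1, b1, 1) (ptrace (a1 * b1) e1 1 X) (a2, b2, 1) (ptrace (a2 * b2) e2 1 Y)"
proof (rule carrier_mat_eq_ix3I[where a = "a1 * a2" and b = "b1 * b2" and e = "1 * 1"])
  fix i j k i' j' k' assume "i < a1 * a2" "j < b1 * b2" "k < (1 :: nat) * 1" "i' < a1 * a2" "j' < b1 * b2" "k' < (1 :: nat) * 1"
  then have lt: "i < a1 * a2" "j < b1 * b2" "i' < a1 * a2" "j' < b1 * b2" and [simp]: "k = 0" "k' = 0" by auto
  have lt': "i * (b1 * b2) + j < a1 * a2 * (b1 * b2)" "i' * (b1 * b2) + j' < a1 * a2 * (b1 * b2)"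
    using lt by (auto intro: mult_add_less)
  have 0: "0 < a2" "0 < b2" using lt by (auto intro: Nat.gr0I)
  have lt'': "(i div a2) * b1 + j div b2 < a1 * b1" "(i' div a2) * b1 + j' div b2 < a1 * b1"
     "(i mod a2) * b2 + j mod b2 < a2 * b2" "(i' mod a2) * b2 + j' mod b2 < a2 * b2"
    using lt 0 by (auto intro!: mult_add_less simp: less_mult_imp_div_less)
  have "ptrace (a1 * a2 * (b1 * b2)) (e1 * e2) 1 (tensor3 (a1, b1, e1) X (a2, b2, e2) Y) $$
      (ix3 (b1 * b2) (1 * 1) i j k, ix3 (b1 * b2) (1 * 1) i' j' k') =
    (\<Sum>k<e1 * e2. tensor3 (a1, b1, e1) X (a2, b2, e2) Y $$ (ix3 (b1 * b2) (e1 * e2) i j k, ix3 (b1 * b2) (e1 * e2) i' j' k))"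
    using ptrace_last_index[OF lt'] by (simp add: ix3_def)
  also have "\<dots> = (\<Sum>k1<e1. \<Sum>k2<e2. X $$ (ix3 b1 e1 (i div a2) (j div b2) k1, ix3 b1 e1 (i' div a2) (j' div b2) k1) *
    Y $$ (ix3 b2 e2 (i mod a2) (j mod b2) k2, ix3 b2 e2 (i' mod a2) (j' mod b2) k2))"
    using lt by (simp add: tensor3_index sum_lessThan_mult mult_add_less)
  also have "\<dots> = ptrace (a1 * b1) e1 1 X $$ (ix3 b1 1 (i div a2) (j div b2) 0, ix3 b1 1 (i' div a2) (j' div b2) 0) *
     ptrace (a2 * b2) e2 1 Y $$ (ix3 b2 1 (i mod a2) (j mod b2) 0, ix3 b2 1 (i' mod a2) (j' mod b2) 0)"
    using lt'' by (simp add: ptrace_last_index[simplified] ix3_def sum_product)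
  also have "\<dots> = tensor3 (a1, b1, 1) (ptrace (a1 * b1) e1 1 X) (a2, b2, 1) (ptrace (a2 * b2) e2 1 Y) $$
      (ix3 (b1 * b2) (1 * 1) i j k, ix3 (b1 * b2) (1 * 1) i' j' k')"
    using lt by (subst tensor3_index) simp_all
  finally show "ptrace (a1 * a2 * (b1 * b2)) (e1 * e2) 1 (tensor3 (a1, b1, e1) X (a2, b2, e2) Y) $$
      (ix3 (b1 * b2) (1 * 1) i j k, ix3 (b1 * b2) (1 * 1) i' j' k') =
     tensor3 (a1, b1, 1) (ptrace (a1 * b1) e1 1 X) (a2, b2, 1) (ptrace (a2 * b2) e2 1 Y) $$
      (ix3 (b1 * b2) (1 * 1) i j k, ix3 (b1 * b2) (1 * 1) i' j' k')" .
qed (simp_all only: mult_1_right tensor3_carrier ptrace_carrier, use tensor3_carrier[of a1 b1 1 _ a2 b2 1] ptrace_carrier[of "a1 * a2 * (b1 * b2)" _ 1] in simp_all)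

text \<open>Identifies the operator whose entanglement of purification is regularized with the
  reduced operator of the state that is to be diluted.\<close>

lemma ptrace_tensor_pow:
  "ptrace (a ^ n * b ^ n) (e ^ n) 1 (tensor_pow (a, b, e) X n) = tensor_pow (a, b, 1) (ptrace (a * b) e 1 X) n"
proof (induction n)
  case 0
  show ?case by (intro eq_matI) (auto simp: ptrace_def ix3_def)
next
  case (Suc n)
  have "ptrace (a ^ Suc n * b ^ Suc n) (e ^ Suc n) 1 (tensor_pow (a, b, e) X (Suc n)) =
     ptrace (a ^ n * a * (b ^ n * b)) (e ^ n * e) 1 (tensor3 (a ^ n, b ^ n, e ^ n) (tensor_pow (a, b, e) X n) (a, b, e) X)"
    by (simp add: dims_pow_eq power_Suc2 del: power_Suc)
  then show ?case by (simp only: ptrace_tensor3 Suc tensor_pow.simps dims_pow_eq power_one)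
qed

lemma tensor3_max_entangled:
  assumes "0 < d1" "0 < d2"
  shows "tensor3 (d1, d1, 1) (max_entangled d1) (d2, d2, 1) (max_entangled d2) = max_entangled (d1 * d2)"
proof (rule carrier_mat_eq_ix3I[where a = "d1 * d2" and b = "d1 * d2" and e = "1 * 1"])
  have ME: "max_entangled d $$ (ix3 d 1 i j 0, ix3 d 1 i' j' 0) = (if i = j \<and> i' = j' then 1 / of_nat d else 0)"
    if "i < d" "j < d" "i' < d" "j' < d" for d i j i' j'
  proof -
    have "ix3 d 1 i j 0 < d * d * 1" "ix3 d 1 i' j' 0 < d * d * 1" using that ix3_less[of i d j d 0 1] ix3_less[of i' d j' d 0 1] by simp_all
    moreover have "complex_of_real (sqrt d) * complex_of_real (sqrt d) = of_nat d" by (simp flip: of_real_mult)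
    ultimately show ?thesis using that by (auto simp: max_entangled_def ensemble_def)
  qed
  fix i j k i' j' k' assume "i < d1 * d2" "j < d1 * d2" "k < (1 :: nat) * 1" "i' < d1 * d2" "j' < d1 * d2" "k' < (1 :: nat) * 1"
  then have lt: "i < d1 * d2" "j < d1 * d2" "i' < d1 * d2" "j' < d1 * d2" and [simp]: "k = 0" "k' = 0" by auto
  have eq: "i = j \<longleftrightarrow> i div d2 = j div d2 \<and> i mod d2 = j mod d2" for i j by (metis div_mult_mod_eq)
  have "tensor3 (d1, d1, 1) (max_entangled d1) (d2, d2, 1) (max_entangled d2) $$
     (ix3 (d1 * d2) (1 * 1) i j k, ix3 (d1 * d2) (1 * 1) i' j' k') =
     (if i div d2 = j div d2 \<and> i' div d2 = j' div d2 then 1 / of_nat d1 else 0) *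
     (if i mod d2 = j mod d2 \<and> i' mod d2 = j' mod d2 then 1 / of_nat d2 else 0)"
    using lt assms by (subst tensor3_index) (simp_all add: ME[simplified] less_mult_imp_div_less)
  also have "\<dots> = max_entangled (d1 * d2) $$ (ix3 (d1 * d2) (1 * 1) i j k, ix3 (d1 * d2) (1 * 1) i' j' k')"
    using lt ME[of i "d1 * d2" j i' j'] eq[of i j] eq[of i' j'] by auto
  finally show "tensor3 (d1, d1, 1) (max_entangled d1) (d2, d2, 1) (max_entangled d2) $$
     (ix3 (d1 * d2) (1 * 1) i j k, ix3 (d1 * d2) (1 * 1) i' j' k') =
     max_entangled (d1 * d2) $$ (ix3 (d1 * d2) (1 * 1) i j k, ix3 (d1 * d2) (1 * 1) i' j' k')" .
qed (use tensor3_carrier[of d1 d1 1 _ d2 d2 1] in \<open>simp_all add: max_entangled_def ensemble_def\<close>)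

lemma unit_state_eq: "unit_state = max_entangled 2"
proof (rule eq_matI)
  fix x y assume "x < dim_row (max_entangled 2)" "y < dim_col (max_entangled 2)"
  then have "x < 4" "y < 4" by (auto simp: max_entangled_def ensemble_def)
  then have "x \<in> {0, 1, 2, 3}" "y \<in> {0, 1, 2, 3}" by auto
  then show "unit_state $$ (x, y) = max_entangled 2 $$ (x, y)"
    by (auto simp: unit_state_def proj_def max_entangled_def ensemble_def pos1_def pos2_def ix3_def)
qed (auto simp: unit_state_def proj_def max_entangled_def ensemble_def)

lemma tensor_pow_unit_state: "tensor_pow unit_dims unit_state n = max_entangled (2 ^ n)"
proof (induction n)
  case 0
  show ?case by (rule eq_matI) (auto simp: max_entangled_def ensemble_def pos1_def pos2_def)
next
  case (Suc n)
  then show ?case using tensor3_max_entangled[of "2 ^ n" 2]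
    by (simp add: unit_dims_def unit_state_eq dims_pow_eq mult.commute)
qed

section \<open>Spectra of purifications\<close>

lemma div_mod_mult_add:
  "y < n \<Longrightarrow> (x * n + y) div n = x" "y < n \<Longrightarrow> (x * n + y) mod n = y" for x y n :: nat
  by simp_all

text \<open>
  \<open>l\<close> is the spectrum of the reduced operator on \<open>AE\<^sub>A\<close> of a purification \<open>\<Sum>\<^sub>c u\<^sub>c \<otimes> w\<^sub>c\<close> of \<open>\<tau>\<close> in
  Schmidt form, in which \<open>|w\<^sub>c|\<^sup>2 = l\<^sub>c\<close>.
\<close>

definition purification_spectrum :: "nat \<Rightarrow> nat \<Rightarrow> complex mat \<Rightarrow> nat \<Rightarrow> (nat \<Rightarrow> real) \<Rightarrow> bool" where
  "purification_spectrum a b \<tau> D l \<longleftrightarrow> (\<exists>ea eb u w. D = a * ea \<and>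
     orthogonal_family D (a * ea) u (\<lambda>_. 1) \<and> orthogonal_family D (b * eb) w l \<and>
     (\<forall>i<a. \<forall>j<b. \<forall>i'<a. \<forall>j'<b. \<tau> $$ (i * b + j, i' * b + j') =
        (\<Sum>k<ea. \<Sum>m<eb. (\<Sum>c<D. u c (i * ea + k) * w c (j * eb + m)) *
           cnj (\<Sum>c<D. u c (i' * ea + k) * w c (j' * eb + m)))))"

definition shannon :: "nat \<Rightarrow> (nat \<Rightarrow> real) \<Rightarrow> real" where
  "shannon D l = - (\<Sum>c<D. l c * log 2 (l c))"

lemma purification_iff:
  assumes "\<tau> \<in> carrier_mat (a * b) (a * b)"
  shows "purification a b \<tau> ea eb \<phi> \<longleftrightarrow> \<phi> \<in> carrier_vec (a * ea * (b * eb)) \<and>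
     (\<forall>i<a. \<forall>j<b. \<forall>i'<a. \<forall>j'<b. \<tau> $$ (i * b + j, i' * b + j') =
        (\<Sum>k<ea. \<Sum>m<eb. \<phi> $ ((i * ea + k) * (b * eb) + (j * eb + m)) * cnj (\<phi> $ ((i' * ea + k) * (b * eb) + (j' * eb + m)))))"
proof (cases "\<phi> \<in> carrier_vec (a * ea * (b * eb))")
  case True
  let ?P = "ptrace a ea b (ptrace (a * ea * b) eb 1 (proj \<phi>))"
  have entry: "?P $$ (i * b + j, i' * b + j') =
      (\<Sum>k<ea. \<Sum>m<eb. \<phi> $ ((i * ea + k) * (b * eb) + (j * eb + m)) * cnj (\<phi> $ ((i' * ea + k) * (b * eb) + (j' * eb + m))))"
    if "i < a" "j < b" "i' < a" "j' < b" for i j i' j'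
  proof -
    have "i * b + j < a * b" "i' * b + j' < a * b" using that by (auto intro: mult_add_less)
    then have "?P $$ (i * b + j, i' * b + j') = (\<Sum>k<ea. ptrace (a * ea * b) eb 1 (proj \<phi>) $$ (ix3 ea b i k j, ix3 ea b i' k j'))"
      using that by (simp add: ptrace_def)
    also have "\<dots> = (\<Sum>k<ea. \<Sum>m<eb. proj \<phi> $$ (ix3 ea b i k j * eb + m, ix3 ea b i' k j' * eb + m))"
      by (rule sum.cong[OF refl], rule ptrace_last_index) (use that in \<open>auto intro: ix3_less\<close>)
    also have "\<dots> = (\<Sum>k<ea. \<Sum>m<eb. \<phi> $ ((i * ea + k) * (b * eb) + (j * eb + m)) * cnj (\<phi> $ ((i' * ea + k) * (b * eb) + (j' * eb + m))))"
    proof (intro sum.cong refl)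
      fix k m assume km: "k \<in> {..<ea}" "m \<in> {..<eb}"
      have ix: "ix3 ea b i k j * eb + m = (i * ea + k) * (b * eb) + (j * eb + m)" for i j
        by (simp add: ix3_def algebra_simps)
      have "(i * ea + k) * (b * eb) + (j * eb + m) < a * ea * (b * eb)" "(i' * ea + k) * (b * eb) + (j' * eb + m) < a * ea * (b * eb)"
        using that km by (auto intro!: mult_add_less)
      then show "proj \<phi> $$ (ix3 ea b i k j * eb + m, ix3 ea b i' k j' * eb + m) =
         \<phi> $ ((i * ea + k) * (b * eb) + (j * eb + m)) * cnj (\<phi> $ ((i' * ea + k) * (b * eb) + (j' * eb + m)))"
        unfolding ix using True by (simp add: proj_def)
    qed
    finally show ?thesis .
  qed
  have "?P = \<tau> \<longleftrightarrow> (\<forall>i<a. \<forall>j<b. \<forall>i'<a. \<forall>j'<b. \<tau> $$ (i * b + j, i' * b + j') = ?P $$ (i * b + j, i' * b + j'))"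
  proof
    assume *: "\<forall>i<a. \<forall>j<b. \<forall>i'<a. \<forall>j'<b. \<tau> $$ (i * b + j, i' * b + j') = ?P $$ (i * b + j, i' * b + j')"
    show "?P = \<tau>"
      by (rule carrier_mat_eq_ix3I[where a = a and b = b and e = 1]) (use * assms in \<open>auto simp: ix3_def\<close>)
  qed auto
  then show ?thesis using True entry by (simp add: purification_def)
qed (simp add: purification_def)

text \<open>The Schmidt decomposition of \<phi> across the cut between \<open>A\<close>,
  \<open>E_A\<close> and \<open>B\<close>, \<open>E_B\<close> supplies the vectors, and its weights
  are the eigenvalues of the reduced operator.\<close>

lemma purification_spectrumI:
  assumes "\<tau> \<in> carrier_mat (a * b) (a * b)" "purification a b \<tau> ea eb \<phi>"
  obtains l where "purification_spectrum a b \<tau> (a * ea) l"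
    "vn_entropy (ptrace (a * ea) (b * eb) 1 (proj \<phi>)) = shannon (a * ea) l"
proof -
  note pur = assms(2)[unfolded purification_iff[OF assms(1)]]
  define M where "M x y = \<phi> $ (x * (b * eb) + y)" for x y
  obtain u w and l :: "nat \<Rightarrow> real" where u: "orthogonal_family (a * ea) (a * ea) u (\<lambda>_. 1)"
    and w: "orthogonal_family (a * ea) (b * eb) w l"
    and M: "\<And>x y. x < a * ea \<Longrightarrow> y < b * eb \<Longrightarrow> M x y = (\<Sum>c<a * ea. u c x * w c y)"
    and G: "\<And>x x'. x < a * ea \<Longrightarrow> x' < a * ea \<Longrightarrow>
      (\<Sum>y<b * eb. M x y * cnj (M x' y)) = (\<Sum>c<a * ea. l c * (u c x * cnj (u c x')))"
    by (rule schmidt_decomposition[of "a * ea" "b * eb" M]) blast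
  have "\<tau> $$ (i * b + j, i' * b + j') =
        (\<Sum>k<ea. \<Sum>m<eb. (\<Sum>c<a * ea. u c (i * ea + k) * w c (j * eb + m)) *
           cnj (\<Sum>c<a * ea. u c (i' * ea + k) * w c (j' * eb + m)))"
    if "i < a" "j < b" "i' < a" "j' < b" for i j i' j'
    using pur that by (simp add: M[symmetric] mult_add_less M_def)
  then have "purification_spectrum a b \<tau> (a * ea) l"
    unfolding purification_spectrum_def using u w by blast
  moreover have dim: "dim_vec \<phi> = a * ea * (b * eb)" using pur by auto
  have "ptrace (a * ea) (b * eb) 1 (proj \<phi>) = spectral_mat (a * ea) l u"
  proof (rule eq_matI)
    fix x y assume "x < dim_row (spectral_mat (a * ea) l u)" "y < dim_col (spectral_mat (a * ea) l u)"
    then have xy: "x < a * ea" "y < a * ea" by auto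
    have "ptrace (a * ea) (b * eb) 1 (proj \<phi>) $$ (x, y) = (\<Sum>k<b * eb. M x k * cnj (M y k))"
      unfolding ptrace_last_index[OF xy] using xy
      by (intro sum.cong refl) (simp add: proj_def dim M_def mult_add_less)
    then show "ptrace (a * ea) (b * eb) 1 (proj \<phi>) $$ (x, y) = spectral_mat (a * ea) l u $$ (x, y)"
      using G xy by (simp add: spectral_mat_index)
  qed (simp_all add: ptrace_def)
  then have "vn_entropy (ptrace (a * ea) (b * eb) 1 (proj \<phi>)) = shannon (a * ea) l"
    by (simp add: vn_entropy_spectral_mat[OF u] shannon_def)
  ultimately show ?thesis by (rule that)
qed

lemma purification_spectrumD:
  assumes \<tau>: "\<tau> \<in> carrier_mat (a * b) (a * b)" and "purification_spectrum a b \<tau> D l"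
  obtains ea eb \<phi> where "purification a b \<tau> ea eb \<phi>"
    "vn_entropy (ptrace (a * ea) (b * eb) 1 (proj \<phi>)) = shannon D l"
proof -
  obtain ea eb u w where D: "D = a * ea" and u: "orthogonal_family D (a * ea) u (\<lambda>_. 1)"
    and w: "orthogonal_family D (b * eb) w l"
    and \<tau>_eq: "\<forall>i<a. \<forall>j<b. \<forall>i'<a. \<forall>j'<b. \<tau> $$ (i * b + j, i' * b + j') =
        (\<Sum>k<ea. \<Sum>m<eb. (\<Sum>c<D. u c (i * ea + k) * w c (j * eb + m)) *
           cnj (\<Sum>c<D. u c (i' * ea + k) * w c (j' * eb + m)))"
    using assms(2) unfolding purification_spectrum_def by blast
  define \<phi> where "\<phi> = vec (a * ea * (b * eb)) (\<lambda>z. \<Sum>c<D. u c (z div (b * eb)) * w c (z mod (b * eb)))"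
  have \<phi>: "\<phi> $ (x * (b * eb) + y) = (\<Sum>c<D. u c x * w c y)" if "x < a * ea" "y < b * eb" for x y
    using mult_add_less[OF that] that by (simp add: \<phi>_def div_mod_mult_add del: mod_mult_self3)
  have "purification a b \<tau> ea eb \<phi>"
    unfolding purification_iff[OF \<tau>] using \<tau>_eq by (auto simp: \<phi> mult_add_less) (simp add: \<phi>_def)
  moreover have "ptrace (a * ea) (b * eb) 1 (proj \<phi>) = spectral_mat D l u"
  proof (rule eq_matI)
    fix x y assume "x < dim_row (spectral_mat D l u)" "y < dim_col (spectral_mat D l u)"
    then have xy: "x < a * ea" "y < a * ea" by (auto simp: D)
    have dim: "dim_vec \<phi> = a * ea * (b * eb)" by (simp add: \<phi>_def)
    have "ptrace (a * ea) (b * eb) 1 (proj \<phi>) $$ (x, y) =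
       (\<Sum>k<b * eb. (\<Sum>c<D. u c x * w c k) * cnj (\<Sum>c<D. u c y * w c k))"
      unfolding ptrace_last_index[OF xy] using xy
      by (intro sum.cong refl) (simp add: proj_def dim \<phi> mult_add_less)
    also have "\<dots> = (\<Sum>k<b * eb. \<Sum>c<D. \<Sum>c'<D. u c x * cnj (u c' y) * (w c k * cnj (w c' k)))"
      unfolding cnj_sum sum_product by (simp add: mult_ac)
    also have "\<dots> = (\<Sum>c<D. \<Sum>c'<D. \<Sum>k<b * eb. u c x * cnj (u c' y) * (w c k * cnj (w c' k)))"
      unfolding sum.cartesian_product
      by (rule sum.reindex_bij_witness[of _ "\<lambda>(c, c', k). (k, c, c')" "\<lambda>(k, c, c'). (c, c', k)"]) auto
    also have "\<dots> = (\<Sum>c<D. \<Sum>c'<D. u c x * cnj (u c' y) * (\<Sum>k<b * eb. w c k * cnj (w c' k)))"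
      by (simp add: sum_distrib_left)
    also have "\<dots> = (\<Sum>c<D. \<Sum>c'<D. if c' = c then l c * (u c x * cnj (u c y)) else 0)"
      by (intro sum.cong refl) (auto simp: orthogonal_familyD[OF w])
    finally show "ptrace (a * ea) (b * eb) 1 (proj \<phi>) $$ (x, y) = spectral_mat D l u $$ (x, y)"
      using xy by (simp add: spectral_mat_index D)
  qed (simp_all add: ptrace_def D)
  then have "vn_entropy (ptrace (a * ea) (b * eb) 1 (proj \<phi>)) = shannon D l"
    using u by (simp add: vn_entropy_spectral_mat D shannon_def)
  ultimately show ?thesis by (rule that)
qed

lemma purification_spectrum_nonneg:
  assumes "purification_spectrum a b \<tau> D l" "c < D"
  shows "0 \<le> l c"
proof -
  obtain eb w where "orthogonal_family D (b * eb) w l"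
    using assms(1) unfolding purification_spectrum_def by blast
  from orthogonal_family_norm[OF this assms(2)] show ?thesis by (simp add: sum_nonneg)
qed

text \<open>Both sides are the squared norm of the purification.\<close>

lemma purification_spectrum_sum:
  assumes \<tau>: "\<tau> \<in> carrier_mat (a * b) (a * b)" and "purification_spectrum a b \<tau> D l"
  shows "complex_of_real (\<Sum>c<D. l c) = mtrace \<tau>"
proof -
  obtain ea eb u w where D: "D = a * ea" and u: "orthogonal_family D (a * ea) u (\<lambda>_. 1)"
    and w: "orthogonal_family D (b * eb) w l"
    and \<tau>_eq: "\<forall>i<a. \<forall>j<b. \<forall>i'<a. \<forall>j'<b. \<tau> $$ (i * b + j, i' * b + j') =
        (\<Sum>k<ea. \<Sum>m<eb. (\<Sum>c<D. u c (i * ea + k) * w c (j * eb + m)) *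
           cnj (\<Sum>c<D. u c (i' * ea + k) * w c (j' * eb + m)))"
    using assms(2) unfolding purification_spectrum_def by blast
  let ?\<phi> = "\<lambda>x y. \<Sum>c<D. complex_of_real 1 * (u c x * w c y)"
  have "mtrace \<tau> = (\<Sum>i<a. \<Sum>j<b. \<tau> $$ (i * b + j, i * b + j))"
    using \<tau> by (simp add: mtrace_def sum_lessThan_mult)
  also have "\<dots> = (\<Sum>i<a. \<Sum>j<b. \<Sum>k<ea. \<Sum>m<eb. complex_of_real ((cmod (?\<phi> (i * ea + k) (j * eb + m)))\<^sup>2))"
    using \<tau>_eq by (intro sum.cong refl) (simp only: complex_norm_square of_real_1 mult_1 lessThan_iff)
  also have "\<dots> = (\<Sum>i<a. \<Sum>k<ea. \<Sum>j<b. \<Sum>m<eb. complex_of_real ((cmod (?\<phi> (i * ea + k) (j * eb + m)))\<^sup>2))"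
    by (rule sum.cong[OF refl], rule sum.swap)
  also have "\<dots> = complex_of_real (\<Sum>x<a * ea. \<Sum>y<b * eb. (cmod (?\<phi> x y))\<^sup>2)"
    by (simp add: sum_lessThan_mult)
  also have "\<dots> = complex_of_real (\<Sum>c<D. l c)"
    using orthogonal_product_norm[OF u w, of "\<lambda>_. 1"] by (simp only: power_one mult_1)
  finally show ?thesis ..
qed

section \<open>Product and partial purifications\<close>

text \<open>The argument \<open>x\<close> is an index of \<open>A1 A2 E1 E2\<close>; the formulas
  extract from it the indices of \<open>A1 E1\<close> and \<open>A2 E2\<close>. This is the
  interleaving that turns a product of purifications into a purification of the product.\<close>

lemma sum_tensor:
  fixes F G :: "nat \<Rightarrow> complex"
  shows "(\<Sum>x<a1 * a2 * (e1 * e2). F (x div (e1 * e2) div a2 * e1 + x mod (e1 * e2) div e2) *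
      G (x div (e1 * e2) mod a2 * e2 + x mod (e1 * e2) mod e2)) = (\<Sum>y<a1 * e1. F y) * (\<Sum>y<a2 * e2. G y)"
proof -
  have "(\<Sum>x<a1 * a2 * (e1 * e2). F (x div (e1 * e2) div a2 * e1 + x mod (e1 * e2) div e2) *
      G (x div (e1 * e2) mod a2 * e2 + x mod (e1 * e2) mod e2)) =
    (\<Sum>i1<a1. \<Sum>i2<a2. \<Sum>k1<e1. \<Sum>k2<e2. F (i1 * e1 + k1) * G (i2 * e2 + k2))"
    unfolding sum_lessThan_mult[of _ "a1 * a2" "e1 * e2"] sum_lessThan_mult[of _ a1 a2] sum_lessThan_mult[of _ e1 e2]
    by (intro sum.cong refl) (simp add: mult_add_less)
  also have "\<dots> = (\<Sum>y<a1 * e1. F y) * (\<Sum>y<a2 * e2. G y)"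
    by (simp add: sum_lessThan_mult sum_product)
  finally show ?thesis .
qed

lemma orthogonal_family_tensor:
  assumes 1: "orthogonal_family D1 (a1 * e1) u1 l1" and 2: "orthogonal_family D2 (a2 * e2) u2 l2"
  shows "orthogonal_family (D1 * D2) (a1 * a2 * (e1 * e2))
    (\<lambda>c x. u1 (c div D2) (x div (e1 * e2) div a2 * e1 + x mod (e1 * e2) div e2) *
       u2 (c mod D2) (x div (e1 * e2) mod a2 * e2 + x mod (e1 * e2) mod e2))
    (\<lambda>c. l1 (c div D2) * l2 (c mod D2))"
  unfolding orthogonal_family_def
proof (intro allI impI)
  fix c c' assume c: "c < D1 * D2" "c' < D1 * D2"
  then have lt: "c div D2 < D1" "c' div D2 < D1" "c mod D2 < D2" "c' mod D2 < D2"
    by (auto simp: less_mult_imp_div_less intro!: mod_less_divisor Nat.gr0I)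
  have eq: "c = c' \<longleftrightarrow> c div D2 = c' div D2 \<and> c mod D2 = c' mod D2" by (metis div_mult_mod_eq)
  show "(\<Sum>x<a1 * a2 * (e1 * e2). u1 (c div D2) (x div (e1 * e2) div a2 * e1 + x mod (e1 * e2) div e2) *
       u2 (c mod D2) (x div (e1 * e2) mod a2 * e2 + x mod (e1 * e2) mod e2) *
     cnj (u1 (c' div D2) (x div (e1 * e2) div a2 * e1 + x mod (e1 * e2) div e2) *
       u2 (c' mod D2) (x div (e1 * e2) mod a2 * e2 + x mod (e1 * e2) mod e2))) =
     (if c = c' then complex_of_real (l1 (c div D2) * l2 (c mod D2)) else 0)"
    using sum_tensor[of "\<lambda>y. u1 (c div D2) y * cnj (u1 (c' div D2) y)" e1 e2 a2 "\<lambda>y. u2 (c mod D2) y * cnj (u2 (c' mod D2) y)" a1]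
      orthogonal_familyD[OF 1 lt(1,2)] orthogonal_familyD[OF 2 lt(3,4)]
    unfolding eq by (simp add: mult_ac)
qed

lemma purification_spectrum_tensor:
  assumes "purification_spectrum a1 b1 \<tau>1 D1 l1" "purification_spectrum a2 b2 \<tau>2 D2 l2"
  shows "purification_spectrum (a1 * a2) (b1 * b2) (tensor3 (a1, b1, 1) \<tau>1 (a2, b2, 1) \<tau>2) (D1 * D2)
    (\<lambda>c. l1 (c div D2) * l2 (c mod D2))"
proof -
  obtain ea1 eb1 u1 w1 where D1: "D1 = a1 * ea1" and u1: "orthogonal_family D1 (a1 * ea1) u1 (\<lambda>_. 1)"
    and w1: "orthogonal_family D1 (b1 * eb1) w1 l1"
    and \<tau>1: "\<forall>i<a1. \<forall>j<b1. \<forall>i'<a1. \<forall>j'<b1. \<tau>1 $$ (i * b1 + j, i' * b1 + j') =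
        (\<Sum>k<ea1. \<Sum>m<eb1. (\<Sum>c<D1. u1 c (i * ea1 + k) * w1 c (j * eb1 + m)) *
           cnj (\<Sum>c<D1. u1 c (i' * ea1 + k) * w1 c (j' * eb1 + m)))"
    using assms(1) unfolding purification_spectrum_def by blast
  obtain ea2 eb2 u2 w2 where D2: "D2 = a2 * ea2" and u2: "orthogonal_family D2 (a2 * ea2) u2 (\<lambda>_. 1)"
    and w2: "orthogonal_family D2 (b2 * eb2) w2 l2"
    and \<tau>2: "\<forall>i<a2. \<forall>j<b2. \<forall>i'<a2. \<forall>j'<b2. \<tau>2 $$ (i * b2 + j, i' * b2 + j') =
        (\<Sum>k<ea2. \<Sum>m<eb2. (\<Sum>c<D2. u2 c (i * ea2 + k) * w2 c (j * eb2 + m)) *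
           cnj (\<Sum>c<D2. u2 c (i' * ea2 + k) * w2 c (j' * eb2 + m)))"
    using assms(2) unfolding purification_spectrum_def by blast
  define u where "u c x = u1 (c div D2) (x div (ea1 * ea2) div a2 * ea1 + x mod (ea1 * ea2) div ea2) *
       u2 (c mod D2) (x div (ea1 * ea2) mod a2 * ea2 + x mod (ea1 * ea2) mod ea2)" for c x
  define w where "w c x = w1 (c div D2) (x div (eb1 * eb2) div b2 * eb1 + x mod (eb1 * eb2) div eb2) *
       w2 (c mod D2) (x div (eb1 * eb2) mod b2 * eb2 + x mod (eb1 * eb2) mod eb2)" for c x
  define f1 where "f1 i k j m = (\<Sum>c<D1. u1 c (i * ea1 + k) * w1 c (j * eb1 + m))" for i k j m
  define f2 where "f2 i k j m = (\<Sum>c<D2. u2 c (i * ea2 + k) * w2 c (j * eb2 + m))" for i k j m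
  have uw: "(\<Sum>c<D1 * D2. u c (i * (ea1 * ea2) + k) * w c (j * (eb1 * eb2) + m)) =
      f1 (i div a2) (k div ea2) (j div b2) (m div eb2) * f2 (i mod a2) (k mod ea2) (j mod b2) (m mod eb2)"
    if "k < ea1 * ea2" "m < eb1 * eb2" for i k j m
  proof -
    have "(\<Sum>c<D1 * D2. u c (i * (ea1 * ea2) + k) * w c (j * (eb1 * eb2) + m)) =
       (\<Sum>c1<D1. \<Sum>c2<D2. (u1 c1 (i div a2 * ea1 + k div ea2) * w1 c1 (j div b2 * eb1 + m div eb2)) *
          (u2 c2 (i mod a2 * ea2 + k mod ea2) * w2 c2 (j mod b2 * eb2 + m mod eb2)))"
      unfolding sum_lessThan_mult using that by (intro sum.cong refl) (simp add: u_def w_def div_mod_mult_add)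
    then show ?thesis by (simp add: f1_def f2_def sum_product)
  qed
  have "D1 * D2 = a1 * a2 * (ea1 * ea2)" by (simp add: D1 D2)
  moreover have "orthogonal_family (D1 * D2) (a1 * a2 * (ea1 * ea2)) u (\<lambda>_. 1)"
    using orthogonal_family_tensor[OF u1 u2] by (simp add: u_def[abs_def])
  moreover have "orthogonal_family (D1 * D2) (b1 * b2 * (eb1 * eb2)) w (\<lambda>c. l1 (c div D2) * l2 (c mod D2))"
    using orthogonal_family_tensor[OF w1 w2] by (simp add: w_def[abs_def])
  moreover have "tensor3 (a1, b1, 1) \<tau>1 (a2, b2, 1) \<tau>2 $$ (i * (b1 * b2) + j, i' * (b1 * b2) + j') =
     (\<Sum>k<ea1 * ea2. \<Sum>m<eb1 * eb2. (\<Sum>c<D1 * D2. u c (i * (ea1 * ea2) + k) * w c (j * (eb1 * eb2) + m)) *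
        cnj (\<Sum>c<D1 * D2. u c (i' * (ea1 * ea2) + k) * w c (j' * (eb1 * eb2) + m)))"
    if lt: "i < a1 * a2" "j < b1 * b2" "i' < a1 * a2" "j' < b1 * b2" for i j i' j'
  proof -
    have 0: "0 < a2" "0 < b2" using lt by (auto intro: Nat.gr0I)
    have "tensor3 (a1, b1, 1) \<tau>1 (a2, b2, 1) \<tau>2 $$ (i * (b1 * b2) + j, i' * (b1 * b2) + j') =
       \<tau>1 $$ (i div a2 * b1 + j div b2, i' div a2 * b1 + j' div b2) * \<tau>2 $$ (i mod a2 * b2 + j mod b2, i' mod a2 * b2 + j' mod b2)"
      using tensor3_index[of i a1 a2 j b1 b2 0 1 1 i' j' 0 \<tau>1 \<tau>2] lt by (simp add: ix3_def)
    also have "\<tau>1 $$ (i div a2 * b1 + j div b2, i' div a2 * b1 + j' div b2) =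
       (\<Sum>k<ea1. \<Sum>m<eb1. f1 (i div a2) k (j div b2) m * cnj (f1 (i' div a2) k (j' div b2) m))"
      unfolding f1_def using \<tau>1 lt by (simp add: less_mult_imp_div_less)
    also have "\<tau>2 $$ (i mod a2 * b2 + j mod b2, i' mod a2 * b2 + j' mod b2) =
       (\<Sum>k<ea2. \<Sum>m<eb2. f2 (i mod a2) k (j mod b2) m * cnj (f2 (i' mod a2) k (j' mod b2) m))"
      unfolding f2_def using \<tau>2 0 by simp
    also have "(\<Sum>k<ea1. \<Sum>m<eb1. f1 (i div a2) k (j div b2) m * cnj (f1 (i' div a2) k (j' div b2) m)) *
      (\<Sum>k<ea2. \<Sum>m<eb2. f2 (i mod a2) k (j mod b2) m * cnj (f2 (i' mod a2) k (j' mod b2) m)) =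
      (\<Sum>k1<ea1. \<Sum>k2<ea2. \<Sum>m1<eb1. \<Sum>m2<eb2. (f1 (i div a2) k1 (j div b2) m1 * cnj (f1 (i' div a2) k1 (j' div b2) m1)) *
         (f2 (i mod a2) k2 (j mod b2) m2 * cnj (f2 (i' mod a2) k2 (j' mod b2) m2)))"
      by (simp add: sum_product)
    also have "\<dots> = (\<Sum>k<ea1 * ea2. \<Sum>m<eb1 * eb2. (\<Sum>c<D1 * D2. u c (i * (ea1 * ea2) + k) * w c (j * (eb1 * eb2) + m)) *
        cnj (\<Sum>c<D1 * D2. u c (i' * (ea1 * ea2) + k) * w c (j' * (eb1 * eb2) + m)))"
      unfolding sum_lessThan_mult[of _ ea1 ea2] sum_lessThan_mult[of _ eb1 eb2]
      by (intro sum.cong refl) (simp add: uw mult_add_less)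
    finally show ?thesis .
  qed
  ultimately show ?thesis unfolding purification_spectrum_def by blast
qed

text \<open>In the index, \<open>A2\<close> stands between \<open>A1\<close> and \<open>E_A\<close>,
  so adjoining it to the latter changes neither the Schmidt vectors nor the spectrum. The sums over
  the adjoined systems trace out \<open>\<tau>2\<close>, leaving a factor
  \<open>mtrace \<tau>2\<close>.\<close>

lemma purification_spectrum_partial:
  assumes "purification_spectrum (a1 * a2) (b1 * b2) (tensor3 (a1, b1, 1) \<tau>1 (a2, b2, 1) \<tau>2) D l"
    and \<tau>2: "\<tau>2 \<in> carrier_mat (a2 * b2) (a2 * b2)" "mtrace \<tau>2 = 1"
  shows "purification_spectrum a1 b1 \<tau>1 D l"
proof -
  obtain ea eb u w where D: "D = a1 * a2 * ea" and u: "orthogonal_family D (a1 * a2 * ea) u (\<lambda>_. 1)"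
    and w: "orthogonal_family D (b1 * b2 * eb) w l"
    and \<tau>: "\<forall>i<a1 * a2. \<forall>j<b1 * b2. \<forall>i'<a1 * a2. \<forall>j'<b1 * b2.
       tensor3 (a1, b1, 1) \<tau>1 (a2, b2, 1) \<tau>2 $$ (i * (b1 * b2) + j, i' * (b1 * b2) + j') =
        (\<Sum>k<ea. \<Sum>m<eb. (\<Sum>c<D. u c (i * ea + k) * w c (j * eb + m)) *
           cnj (\<Sum>c<D. u c (i' * ea + k) * w c (j' * eb + m)))"
    using assms(1) unfolding purification_spectrum_def by blast
  have "\<tau>1 $$ (i * b1 + j, i' * b1 + j') =
     (\<Sum>k<a2 * ea. \<Sum>m<b2 * eb. (\<Sum>c<D. u c (i * (a2 * ea) + k) * w c (j * (b2 * eb) + m)) *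
           cnj (\<Sum>c<D. u c (i' * (a2 * ea) + k) * w c (j' * (b2 * eb) + m)))"
    if lt: "i < a1" "j < b1" "i' < a1" "j' < b1" for i j i' j'
  proof -
    have ix: "i * (y * e) + (x * e + k) = (i * y + x) * e + k" for i x y e k :: nat by (simp add: algebra_simps)
    have "(\<Sum>k<a2 * ea. \<Sum>m<b2 * eb. (\<Sum>c<D. u c (i * (a2 * ea) + k) * w c (j * (b2 * eb) + m)) *
           cnj (\<Sum>c<D. u c (i' * (a2 * ea) + k) * w c (j' * (b2 * eb) + m))) =
      (\<Sum>x<a2. \<Sum>k<ea. \<Sum>y<b2. \<Sum>m<eb. (\<Sum>c<D. u c ((i * a2 + x) * ea + k) * w c ((j * b2 + y) * eb + m)) *
           cnj (\<Sum>c<D. u c ((i' * a2 + x) * ea + k) * w c ((j' * b2 + y) * eb + m)))"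
      by (simp only: sum_lessThan_mult ix)
    also have "\<dots> = (\<Sum>x<a2. \<Sum>y<b2. \<Sum>k<ea. \<Sum>m<eb. (\<Sum>c<D. u c ((i * a2 + x) * ea + k) * w c ((j * b2 + y) * eb + m)) *
           cnj (\<Sum>c<D. u c ((i' * a2 + x) * ea + k) * w c ((j' * b2 + y) * eb + m)))"
      by (rule sum.cong[OF refl], rule sum.swap)
    also have "\<dots> = (\<Sum>x<a2. \<Sum>y<b2. tensor3 (a1, b1, 1) \<tau>1 (a2, b2, 1) \<tau>2 $$
        ((i * a2 + x) * (b1 * b2) + (j * b2 + y), (i' * a2 + x) * (b1 * b2) + (j' * b2 + y)))"
      using \<tau> lt by (simp add: mult_add_less)
    also have "\<dots> = (\<Sum>x<a2. \<Sum>y<b2. \<tau>1 $$ (i * b1 + j, i' * b1 + j') * \<tau>2 $$ (x * b2 + y, x * b2 + y))"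
    proof (intro sum.cong refl)
      fix x y assume "x \<in> {..<a2}" "y \<in> {..<b2}"
      then show "tensor3 (a1, b1, 1) \<tau>1 (a2, b2, 1) \<tau>2 $$ ((i * a2 + x) * (b1 * b2) + (j * b2 + y), (i' * a2 + x) * (b1 * b2) + (j' * b2 + y)) =
         \<tau>1 $$ (i * b1 + j, i' * b1 + j') * \<tau>2 $$ (x * b2 + y, x * b2 + y)"
        using tensor3_index[of "i * a2 + x" a1 a2 "j * b2 + y" b1 b2 0 1 1 "i' * a2 + x" "j' * b2 + y" 0 \<tau>1 \<tau>2] lt
        by (simp add: ix3_def mult_add_less)
    qed
    also have "\<dots> = \<tau>1 $$ (i * b1 + j, i' * b1 + j') * mtrace \<tau>2"
      using \<tau>2(1) by (simp add: mtrace_def sum_lessThan_mult sum_distrib_left)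
    finally show ?thesis using \<tau>2(2) by simp
  qed
  moreover have "D = a1 * (a2 * ea)" "orthogonal_family D (a1 * (a2 * ea)) u (\<lambda>_. 1)" "orthogonal_family D (b1 * (b2 * eb)) w l"
    using D u w by (simp_all add: mult.assoc)
  ultimately show ?thesis unfolding purification_spectrum_def by blast
qed

text \<open>The vector \<psi> itself is a purification: \<open>E_A\<close> is one-dimensional and
  Eve's system serves as \<open>E_B\<close>.\<close>

lemma purification_spectrum_exists:
  assumes "\<psi> \<in> carrier_vec (a * b * e)"
  obtains D l where "purification_spectrum a b (ptrace (a * b) e 1 (proj \<psi>)) D l"
proof -
  let ?\<tau> = "ptrace (a * b) e 1 (proj \<psi>)"
  have \<tau>: "?\<tau> \<in> carrier_mat (a * b) (a * b)" using ptrace_carrier[of "a * b" e 1] by simp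
  have "?\<tau> $$ (i * b + j, i' * b + j') = (\<Sum>k<1. \<Sum>m<e. \<psi> $ ((i * 1 + k) * (b * e) + (j * e + m)) * cnj (\<psi> $ ((i' * 1 + k) * (b * e) + (j' * e + m))))"
    if "i < a" "j < b" "i' < a" "j' < b" for i j i' j'
  proof -
    have lt: "i * b + j < a * b" "i' * b + j' < a * b" using that by (auto intro: mult_add_less)
    have "?\<tau> $$ (i * b + j, i' * b + j') = (\<Sum>m<e. \<psi> $ ((i * b + j) * e + m) * cnj (\<psi> $ ((i' * b + j') * e + m)))"
      unfolding ptrace_last_index[OF lt] using assms lt by (simp add: proj_def mult_add_less)
    then show ?thesis by (simp add: algebra_simps)
  qed
  then have "purification a b ?\<tau> 1 e \<psi>" using assms unfolding purification_iff[OF \<tau>] by (simp add: mult.assoc)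
  from purification_spectrumI[OF \<tau> this] show ?thesis using that by blast
qed

section \<open>Subadditivity of the entanglement of purification\<close>

lemma shannon_nonneg:
  assumes "\<And>c. c < D \<Longrightarrow> 0 \<le> l c" "(\<Sum>c<D. l c) = 1"
  shows "0 \<le> shannon D l"
proof -
  have "l c * log 2 (l c) \<le> 0" if "c < D" for c
  proof -
    have "l c \<le> (\<Sum>c<D. l c)" using that assms(1) by (intro member_le_sum) auto
    then have "l c \<le> 1" by (simp add: assms(2))
    then show ?thesis using assms(1)[OF that]
      by (cases "l c = 0") (auto intro!: mult_nonneg_nonpos simp: log_le_zero_cancel_iff)
  qed
  then have "(\<Sum>c<D. l c * log 2 (l c)) \<le> 0" by (intro sum_nonpos) auto
  then show ?thesis by (simp add: shannon_def)
qed

lemma sum_tensor_spectrum: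
  "(\<Sum>c<D1 * D2. l1 (c div D2) * l2 (c mod D2)) = (\<Sum>c<D1. l1 c) * (\<Sum>c<D2. l2 c)"
  for l1 l2 :: "nat \<Rightarrow> real"
  unfolding sum_lessThan_mult sum_product by (intro sum.cong refl) simp

lemma shannon_tensor:
  assumes 1: "\<And>c. c < D1 \<Longrightarrow> 0 \<le> l1 c" "(\<Sum>c<D1. l1 c) = 1"
    and 2: "\<And>c. c < D2 \<Longrightarrow> 0 \<le> l2 c" "(\<Sum>c<D2. l2 c) = 1"
  shows "shannon (D1 * D2) (\<lambda>c. l1 (c div D2) * l2 (c mod D2)) = shannon D1 l1 + shannon D2 l2"
proof -
  have "(\<Sum>c<D1 * D2. (l1 (c div D2) * l2 (c mod D2)) * log 2 (l1 (c div D2) * l2 (c mod D2))) =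
    (\<Sum>c1<D1. \<Sum>c2<D2. (l1 c1 * l2 c2) * log 2 (l1 c1 * l2 c2))"
    unfolding sum_lessThan_mult by (intro sum.cong refl) simp
  also have "\<dots> = (\<Sum>c1<D1. \<Sum>c2<D2. (l1 c1 * log 2 (l1 c1)) * l2 c2 + l1 c1 * (l2 c2 * log 2 (l2 c2)))"
  proof (intro sum.cong refl)
    fix c1 c2 assume "c1 \<in> {..<D1}" "c2 \<in> {..<D2}"
    then have "0 \<le> l1 c1" "0 \<le> l2 c2" using assms by auto
    then show "(l1 c1 * l2 c2) * log 2 (l1 c1 * l2 c2) =
        (l1 c1 * log 2 (l1 c1)) * l2 c2 + l1 c1 * (l2 c2 * log 2 (l2 c2))"
      by (cases "l1 c1 = 0"; cases "l2 c2 = 0") (simp_all add: log_mult algebra_simps)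
  qed
  also have "\<dots> = (\<Sum>c<D1. l1 c * log 2 (l1 c)) * (\<Sum>c<D2. l2 c) + (\<Sum>c<D1. l1 c) * (\<Sum>c<D2. l2 c * log 2 (l2 c))"
    by (simp only: sum.distrib sum_product)
  finally show ?thesis using 1 2 by (simp add: shannon_def)
qed

text \<open>From here on a purification is known only through its spectrum, for which tensor
  products and the transfer of spare copies are already available.\<close>

lemma E_P_eq_Inf_shannon:
  assumes "\<tau> \<in> carrier_mat (a * b) (a * b)"
  shows "E_P a b \<tau> = Inf {shannon D l | D l. purification_spectrum a b \<tau> D l}"
proof -
  have "{vn_entropy (ptrace (a * ea) (b * eb) 1 (proj \<phi>)) | ea eb \<phi>. purification a b \<tau> ea eb \<phi>} =
      {shannon D l | D l. purification_spectrum a b \<tau> D l}"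
  proof (intro equalityI subsetI)
    fix x assume "x \<in> {vn_entropy (ptrace (a * ea) (b * eb) 1 (proj \<phi>)) | ea eb \<phi>. purification a b \<tau> ea eb \<phi>}"
    then obtain ea eb \<phi> where x: "x = vn_entropy (ptrace (a * ea) (b * eb) 1 (proj \<phi>))" "purification a b \<tau> ea eb \<phi>"
      by blast
    obtain l where "purification_spectrum a b \<tau> (a * ea) l" "x = shannon (a * ea) l"
      unfolding x(1) by (rule purification_spectrumI[OF assms x(2)])
    then show "x \<in> {shannon D l | D l. purification_spectrum a b \<tau> D l}" by blast
  next
    fix x assume "x \<in> {shannon D l | D l. purification_spectrum a b \<tau> D l}"
    then obtain D l where x: "x = shannon D l" "purification_spectrum a b \<tau> D l" by blast
    obtain ea eb \<phi> where "purification a b \<tau> ea eb \<phi>" "vn_entropy (ptrace (a * ea) (b * eb) 1 (proj \<phi>)) = x"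
      unfolding x(1) by (rule purification_spectrumD[OF assms x(2)])
    then show "x \<in> {vn_entropy (ptrace (a * ea) (b * eb) 1 (proj \<phi>)) | ea eb \<phi>. purification a b \<tau> ea eb \<phi>}" by blast
  qed
  then show ?thesis by (simp add: E_P_def)
qed

text \<open>Positivity is expressed through the existence of a purification, which makes the set
  under the infimum in \<open>E_P\<close> nonempty. The trace condition turns the spectra into
  probability distributions, so that 0 is a lower bound.\<close>

definition normalized_state :: "nat \<Rightarrow> nat \<Rightarrow> complex mat \<Rightarrow> bool" where
  "normalized_state a b \<tau> \<longleftrightarrow> \<tau> \<in> carrier_mat (a * b) (a * b) \<and> mtrace \<tau> = 1 \<and>
     (\<exists>D l. purification_spectrum a b \<tau> D l)"

lemma normalized_state_spectrum:
  assumes "normalized_state a b \<tau>" "purification_spectrum a b \<tau> D l"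
  shows "(\<Sum>c<D. l c) = 1" "0 \<le> shannon D l"
proof -
  have "complex_of_real (\<Sum>c<D. l c) = complex_of_real 1"
    using purification_spectrum_sum[OF _ assms(2)] assms(1) by (simp add: normalized_state_def)
  then show s: "(\<Sum>c<D. l c) = 1" by (simp only: of_real_eq_iff)
  show "0 \<le> shannon D l" by (rule shannon_nonneg[OF purification_spectrum_nonneg[OF assms(2)] s])
qed

lemma E_P_nonneg:
  assumes "normalized_state a b \<tau>"
  shows "0 \<le> E_P a b \<tau>"
  using assms normalized_state_spectrum[OF assms] unfolding normalized_state_def
  by (auto simp: E_P_eq_Inf_shannon intro!: cInf_greatest)

lemma E_P_le:
  assumes "normalized_state a b \<tau>" "purification_spectrum a b \<tau> D l"
  shows "E_P a b \<tau> \<le> shannon D l"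
proof -
  have "bdd_below {shannon D l | D l. purification_spectrum a b \<tau> D l}"
    using normalized_state_spectrum(2)[OF assms(1)] by (intro bdd_belowI[of _ 0]) auto
  then show ?thesis using assms unfolding normalized_state_def
    by (auto simp: E_P_eq_Inf_shannon intro!: cInf_lower)
qed

lemma E_P_less:
  assumes "normalized_state a b \<tau>" "E_P a b \<tau> < t"
  obtains D l where "purification_spectrum a b \<tau> D l" "shannon D l < t"
proof -
  have "{shannon D l | D l. purification_spectrum a b \<tau> D l} \<noteq> {}"
    using assms(1) by (auto simp: normalized_state_def)
  moreover have "Inf {shannon D l | D l. purification_spectrum a b \<tau> D l} < t"
    using assms by (simp add: normalized_state_def E_P_eq_Inf_shannon)
  ultimately have "\<exists>x\<in>{shannon D l | D l. purification_spectrum a b \<tau> D l}. x < t"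
    by (rule cInf_lessD)
  then show ?thesis using that by blast
qed

lemma normalized_state_tensor:
  assumes 1: "normalized_state a1 b1 \<tau>1" and 2: "normalized_state a2 b2 \<tau>2"
  shows "normalized_state (a1 * a2) (b1 * b2) (tensor3 (a1, b1, 1) \<tau>1 (a2, b2, 1) \<tau>2)"
proof -
  let ?\<tau> = "tensor3 (a1, b1, 1) \<tau>1 (a2, b2, 1) \<tau>2"
  obtain D1 l1 where l1: "purification_spectrum a1 b1 \<tau>1 D1 l1" using 1 by (auto simp: normalized_state_def)
  obtain D2 l2 where l2: "purification_spectrum a2 b2 \<tau>2 D2 l2" using 2 by (auto simp: normalized_state_def)
  have c: "?\<tau> \<in> carrier_mat (a1 * a2 * (b1 * b2)) (a1 * a2 * (b1 * b2))"
    using tensor3_carrier[of a1 b1 1 \<tau>1 a2 b2 1 \<tau>2] by simp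
  note t = purification_spectrum_tensor[OF l1 l2]
  have "mtrace ?\<tau> = 1"
    using purification_spectrum_sum[OF c t]
    by (simp add: sum_tensor_spectrum normalized_state_spectrum(1)[OF 1 l1] normalized_state_spectrum(1)[OF 2 l2])
  then show ?thesis using c t by (auto simp: normalized_state_def)
qed

lemma E_P_tensor_le:
  assumes 1: "normalized_state a1 b1 \<tau>1" and 2: "normalized_state a2 b2 \<tau>2"
  shows "E_P (a1 * a2) (b1 * b2) (tensor3 (a1, b1, 1) \<tau>1 (a2, b2, 1) \<tau>2) \<le> E_P a1 b1 \<tau>1 + E_P a2 b2 \<tau>2"
proof (rule field_le_epsilon)
  fix \<epsilon> :: real assume "0 < \<epsilon>"
  then have "E_P a1 b1 \<tau>1 < E_P a1 b1 \<tau>1 + \<epsilon> / 2" "E_P a2 b2 \<tau>2 < E_P a2 b2 \<tau>2 + \<epsilon> / 2" by auto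
  then obtain D1 l1 D2 l2 where l1: "purification_spectrum a1 b1 \<tau>1 D1 l1" "shannon D1 l1 < E_P a1 b1 \<tau>1 + \<epsilon> / 2"
    and l2: "purification_spectrum a2 b2 \<tau>2 D2 l2" "shannon D2 l2 < E_P a2 b2 \<tau>2 + \<epsilon> / 2"
    using E_P_less[OF 1] E_P_less[OF 2] by metis
  have "E_P (a1 * a2) (b1 * b2) (tensor3 (a1, b1, 1) \<tau>1 (a2, b2, 1) \<tau>2) \<le>
      shannon (D1 * D2) (\<lambda>c. l1 (c div D2) * l2 (c mod D2))"
    by (rule E_P_le[OF normalized_state_tensor[OF 1 2] purification_spectrum_tensor[OF l1(1) l2(1)]])
  also have "\<dots> = shannon D1 l1 + shannon D2 l2"
    by (intro shannon_tensor purification_spectrum_nonneg[OF l1(1)] purification_spectrum_nonneg[OF l2(1)]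
        normalized_state_spectrum(1)[OF 1 l1(1)] normalized_state_spectrum(1)[OF 2 l2(1)])
  finally show "E_P (a1 * a2) (b1 * b2) (tensor3 (a1, b1, 1) \<tau>1 (a2, b2, 1) \<tau>2) \<le> E_P a1 b1 \<tau>1 + E_P a2 b2 \<tau>2 + \<epsilon>"
    using l1(2) l2(2) by linarith
qed

text \<open>Fekete's lemma: the limit is the infimum of the quotients over positive
  \<open>n\<close>. Near-optimality at one \<open>m\<close> extends to all large \<open>n\<close> by
  division with remainder.\<close>

lemma subadditive_convergent:
  fixes f :: "nat \<Rightarrow> real"
  assumes sub: "\<And>m n. f (m + n) \<le> f m + f n" and nonneg: "\<And>n. 0 \<le> f n"
  shows "convergent (\<lambda>n. f n / real n)"
proof -
  define c where "c = Inf ((\<lambda>n. f n / real n) ` {1..})"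
  have bdd: "bdd_below ((\<lambda>n. f n / real n) ` {1..})"
    by (intro bdd_belowI[of _ 0]) (use nonneg in auto)
  have lower: "c \<le> f n / real n" if "1 \<le> n" for n
    unfolding c_def using that by (intro cInf_lower bdd) auto
  have "(\<lambda>n. f n / real n) \<longlonglongrightarrow> c"
  proof (rule LIMSEQ_I)
    fix r :: real assume r: "0 < r"
    have "\<exists>x\<in>(\<lambda>n. f n / real n) ` {1..}. x < c + r / 2"
    proof (rule cInf_lessD)
      show "Inf ((\<lambda>n. f n / real n) ` {1..}) < c + r / 2" using r unfolding c_def by linarith
    qed auto
    then obtain m where m: "1 \<le> m" "f m / real m < c + r / 2" by auto
    \<comment> \<open>By nonnegativity, a single bound for the contributions of all possible
      remainders.\<close>
    define C where "C = (\<Sum>i<m. f i)"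
    have mult: "f (q * m + i) \<le> real q * f m + f i" for q i
    proof (induction q)
      case (Suc q)
      have "f (Suc q * m + i) \<le> f m + f (q * m + i)" using sub[of m "q * m + i"] by (simp add: add.assoc)
      then show ?case using Suc by (simp add: algebra_simps)
    qed simp
    have upper: "f n \<le> real n * (f m / real m) + C" for n
    proof -
      have "f n \<le> real (n div m) * f m + f (n mod m)" using mult[of "n div m" "n mod m"] by simp
      also have "f (n mod m) \<le> C" unfolding C_def using m nonneg by (intro member_le_sum) auto
      also have "real (n div m) * f m \<le> real n / real m * f m"
        by (intro mult_right_mono nonneg of_nat_div_le_of_nat)
      finally show ?thesis by simp
    qed
    obtain N :: nat where N: "2 * C / r < real N" using reals_Archimedean2 by blast
    show "\<exists>no. \<forall>n\<ge>no. norm (f n / real n - c) < r"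
    proof (intro exI[of _ "max 1 N"] allI impI)
      fix n assume n: "max 1 N \<le> n"
      then have n1: "1 \<le> n" "0 < real n" by auto
      have "2 * C / r < real n" using n N by linarith
      then have "C / real n < r / 2" using r n1 by (simp add: field_simps)
      moreover have "f n / real n \<le> f m / real m + C / real n"
        using upper[of n] n1 by (simp add: field_simps)
      ultimately have "f n / real n < c + r" using m(2) by linarith
      then show "norm (f n / real n - c) < r" using lower[OF n1(1)] by simp
    qed
  qed
  then show ?thesis by (rule convergentI)
qed

section \<open>Typical part of a product spectrum\<close>

text \<open>\<open>c\<close> is a word of \<open>k\<close> digits in base \<open>D\<close>, and its
  weight is the product of the weights of its digits: the distribution of \<open>k\<close>
  independent draws from \<open>l\<close>.\<close>

primrec spectrum_pow :: "nat \<Rightarrow> (nat \<Rightarrow> real) \<Rightarrow> nat \<Rightarrow> nat \<Rightarrow> real" where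
  "spectrum_pow D l 0 = (\<lambda>_. 1)"
| "spectrum_pow D l (Suc k) = (\<lambda>c. spectrum_pow D l k (c div D) * l (c mod D))"

lemma purification_spectrum_pow:
  assumes "purification_spectrum a b \<tau> D l"
  shows "purification_spectrum (a ^ k) (b ^ k) (tensor_pow (a, b, 1) \<tau> k) (D ^ k) (spectrum_pow D l k)"
proof (induction k)
  case 0
  show ?case unfolding purification_spectrum_def
    by (rule exI[of _ 1], rule exI[of _ 1], rule exI[of _ "\<lambda>_ _. 1"], rule exI[of _ "\<lambda>_ _. 1"])
      (simp add: orthogonal_family_def)
next
  case (Suc k)
  show ?case using purification_spectrum_tensor[OF Suc assms]
    by (simp add: dims_pow_eq power_Suc2 del: power_Suc)
qed

lemma spectrum_pow_nonneg:
  assumes "\<And>c. c < D \<Longrightarrow> 0 \<le> l c"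
  shows "c < D ^ k \<Longrightarrow> 0 \<le> spectrum_pow D l k c"
proof (induction k arbitrary: c)
  case (Suc k)
  then have "c < D ^ k * D" by (simp add: mult.commute)
  then have "c div D < D ^ k" "c mod D < D"
    by (auto simp: less_mult_imp_div_less intro!: mod_less_divisor Nat.gr0I)
  then show ?case using Suc assms by simp
qed simp

lemma sum_spectrum_pow: "(\<Sum>c<D ^ k. spectrum_pow D l k c) = (\<Sum>c<D. l c) ^ k"
proof (induction k)
  case (Suc k)
  then show ?case using sum_tensor_spectrum[where ?D1.0 = "D ^ k" and ?D2.0 = D]
    by (simp add: power_Suc2 del: power_Suc)
qed simp

text \<open>The summand is, for positive weight \<open>x\<close>, the power
  \<open>x powr (1 - s)\<close> times \<open>exp (- s * k * R)\<close>, hence multiplicative over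
  independent draws. At weight 0 the prefactor cancels the default value of
  \<open>ln\<close>.\<close>

lemma moment_spectrum_pow:
  assumes "\<And>c. c < D \<Longrightarrow> 0 \<le> l c"
  shows "(\<Sum>c<D ^ k. spectrum_pow D l k c * exp (s * (- ln (spectrum_pow D l k c) - real k * R))) =
    (\<Sum>c<D. l c * exp (s * (- ln (l c) - R))) ^ k"
proof (induction k)
  case (Suc k)
  let ?F = "\<lambda>x k. x * exp (s * (- ln x - real k * R))"
  have F: "?F (x * y) (Suc k) = ?F x k * ?F y 1" if "0 \<le> x" "0 \<le> y" for x y
    using that by (cases "x = 0"; cases "y = 0") (simp_all add: ln_mult exp_add[symmetric] algebra_simps)
  have "(\<Sum>c<D ^ Suc k. ?F (spectrum_pow D l (Suc k) c) (Suc k)) =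
      (\<Sum>c1<D ^ k. \<Sum>c2<D. ?F (spectrum_pow D l k c1 * l c2) (Suc k))"
    unfolding power_Suc2 sum_lessThan_mult by (intro sum.cong refl) simp
  also have "\<dots> = (\<Sum>c1<D ^ k. \<Sum>c2<D. ?F (spectrum_pow D l k c1) k * ?F (l c2) 1)"
    by (intro sum.cong refl F spectrum_pow_nonneg assms) auto
  also have "\<dots> = (\<Sum>c<D ^ k. ?F (spectrum_pow D l k c) k) * (\<Sum>c<D. ?F (l c) 1)"
    by (simp only: sum_product)
  finally show ?case unfolding Suc by (simp add: mult.commute)
qed simp

text \<open>The derivative of the moment at \<open>s = 0\<close> is the difference of the entropy and \<open>R\<close>, up to \<open>ln 2\<close>.\<close>

lemma moment_less_one:
  assumes "(\<Sum>c<D. l c) = 1" "shannon D l < R"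
  obtains s where "0 < s" "(\<Sum>c<D. l c * exp (s * (- ln (l c) - R * ln 2))) < 1"
proof -
  let ?g = "\<lambda>s. \<Sum>c<D. l c * exp (s * (- ln (l c) - R * ln 2))"
  have "(?g has_real_derivative (\<Sum>c<D. l c * (- ln (l c) - R * ln 2))) (at 0)"
    by (auto intro!: derivative_eq_intros sum.cong)
  moreover have "(\<Sum>c<D. l c * (- ln (l c) - R * ln 2)) < 0"
  proof -
    have "(\<Sum>c<D. l c * (- ln (l c) - R * ln 2)) = - (\<Sum>c<D. l c * ln (l c)) - (\<Sum>c<D. l c) * (R * ln 2)"
      by (simp add: right_diff_distrib sum_subtractf sum_negf sum_distrib_right)
    also have "(\<Sum>c<D. l c * ln (l c)) = - shannon D l * ln 2"
      by (simp add: shannon_def log_def sum_distrib_right)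
    finally show ?thesis using assms by simp
  qed
  \<comment> \<open>At \<open>s = 0\<close> the moment is the total weight 1, so the negative
    derivative brings it below 1 at small positive \<open>s\<close>.\<close>
  ultimately obtain d where d: "0 < d" "\<And>h. 0 < h \<Longrightarrow> h < d \<Longrightarrow> ?g (0 + h) < ?g 0"
    using DERIV_neg_dec_right[of ?g _ 0] by blast
  then have "?g (d / 2) < 1" using d(2)[of "d / 2"] assms(1) by simp
  then show ?thesis using that[of "d / 2"] d(1) by simp
qed

text \<open>Every element of \<open>S\<close> has weight at least \<open>2 powr (- k * R)\<close>,
  so total weight 1 bounds their number. Outside \<open>S\<close> the exponential factor is at least
  1, so Markov's inequality for the moment bounds the lost weight; together with multiplicativity
  this is Chernoff's bound.\<close>

lemma spectrum_pow_typical: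
  fixes R :: real and k :: nat
  assumes nonneg: "\<And>c. c < D \<Longrightarrow> 0 \<le> l c" and "(\<Sum>c<D. l c) = 1" and s: "0 < s"
  defines "\<theta> \<equiv> (\<Sum>c<D. l c * exp (s * (- ln (l c) - R * ln 2)))"
    and "S \<equiv> {c. c < D ^ k \<and> exp (- (real k * (R * ln 2))) \<le> spectrum_pow D l k c}"
  shows "real (card S) \<le> 2 powr (real k * R)" "1 - \<theta> ^ k \<le> (\<Sum>c\<in>S. spectrum_pow D l k c)"
proof -
  let ?p = "spectrum_pow D l k" and ?x = "real k * (R * ln 2)"
  have p: "0 \<le> ?p c" if "c < D ^ k" for c using spectrum_pow_nonneg[OF nonneg that] .
  have sum: "(\<Sum>c<D ^ k. ?p c) = 1" using assms(2) by (simp add: sum_spectrum_pow)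
  have S: "finite S" "S \<subseteq> {..<D ^ k}" by (auto simp: S_def)
  have "real (card S) * exp (- ?x) \<le> (\<Sum>c\<in>S. ?p c)"
    using sum_bounded_below[of S "exp (- ?x)" ?p] by (simp add: S_def)
  also have "\<dots> \<le> (\<Sum>c<D ^ k. ?p c)" using S p by (intro sum_mono2) auto
  finally have "real (card S) \<le> exp ?x" using sum by (simp add: exp_minus field_simps)
  then show "real (card S) \<le> 2 powr (real k * R)" by (simp add: powr_def mult.assoc)
  have "(\<Sum>c\<in>{..<D ^ k} - S. ?p c) \<le> (\<Sum>c\<in>{..<D ^ k} - S. ?p c * exp (s * (- ln (?p c) - ?x)))"
  proof (rule sum_mono)
    fix c assume c: "c \<in> {..<D ^ k} - S"
    show "?p c \<le> ?p c * exp (s * (- ln (?p c) - ?x))"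
    proof (cases "?p c = 0")
      case False
      then have pos: "0 < ?p c" using p[of c] c by simp
      have "?p c < exp (- ?x)" using c by (auto simp: S_def)
      then have "ln (?p c) < ln (exp (- ?x))" using pos by (subst ln_less_cancel_iff) auto
      then have "ln (?p c) < - ?x" by simp
      then have "0 \<le> s * (- ln (?p c) - ?x)" using s by simp
      then have "1 \<le> exp (s * (- ln (?p c) - ?x))" by simp
      then show ?thesis using pos by (simp add: mult_le_cancel_left1)
    qed simp
  qed
  also have "\<dots> \<le> (\<Sum>c<D ^ k. ?p c * exp (s * (- ln (?p c) - ?x)))"
    using p by (intro sum_mono2) auto
  also have "\<dots> = \<theta> ^ k" unfolding \<theta>_def by (rule moment_spectrum_pow[OF nonneg])
  finally have "(\<Sum>c\<in>{..<D ^ k} - S. ?p c) \<le> \<theta> ^ k" .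
  moreover have "(\<Sum>c<D ^ k. ?p c) = (\<Sum>c\<in>{..<D ^ k} - S. ?p c) + (\<Sum>c\<in>S. ?p c)"
    using S by (intro sum.subset_diff) auto
  ultimately show "1 - \<theta> ^ k \<le> (\<Sum>c\<in>S. ?p c)" using sum by simp
qed

section \<open>The dilution rate\<close>

text \<open>Reconciles two orders of the local factors: \<open>E_P\<close> puts \<open>A\<close>
  before \<open>E_A\<close>, whereas the protocol needs the part to be sent in front.
  \<open>swap\<close> transposes them, which permutes coordinates and preserves
  orthogonality.\<close>

lemma convertible_of_spectrum:
  assumes \<psi>: "\<psi> \<in> carrier_vec (a * b * e)" and "0 < e" "0 < d"
    and "purification_spectrum a b (ptrace (a * b) e 1 (proj \<psi>)) D l" and l: "(\<Sum>c<D. l c) = 1"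
    and S: "S \<subseteq> {..<D}" "card S \<le> d" "\<And>c. c \<in> S \<Longrightarrow> 0 < l c" "0 < (\<Sum>c\<in>S. l c)"
  shows "convertible (2 * sqrt (2 * (1 - (\<Sum>c\<in>S. l c)))) (d, d, 1) (max_entangled d) (a, b, e) (proj \<psi>)"
proof -
  obtain ea eb u w where u: "orthogonal_family D (a * ea) u (\<lambda>_. 1)"
    and w: "orthogonal_family D (b * eb) w l"
    and \<tau>: "\<forall>i<a. \<forall>j<b. \<forall>i'<a. \<forall>j'<b. ptrace (a * b) e 1 (proj \<psi>) $$ (i * b + j, i' * b + j') =
        (\<Sum>k<ea. \<Sum>m<eb. (\<Sum>c<D. u c (i * ea + k) * w c (j * eb + m)) *
           cnj (\<Sum>c<D. u c (i' * ea + k) * w c (j' * eb + m)))"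
    using assms(4) unfolding purification_spectrum_def by blast
  define swap where "swap x n m = x mod n * m + x div n" for x n m :: nat
  have swap: "swap (k * n + i) n m = i * m + k" if "i < n" for i k n m
    using that by (simp add: swap_def)
  have orth: "orthogonal_family D (m * n) (\<lambda>c x. f c (swap x n m)) l'" if f: "orthogonal_family D (n * m) f l'" for n m f l'
  proof -
    have "(\<Sum>x<m * n. g (swap x n m)) = (\<Sum>x<n * m. g x)" for g :: "nat \<Rightarrow> complex"
    proof -
      have "(\<Sum>x<m * n. g (swap x n m)) = (\<Sum>k<m. \<Sum>i<n. g (i * m + k))"
        unfolding sum_lessThan_mult by (intro sum.cong refl) (simp add: swap)
      then show ?thesis by (subst (asm) sum.swap) (simp add: sum_lessThan_mult)
    qed
    from this[of "\<lambda>x. f _ x * cnj (f _ x)"] show ?thesis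
      using f by (simp add: orthogonal_family_def)
  qed
  have "(\<Sum>p<e. \<psi> $ ix3 b e i j p * cnj (\<psi> $ ix3 b e i' j' p)) =
      (\<Sum>m<eb. \<Sum>k<ea. (\<Sum>c<D. u c (swap (k * a + i) a ea) * w c (swap (m * b + j) b eb)) *
        cnj (\<Sum>c<D. u c (swap (k * a + i') a ea) * w c (swap (m * b + j') b eb)))"
    if lt: "i < a" "j < b" "i' < a" "j' < b" for i j i' j'
  proof -
    have lt': "i * b + j < a * b" "i' * b + j' < a * b" using lt by (auto intro: mult_add_less)
    have "(\<Sum>p<e. \<psi> $ ix3 b e i j p * cnj (\<psi> $ ix3 b e i' j' p)) = ptrace (a * b) e 1 (proj \<psi>) $$ (i * b + j, i' * b + j')"
      unfolding ptrace_last_index[OF lt'] using \<psi> lt'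
      by (intro sum.cong refl) (simp add: proj_def ix3_def mult_add_less)
    also have "\<dots> = (\<Sum>k<ea. \<Sum>m<eb. (\<Sum>c<D. u c (i * ea + k) * w c (j * eb + m)) *
           cnj (\<Sum>c<D. u c (i' * ea + k) * w c (j' * eb + m)))"
      using \<tau> lt by blast
    finally show ?thesis using lt by (subst sum.swap) (simp add: swap)
  qed
  from convertible_of_purification[OF \<psi> \<open>0 < e\<close> \<open>0 < d\<close> orth[OF u] orth[OF w] l this S]
  show ?thesis by blast
qed

lemma convertible_mono:
  "convertible \<delta> s1 \<rho>1 s2 \<rho>2 \<Longrightarrow> \<delta> \<le> \<epsilon> \<Longrightarrow> convertible \<epsilon> s1 \<rho>1 s2 \<rho>2"
  unfolding convertible_def by (cases s2) (fastforce intro: order_trans)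

text \<open>A strict inequality for one block suffices, because the slack is used twice: for the
  exponential concentration and for rounding \<open>n\<close> up to whole blocks.\<close>

lemma achievable_dilution_of_block:
  fixes \<psi> :: "complex vec"
  assumes \<psi>: "\<psi> \<in> carrier_vec (a * b * e)" and "0 < e"
    and norm: "\<And>n. normalized_state (a ^ n) (b ^ n) (tensor_pow (a, b, 1) (ptrace (a * b) e 1 (proj \<psi>)) n)"
    and m: "0 < m" and EP: "E_P (a ^ m) (b ^ m) (tensor_pow (a, b, 1) (ptrace (a * b) e 1 (proj \<psi>)) m) < real m * R"
  shows "achievable_dilution (a, b, e) (proj \<psi>) R"
proof -
  let ?T = "tensor_pow (a, b, 1) (ptrace (a * b) e 1 (proj \<psi>))"
  obtain D l where l: "purification_spectrum (a ^ m) (b ^ m) (?T m) D l" and H: "shannon D l < real m * R"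
    using E_P_less[OF norm EP] by blast
  note l_sum = normalized_state_spectrum(1)[OF norm l] and l_nonneg = purification_spectrum_nonneg[OF l]
  \<comment> \<open>\<open>R1\<close> is a rate for a block of \<open>m\<close> copies. The gap
    below it makes the discarded weight decay, and the gap above it absorbs the additional
    block.\<close>
  obtain R1 where R1: "shannon D l < R1" "R1 < real m * R" using dense[OF H] by blast
  have R1pos: "0 < R1" using normalized_state_spectrum(2)[OF norm l] R1(1) by linarith
  have "0 < real m * R" using R1pos R1(2) by linarith
  then have R: "0 < R" using m by (simp add: zero_less_mult_iff)
  obtain s where s: "0 < s" "(\<Sum>c<D. l c * exp (s * (- ln (l c) - R1 * ln 2))) < 1"
    using moment_less_one[OF l_sum R1(1)] by blast
  define \<theta> where "\<theta> = (\<Sum>c<D. l c * exp (s * (- ln (l c) - R1 * ln 2)))"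
  have \<theta>: "0 \<le> \<theta>" "\<theta> < 1" using s(2) l_nonneg by (auto simp: \<theta>_def intro!: sum_nonneg)
  have "\<forall>\<^sub>F n in sequentially. convertible \<epsilon> (dims_pow unit_dims (nat \<lceil>real n * R\<rceil>))
      (tensor_pow unit_dims unit_state (nat \<lceil>real n * R\<rceil>)) (dims_pow (a, b, e) n) (tensor_pow (a, b, e) (proj \<psi>) n)"
    if \<epsilon>: "0 < \<epsilon>" for \<epsilon>
  proof -
    \<comment> \<open>The constant 8 makes \<open>2 * sqrt (2 * \<theta> ^ k)\<close> at most
      \<epsilon>.\<close>
    obtain K where K: "\<theta> ^ K < \<epsilon>\<^sup>2 / 8" using real_arch_pow_inv[of "\<epsilon>\<^sup>2 / 8" \<theta>] \<epsilon> \<theta> by auto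
    \<comment> \<open>Solves \<open>(n / m + 1) * R1 < n * R\<close> for \<open>n\<close>, where the
      left factor bounds the number of blocks.\<close>
    obtain n0 :: nat where n0: "real m * R1 / (real m * R - R1) < real n0" using reals_Archimedean2 by blast
    show ?thesis
    proof (rule eventually_sequentiallyI[of "max n0 (K * m)"])
      fix n assume n: "max n0 (K * m) \<le> n"
      \<comment> \<open>The added 1 guarantees at least \<open>n\<close> copies even if
        \<open>m\<close> does not divide \<open>n\<close>; the \<open>x\<close> surplus copies are
        dealt with below.\<close>
      define k where "k = n div m + 1"
      define N where "N = nat \<lceil>real n * R\<rceil>"
      have "K \<le> k" using n m by (simp add: k_def le_SucI less_eq_div_iff_mult_less_eq)
      then have "\<theta> ^ k \<le> \<theta> ^ K" using \<theta> by (intro power_decreasing) auto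
      then have \<theta>k: "\<theta> ^ k \<le> \<epsilon>\<^sup>2 / 8" using K by linarith
      have "0 < k" by (simp add: k_def)
      then have \<theta>k1: "\<theta> ^ k < 1" using power_strict_mono[of \<theta> 1 k] \<theta> by simp
      define S where "S = {c. c < D ^ k \<and> exp (- (real k * (R1 * ln 2))) \<le> spectrum_pow D l k c}"
      have typical: "real (card S) \<le> 2 powr (real k * R1)" "1 - \<theta> ^ k \<le> (\<Sum>c\<in>S. spectrum_pow D l k c)"
        unfolding S_def \<theta>_def by (rule spectrum_pow_typical[OF l_nonneg l_sum s(1)]; assumption)+
      have "real k * R1 \<le> real n * R"
      proof -
        have "real m * R1 / (real m * R - R1) < real n" using n n0 by linarith
        then have "real m * R1 < real n * (real m * R - R1)" using R1(2) by (simp add: field_simps)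
        then have "(real n / real m + 1) * R1 \<le> real n * R" using m by (simp add: field_simps)
        moreover have "real k \<le> real n / real m + 1" by (simp add: k_def of_nat_div_le_of_nat)
        ultimately show ?thesis using R1pos by (meson mult_right_mono less_imp_le order_trans)
      qed
      also have "real n * R \<le> real N" by (simp add: N_def real_nat_ceiling_ge)
      finally have "2 powr (real k * R1) \<le> 2 powr real N" by simp
      also have "2 powr real N = real (2 ^ N)" by (simp add: powr_realpow)
      finally have card: "card S \<le> 2 ^ N" using typical(1) order_trans of_nat_le_iff by metis
      have "n < m * k" using m by (simp add: k_def dividend_less_times_div)
      then obtain x where x: "m * k = n + x" using less_imp_add_positive by metis
      have "purification_spectrum ((a ^ m) ^ k) ((b ^ m) ^ k) (tensor_pow (a ^ m, b ^ m, 1) (?T m) k) (D ^ k) (spectrum_pow D l k)"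
        by (rule purification_spectrum_pow[OF l])
      moreover have "tensor_pow (a ^ m, b ^ m, 1) (?T m) k = tensor3 (a ^ n, b ^ n, 1) (?T n) (a ^ x, b ^ x, 1) (?T x)"
        using tensor_pow_mult[of a b 1 _ m k] tensor_pow_add[of a b 1 _ n x] by (simp add: x)
      ultimately have "purification_spectrum (a ^ n * a ^ x) (b ^ n * b ^ x)
          (tensor3 (a ^ n, b ^ n, 1) (?T n) (a ^ x, b ^ x, 1) (?T x)) (D ^ k) (spectrum_pow D l k)"
        by (simp add: power_mult[symmetric] x power_add)
      then have spec: "purification_spectrum (a ^ n) (b ^ n) (?T n) (D ^ k) (spectrum_pow D l k)"
        by (rule purification_spectrum_partial) (use norm[of x] in \<open>auto simp: normalized_state_def\<close>)
      obtain \<eta> where \<eta>: "\<eta> \<in> carrier_vec (a ^ n * b ^ n * e ^ n)" "tensor_pow (a, b, e) (proj \<psi>) n = proj \<eta>"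
        using tensor_pow_proj[OF \<psi>] by blast
      have "convertible (2 * sqrt (2 * (1 - (\<Sum>c\<in>S. spectrum_pow D l k c)))) (2 ^ N, 2 ^ N, 1) (max_entangled (2 ^ N))
         (a ^ n, b ^ n, e ^ n) (proj \<eta>)"
      proof (rule convertible_of_spectrum[OF \<eta>(1)])
        show "purification_spectrum (a ^ n) (b ^ n) (ptrace (a ^ n * b ^ n) (e ^ n) 1 (proj \<eta>)) (D ^ k) (spectrum_pow D l k)"
          using spec by (simp add: \<eta>(2)[symmetric] ptrace_tensor_pow[simplified])
        show "(\<Sum>c<D ^ k. spectrum_pow D l k c) = 1" by (simp add: sum_spectrum_pow l_sum)
        show "0 < spectrum_pow D l k c" if "c \<in> S" for c
          using that by (auto simp: S_def intro: less_le_trans[OF exp_gt_zero])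
        show "0 < (\<Sum>c\<in>S. spectrum_pow D l k c)" using typical(2) \<theta>k1 by linarith
      qed (use \<open>0 < e\<close> card in \<open>auto simp: S_def\<close>)
      moreover have "2 * sqrt (2 * (1 - (\<Sum>c\<in>S. spectrum_pow D l k c))) \<le> \<epsilon>"
      proof -
        have "2 * (1 - (\<Sum>c\<in>S. spectrum_pow D l k c)) \<le> (\<epsilon> / 2)\<^sup>2"
          using typical(2) \<theta>k by (simp add: power_divide)
        then have "sqrt (2 * (1 - (\<Sum>c\<in>S. spectrum_pow D l k c))) \<le> \<epsilon> / 2"
          using \<epsilon> by (intro real_le_lsqrt) auto
        then show ?thesis by simp
      qed
      ultimately show "convertible \<epsilon> (dims_pow unit_dims (nat \<lceil>real n * R\<rceil>))
        (tensor_pow unit_dims unit_state (nat \<lceil>real n * R\<rceil>)) (dims_pow (a, b, e) n) (tensor_pow (a, b, e) (proj \<psi>) n)"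
        using convertible_mono by (simp add: N_def[symmetric] tensor_pow_unit_state \<eta>(2) dims_pow_eq unit_dims_def[symmetric])
          (simp add: unit_dims_def dims_pow_eq)
    qed
  qed
  then show ?thesis using R by (simp add: achievable_dilution_def)
qed

lemma normalized_state_tensor_pow:
  assumes "normalized_state a b \<tau>"
  shows "normalized_state (a ^ n) (b ^ n) (tensor_pow (a, b, 1) \<tau> n)"
proof (induction n)
  case 0
  obtain D l where "purification_spectrum a b \<tau> D l" using assms by (auto simp: normalized_state_def)
  from purification_spectrum_pow[OF this, of 0] show ?case
    by (auto simp: normalized_state_def mtrace_def)
next
  case (Suc n)
  from normalized_state_tensor[OF this assms] show ?case
    by (simp add: dims_pow_eq power_Suc2 del: power_Suc)
qed

theorem theorem9:
  fixes a b e :: nat and \<psi> :: "complex vec"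
  assumes "\<psi> \<in> carrier_vec (total_dim (a, b, e))"
    and "\<psi> \<bullet>c \<psi> = 1"
  shows "nonMarkovianity_cost (a, b, e) (proj \<psi>) \<le> ereal (E_P_reg a b (ptrace (a * b) e 1 (proj \<psi>)))"
proof -
  let ?\<tau> = "ptrace (a * b) e 1 (proj \<psi>)"
  let ?f = "\<lambda>n. E_P (a ^ n) (b ^ n) (tensor_pow (a, b, 1) ?\<tau> n)"
  have \<psi>: "\<psi> \<in> carrier_vec (a * b * e)" using assms(1) by simp
  have e: "0 < e" using assms \<psi> by (auto simp: scalar_prod_def intro!: Nat.gr0I)
  have "mtrace ?\<tau> = (\<Sum>x<a * b. \<Sum>k<e. \<psi> $ (x * e + k) * cnj (\<psi> $ (x * e + k)))"
    using \<psi> ptrace_carrier[of "a * b" e 1 "proj \<psi>"]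
    by (simp add: mtrace_def ptrace_last_index[simplified] proj_def mult_add_less)
  also have "\<dots> = \<psi> \<bullet>c \<psi>" using \<psi> by (simp add: scalar_prod_def sum_lessThan_mult atLeast0LessThan)
  finally have "mtrace ?\<tau> = 1" using assms(2) by simp
  moreover obtain D l where "purification_spectrum a b ?\<tau> D l" by (rule purification_spectrum_exists[OF \<psi>])
  ultimately have "normalized_state a b ?\<tau>"
    using ptrace_carrier[of "a * b" e 1 "proj \<psi>"]
    by (auto simp: normalized_state_def)
  then have norm: "normalized_state (a ^ n) (b ^ n) (tensor_pow (a, b, 1) ?\<tau> n)" for n
    by (rule normalized_state_tensor_pow)
  have nonneg: "0 \<le> ?f n" for n by (rule E_P_nonneg[OF norm])
  have "?f (m + n) \<le> ?f m + ?f n" for m n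
    using E_P_tensor_le[OF norm[of m] norm[of n]] tensor_pow_add[of a b 1 ?\<tau> m n] by (simp add: power_add)
  then have "convergent (\<lambda>n. ?f n / real n)" by (intro subadditive_convergent nonneg)
  then have lim: "(\<lambda>n. ?f n / real n) \<longlonglongrightarrow> E_P_reg a b ?\<tau>"
    unfolding E_P_reg_def by (simp add: convergent_LIMSEQ_iff)
  \<comment> \<open>A rate strictly above the limit exceeds the quotient at some block length
    \<open>m\<close>, and that single block already gives achievability.\<close>
  have bound: "nonMarkovianity_cost (a, b, e) (proj \<psi>) \<le> ereal R" if "E_P_reg a b ?\<tau> < R" for R
  proof -
    have "\<forall>\<^sub>F n in sequentially. ?f n / real n < R \<and> 0 < n"
      using order_tendstoD(2)[OF lim that] eventually_gt_at_top[of 0] by eventually_elim auto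
    then obtain m where "0 < m" "?f m / real m < R"
      by (metis (mono_tags, lifting) eventually_happens' sequentially_bot)
    then have "0 < m" "?f m < real m * R" by (simp_all add: field_simps)
    then have "achievable_dilution (a, b, e) (proj \<psi>) R"
      by (rule achievable_dilution_of_block[OF \<psi> e norm])
    then show ?thesis unfolding nonMarkovianity_cost_def by (intro Inf_lower) auto
  qed
  show ?thesis
  \<comment> \<open>Rates strictly above the regularized quantity suffice, since the cost is an
    infimum and the order of the extended reals is dense.\<close>
  proof (rule dense_ge)
    fix x assume "ereal (E_P_reg a b ?\<tau>) < x"
    then show "nonMarkovianity_cost (a, b, e) (proj \<psi>) \<le> x" using bound by (cases x) auto
  qed
qed

end
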